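(* Let $\alpha>0$, $\mu\in\mathbb R$, let $(\phi,\Omega_\alpha)$ be a subdyadic frame pair, and let $m:\mathbb R^d\setminus\{0\}\to\mathbb C$ be supported in $\{|\xi|^\alpha\ge1\}$ and satisfy the high-frequency Hörmander–Miyachi condition of order $\mu$. With $\widehat{T_mf}=m\widehat f$, set $$\mathcal G^m_{(j',k'),(j,k)}:=\big\langle T_m\phi_{x_j^k,\xi_k},\phi_{x_{j'}^{k'},\xi_{k'}}\big\rangle .$$ Then: 1. If the Fourier supports of the $k$-th and $k'$-th packet families do not intersect, then $\mathcal G^m_{(j',k'),(j,k)}=0$ for all $j,j'$. Consequently each frequency index interacts with only uniformly finitely many other frequency indices. 2. Whenever the two frequency supports intersect, $$\sup_{j\in\mathbb Z^d}\sum_{j'\in\mathbb Z^d}\big|\mathcal G^m_{(j',k'),(j,k)}\big|+\sup_{j'\in\mathbb Z^d}\sum_{j\in\mathbb Z^d}\big|\mathcal G^m_{(j',k'),(j,k)}\big|\lesssim(1+|\xi_k|)^{-\mu},$$ with a constant independent of $k,k'$. 3. Consequently, for every $1\le p,q\le\infty$ and every $\beta\in\mathbb R$, the matrix $\mathcal G^m$ defines a bounded operator $$\mathcal G^m:\ell^q(\ell^p;w_{\beta-\mu})\longrightarrow\ell^q(\ell^p;w_\beta).$$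
   Context: Conventions: $\widehat f(\eta)=\int_{\mathbb R^d}f(t)e^{-it\cdot\eta}\,dt$; $\langle f,g\rangle=\int f\overline g$; $B(c,r)$ is a Euclidean ball. Subdyadic lattice at scale $\rho\in(0,\rho_0]$. Here $\rho_0,a>0$ are fixed sufficiently small constants and $b>0$ a fixed constant, depending only on $d,\alpha$. For $n\in\mathbb N_0$ let $A_n=\{2^n\le|\xi|<2^{n+1}\}$, $h_n=\rho2^{n(1-\alpha)}$. Partition $\mathbb R^d$ into half-open cubes of side $h_n$ and choose one point of $A_n$ in each cube meeting $A_n$ (candidates). Order all candidates first by $n$ and arbitrarily inside each annulus, and process them in this order, retaining a candidate $\xi$ exactly when the ball $\{|\eta-\xi|<a\rho|\xi|^{1-\alpha}\}$ is disjoint from all such balls of previously retained candidates. Enumerate the retained points as $\{\xi_k\}_{k\in\mathbb N}$ and set $x_j^k=b\rho|\xi_k|^{\alpha-1}j$, $j\in\mathbb Z^d$; $\Omega_\alpha=\{(x_j^k,\xi_k)\}$. There is a constant $A_{\mathrm{cov}}>1$ depending only on $d,\alpha$ such that the balls $\{|\eta-\xi_k|\le A_{\mathrm{cov}}\rho|\xi_k|^{1-\alpha}\}$ cover $\{|\eta|\ge1\}$. Subdyadic frame pair $(\phi,\Omega_\alpha)$: $\phi\in\mathcal S(\mathbb R^d)$ is real-valued, even, $L^2$-normalized, with $\widehat\phi\in C_c^\infty$, $\operatorname{supp}\widehat\phi\subset B(0,R_1)$, $|\widehat\phi|\ge m_0>0$ on $\{|\zeta|\le R_0\}$, where $3\cdot2^{\max\{\alpha-1,0\}}<R_0<R_1$;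 and $\Omega_\alpha$ is a subdyadic lattice at a scale $\rho_\ast\le\rho_0$, i.e. $\Omega_\alpha=\{(x_j^k,\xi_k):k\in\mathbb N,\ j\in\mathbb Z^d\}$ where the $\xi_k$ are the centers retained by the selection procedure run with $\rho=\rho_\ast$ and $x_j^k=b\rho_\ast|\xi_k|^{\alpha-1}j$, with $A_{\mathrm{cov}}\rho_\ast<R_0$ and $b\rho_\ast R_1<\pi$. Packets: $\phi_{x,\xi}(t)=|\xi|^{\frac d2(1-\alpha)}\phi((t-x)|\xi|^{1-\alpha})e^{it\cdot\xi}$. All packets $\phi_{x_j^k,\xi_k}$ with the same $k$ (the $k$-th packet family) have the same Fourier support $\{\eta:(\eta-\xi_k)/|\xi_k|^{1-\alpha}\in\operatorname{supp}\widehat\phi\}$. Hörmander–Miyachi condition of order $\mu$: with $N_d=\lfloor d/2\rfloor+1$, for all multi-indices $|\gamma|\le N_d$, $$\sup_B\ \operatorname{dist}(B,0)^{\mu+(1-\alpha)|\gamma|}\Big(\frac1{|B|}\int_B|D^\gamma m(\xi)|^2\,d\xi\Big)^{1/2}<\infty,$$ the supremum being over all $\alpha$-subdyadic balls $B$, i.e. Euclidean balls with $\operatorname{dist}(B,0)^\alpha\ge1$ and radius $r(B)\sim\operatorname{dist}(B,0)^{1-\alpha}$, where $\operatorname{dist}(B,0)$ is the distance from the center of $B$ to the origin. Here $\sim$ means comparable up to fixed constants, $\kappa^{-1}\le r(B)/\operatorname{dist}(B,0)^{1-\alpha}\le\kappa$, and the supremum is finite for each fixed $\kappa\ge1$. Derivatives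 are weak derivatives. Sequence spaces: $w_\sigma(\xi)=(1+|\xi|)^\sigma$, and $\ell^q(\ell^p;w_\sigma)$ is the space of $c=(c_{j,k})_{j\in\mathbb Z^d,k\in\mathbb N}$ with norm $\big(\sum_k(\sum_j|c_{j,k}|^p)^{q/p}w_\sigma(\xi_k)^q\big)^{1/q}$ (suprema if $p$ or $q$ is infinite). The matrix acts by $(\mathcal G^mc)_{j',k'}=\sum_{j,k}\mathcal G^m_{(j',k'),(j,k)}c_{j,k}$. *)

theory Defs
  imports "HOL-Analysis.Analysis" "HOL-Library.Disjoint_Sets"
begin

section \<open>Partial derivatives, smooth and Schwartz functions\<close>

definition partial_deriv ::
    "'n \<Rightarrow> (real^'n \<Rightarrow> 'b::real_normed_vector) \<Rightarrow> real^'n \<Rightarrow> 'b" where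
  "partial_deriv i f x = vector_derivative (\<lambda>t. f (x + t *\<^sub>R axis i 1)) (at 0)"

primrec iter_partial ::
    "'n list \<Rightarrow> (real^'n \<Rightarrow> 'b::real_normed_vector) \<Rightarrow> real^'n \<Rightarrow> 'b" where
  "iter_partial [] f = f"
| "iter_partial (i # is) f = partial_deriv i (iter_partial is f)"

text \<open>Smoothness: all iterated partial derivatives are (totally) differentiable. They are then
  continuous, so this is the class of \<open>C\<close>-infinity functions.\<close>

definition smooth :: "(real^'n \<Rightarrow> 'b::real_normed_vector) \<Rightarrow> bool" where
  "smooth f \<longleftrightarrow> (\<forall>is. iter_partial is f differentiable_on UNIV)"

definition multi_order :: "('n::finite \<Rightarrow> nat) \<Rightarrow> nat" where
  "multi_order \<gamma> = (\<Sum>i\<in>UNIV. \<gamma> i)"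

text \<open>The index type carries no order, so the order of differentiation is chosen by \<open>SOME\<close>;
  for smooth functions, the only ones to which it is applied, it does not matter.\<close>

definition multi_deriv ::
    "('n \<Rightarrow> nat) \<Rightarrow> (real^'n \<Rightarrow> 'b::real_normed_vector) \<Rightarrow> real^'n \<Rightarrow> 'b" where
  "multi_deriv \<gamma> f = iter_partial (SOME is. \<forall>i. count_list is i = \<gamma> i) f"

definition schwartz :: "(real^'n \<Rightarrow> 'b::real_normed_vector) \<Rightarrow> bool" where
  "schwartz f \<longleftrightarrow> smooth f \<and>
     (\<forall>N \<gamma>. bounded (range (\<lambda>x. (1 + norm x) ^ N *\<^sub>R multi_deriv \<gamma> f x)))"

definition supp :: "('a::topological_space \<Rightarrow> 'b::zero) \<Rightarrow> 'a set" where
  "supp f = closure {x. f x \<noteq> 0}"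

definition test_function :: "(real^'n) set \<Rightarrow> (real^'n \<Rightarrow> complex) \<Rightarrow> bool" where
  "test_function U \<psi> \<longleftrightarrow> smooth \<psi> \<and> compact (supp \<psi>) \<and> supp \<psi> \<subseteq> U"

definition locally_integrable_on :: "(real^'n \<Rightarrow> complex) \<Rightarrow> (real^'n) set \<Rightarrow> bool" where
  "locally_integrable_on f U \<longleftrightarrow> (\<forall>K. compact K \<and> K \<subseteq> U \<longrightarrow> set_integrable lebesgue K f)"

definition weak_deriv ::
    "(real^'n) set \<Rightarrow> ('n \<Rightarrow> nat) \<Rightarrow> (real^'n \<Rightarrow> complex) \<Rightarrow> (real^'n \<Rightarrow> complex) \<Rightarrow> bool" where
  "weak_deriv U \<gamma> f g \<longleftrightarrow>
     locally_integrable_on f U \<and> locally_integrable_on g U \<and>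
     (\<forall>\<psi>. test_function U \<psi> \<longrightarrow>
        (LINT x|lebesgue. f x * multi_deriv \<gamma> \<psi> x) =
          (-1) ^ multi_order \<gamma> * (LINT x|lebesgue. g x * \<psi> x))"


section \<open>Fourier transform and multiplier operators\<close>

definition fourier :: "(real^'n \<Rightarrow> complex) \<Rightarrow> real^'n \<Rightarrow> complex" where
  "fourier f \<eta> = (LINT t|lebesgue. f t * cis (- (t \<bullet> \<eta>)))"

definition inv_fourier :: "(real^'n \<Rightarrow> complex) \<Rightarrow> real^'n \<Rightarrow> complex" where
  "inv_fourier g t = (LINT \<eta>|lebesgue. g \<eta> * cis (t \<bullet> \<eta>)) / complex_of_real ((2 * pi) ^ CARD('n))"

text \<open>The operator whose Fourier transform is \<open>m\<close> times that of \<open>f\<close>. Below, \<open>f\<close> is a packet,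
  so its Fourier transform is smooth with compact support and, for the symbols considered,
  the product is an integrable (and square integrable) function.\<close>

definition multiplier_op ::
    "(real^'n \<Rightarrow> complex) \<Rightarrow> (real^'n \<Rightarrow> complex) \<Rightarrow> real^'n \<Rightarrow> complex" where
  "multiplier_op m f = inv_fourier (\<lambda>\<eta>. m \<eta> * fourier f \<eta>)"

definition l2_inner :: "(real^'n \<Rightarrow> complex) \<Rightarrow> (real^'n \<Rightarrow> complex) \<Rightarrow> complex" where
  "l2_inner f g = (LINT t|lebesgue. f t * cnj (g t))"


section \<open>Subdyadic lattices\<close>

definition annulus :: "nat \<Rightarrow> (real^'n) set" where
  "annulus n = {\<xi>. 2 ^ n \<le> norm \<xi> \<and> norm \<xi> < 2 ^ (n + 1)}"

definition half_open_cube :: "real^'n \<Rightarrow> real \<Rightarrow> (real^'n) set" where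
  "half_open_cube v h = {x. \<forall>i. v $ i \<le> x $ i \<and> x $ i < v $ i + h}"

text \<open>\<open>C n\<close> is a possible set of candidates in the \<open>n\<close>-th annulus.\<close>

definition candidate_sets :: "real \<Rightarrow> real \<Rightarrow> (nat \<Rightarrow> (real^'n) set) \<Rightarrow> bool" where
  "candidate_sets \<alpha> \<rho> C \<longleftrightarrow>
     (\<forall>n. \<exists>P p. partition_on UNIV P \<and>
        (\<forall>Q\<in>P. \<exists>v. Q = half_open_cube v (\<rho> * 2 powr (real n * (1 - \<alpha>)))) \<and>
        (\<forall>Q\<in>P. Q \<inter> annulus n \<noteq> {} \<longrightarrow> p Q \<in> Q \<inter> annulus n) \<and>
        C n = p ` {Q \<in> P. Q \<inter> annulus n \<noteq> {}})"

text \<open>Each candidate set is finite and nonempty and the annuli are disjoint, so an ordering of all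
  candidates that respects the index of the annulus is an enumeration by \<open>nat\<close>.\<close>

definition candidate_order :: "(nat \<Rightarrow> (real^'n) set) \<Rightarrow> (nat \<Rightarrow> real^'n) \<Rightarrow> bool" where
  "candidate_order C c \<longleftrightarrow> bij_betw c UNIV (\<Union>n. C n) \<and>
     (\<forall>i j n n'. i < j \<and> c i \<in> C n \<and> c j \<in> C n' \<longrightarrow> n \<le> n')"

definition exclusion_ball :: "real \<Rightarrow> real \<Rightarrow> real \<Rightarrow> real^'n \<Rightarrow> (real^'n) set" where
  "exclusion_ball \<alpha> a \<rho> \<xi> = ball \<xi> (a * \<rho> * norm \<xi> powr (1 - \<alpha>))"

text \<open>The points retained after the first \<open>N\<close> candidates have been processed.\<close>

primrec retained ::
    "real \<Rightarrow> real \<Rightarrow> real \<Rightarrow> (nat \<Rightarrow> real^'n) \<Rightarrow> nat \<Rightarrow> (real^'n) set" where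
  "retained \<alpha> a \<rho> c 0 = {}"
| "retained \<alpha> a \<rho> c (Suc N) =
     (if \<forall>\<xi> \<in> retained \<alpha> a \<rho> c N. exclusion_ball \<alpha> a \<rho> (c N) \<inter> exclusion_ball \<alpha> a \<rho> \<xi> = {}
      then insert (c N) (retained \<alpha> a \<rho> c N) else retained \<alpha> a \<rho> c N)"

definition subdyadic_centers :: "real \<Rightarrow> real \<Rightarrow> real \<Rightarrow> (nat \<Rightarrow> real^'n) \<Rightarrow> bool" where
  "subdyadic_centers \<alpha> a \<rho> \<xi> \<longleftrightarrow>
     (\<exists>C c. candidate_sets \<alpha> \<rho> C \<and> candidate_order C c \<and>
        bij_betw \<xi> UNIV (\<Union>N. retained \<alpha> a \<rho> c N))"

definition lattice_point :: "real \<Rightarrow> real \<Rightarrow> real \<Rightarrow> real^'n \<Rightarrow> int^'n \<Rightarrow> real^'n" where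
  "lattice_point \<alpha> b \<rho> \<xi> j = (b * \<rho> * norm \<xi> powr (\<alpha> - 1)) *\<^sub>R (\<chi> i. real_of_int (j $ i))"

text \<open>The covering property that singles out the constant \<open>Acov\<close>; it is uniform over all scales
  up to \<open>\<rho>0\<close> and over all outcomes of the selection procedure.\<close>

definition covering_constant :: "'n::finite itself \<Rightarrow> real \<Rightarrow> real \<Rightarrow> real \<Rightarrow> real \<Rightarrow> bool" where
  "covering_constant (_ :: 'n::finite itself) \<alpha> \<rho>0 a Acov \<longleftrightarrow>
     (\<forall>\<rho> (\<xi> :: nat \<Rightarrow> real^'n). 0 < \<rho> \<and> \<rho> \<le> \<rho>0 \<and> subdyadic_centers \<alpha> a \<rho> \<xi> \<longrightarrow>
        {\<eta>. 1 \<le> norm \<eta>} \<subseteq> (\<Union>k. cball (\<xi> k) (Acov * \<rho> * norm (\<xi> k) powr (1 - \<alpha>))))"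


section \<open>Frame pairs and packets\<close>

text \<open>The lattice of the pair is the family of points \<open>(lattice_point \<alpha> b \<rho> (\<xi> k) j, \<xi> k)\<close>; it is
  represented by its scale \<open>\<rho>\<close> and its enumerated centers \<open>\<xi>\<close>.\<close>

definition subdyadic_frame_pair ::
    "real \<Rightarrow> real \<Rightarrow> real \<Rightarrow> real \<Rightarrow> real \<Rightarrow> (real^'n \<Rightarrow> real) \<Rightarrow> real \<Rightarrow> (nat \<Rightarrow> real^'n) \<Rightarrow> bool" where
  "subdyadic_frame_pair \<alpha> \<rho>0 a b Acov \<phi> \<rho> \<xi> \<longleftrightarrow>
     schwartz \<phi> \<and> (\<forall>t. \<phi> (- t) = \<phi> t) \<and> (LINT t|lebesgue. (\<phi> t)\<^sup>2) = 1 \<and>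
     0 < \<rho> \<and> \<rho> \<le> \<rho>0 \<and> subdyadic_centers \<alpha> a \<rho> \<xi> \<and>
     (let F = fourier (\<lambda>t. complex_of_real (\<phi> t)) in
        test_function UNIV F \<and>
        (\<exists>R0 R1 m0. 3 * 2 powr max (\<alpha> - 1) 0 < R0 \<and> R0 < R1 \<and> 0 < m0 \<and>
           supp F \<subseteq> ball 0 R1 \<and> (\<forall>\<zeta>. norm \<zeta> \<le> R0 \<longrightarrow> m0 \<le> cmod (F \<zeta>)) \<and>
           Acov * \<rho> < R0 \<and> b * \<rho> * R1 < pi))"

definition packet :: "real \<Rightarrow> (real^'n \<Rightarrow> real) \<Rightarrow> real^'n \<Rightarrow> real^'n \<Rightarrow> real^'n \<Rightarrow> complex" where
  "packet \<alpha> \<phi> x \<xi> t =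
     complex_of_real (norm \<xi> powr (real CARD('n) / 2 * (1 - \<alpha>)) *
       \<phi> (norm \<xi> powr (1 - \<alpha>) *\<^sub>R (t - x))) * cis (t \<bullet> \<xi>)"

definition family_fourier_supp :: "real \<Rightarrow> (real^'n \<Rightarrow> real) \<Rightarrow> real^'n \<Rightarrow> (real^'n) set" where
  "family_fourier_supp \<alpha> \<phi> \<xi> =
     {\<eta>. (1 / norm \<xi> powr (1 - \<alpha>)) *\<^sub>R (\<eta> - \<xi>) \<in> supp (fourier (\<lambda>t. complex_of_real (\<phi> t)))}"


section \<open>The Hoermander--Miyachi condition\<close>

text \<open>The symbol is a function on the complement of the origin, hence weak derivatives are taken
  there. The balls are those centred at \<open>c\<close> with radius \<open>r\<close>; note that \<open>dist(B,0)\<close> in the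
  definition of a subdyadic ball is the distance of the center to the origin. Requiring
  integrability excludes the convention that a nonexistent integral is zero.\<close>

definition hoermander_miyachi :: "real \<Rightarrow> real \<Rightarrow> (real^'n \<Rightarrow> complex) \<Rightarrow> bool" where
  "hoermander_miyachi \<alpha> \<mu> m \<longleftrightarrow>
     (\<forall>\<gamma>. multi_order \<gamma> \<le> CARD('n) div 2 + 1 \<longrightarrow>
        (\<exists>g. weak_deriv (- {0}) \<gamma> m g \<and>
           (\<forall>\<kappa>\<ge>1. \<exists>C. \<forall>c r.
              norm c powr \<alpha> \<ge> 1 \<and> 1 / \<kappa> \<le> r / norm c powr (1 - \<alpha>) \<and> r / norm c powr (1 - \<alpha>) \<le> \<kappa> \<longrightarrow>
              set_integrable lebesgue (ball c r) (\<lambda>\<xi>. (cmod (g \<xi>))\<^sup>2) \<and>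
              norm c powr (\<mu> + (1 - \<alpha>) * real (multi_order \<gamma>)) *
                sqrt ((LINT \<xi>:ball c r|lebesgue. (cmod (g \<xi>))\<^sup>2) / measure lebesgue (ball c r)) \<le> C)))"


section \<open>The matrix and the sequence spaces\<close>

definition gram ::
    "real \<Rightarrow> real \<Rightarrow> real \<Rightarrow> (real^'n \<Rightarrow> real) \<Rightarrow> (nat \<Rightarrow> real^'n) \<Rightarrow> (real^'n \<Rightarrow> complex) \<Rightarrow>
     int^'n \<Rightarrow> nat \<Rightarrow> int^'n \<Rightarrow> nat \<Rightarrow> complex" where
  "gram \<alpha> b \<rho> \<phi> \<xi> m j' k' j k =
     l2_inner (multiplier_op m (packet \<alpha> \<phi> (lattice_point \<alpha> b \<rho> (\<xi> k) j) (\<xi> k)))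
              (packet \<alpha> \<phi> (lattice_point \<alpha> b \<rho> (\<xi> k') j') (\<xi> k'))"

definition ennreal_powr :: "ennreal \<Rightarrow> real \<Rightarrow> ennreal" where
  "ennreal_powr x r = (if x = \<infinity> then \<infinity> else ennreal (enn2real x powr r))"

text \<open>Used only for \<open>1 \<le> p \<le> \<infinity>\<close>. The value \<open>\<infinity>\<close> means that the sequence is not in the space.\<close>

definition lp_norm :: "ennreal \<Rightarrow> ('i \<Rightarrow> ennreal) \<Rightarrow> ennreal" where
  "lp_norm p u =
     (if p = \<infinity> then (SUP i. u i)
      else ennreal_powr (\<Sum>\<^sub>\<infinity>i. ennreal_powr (u i) (enn2real p)) (1 / enn2real p))"

definition mixed_norm ::
    "ennreal \<Rightarrow> ennreal \<Rightarrow> real \<Rightarrow> (nat \<Rightarrow> real^'n) \<Rightarrow> (int^'n \<Rightarrow> nat \<Rightarrow> complex) \<Rightarrow> ennreal" where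
  "mixed_norm q p \<sigma> \<xi> c =
     lp_norm q (\<lambda>k. lp_norm p (\<lambda>j. ennreal (cmod (c j k))) * ennreal ((1 + norm (\<xi> k)) powr \<sigma>))"

definition matrix_apply ::
    "('j \<Rightarrow> 'k \<Rightarrow> 'j \<Rightarrow> 'k \<Rightarrow> complex) \<Rightarrow> ('j \<Rightarrow> 'k \<Rightarrow> complex) \<Rightarrow> 'j \<Rightarrow> 'k \<Rightarrow> complex" where
  "matrix_apply M c j' k' = (\<Sum>\<^sub>\<infinity>(j, k)\<in>UNIV. M j' k' j k * c j k)"

text \<open>The matrix acts on every element of the domain by unconditionally convergent sums (so the
  action is linear) and is bounded with respect to the two norms.\<close>

definition bounded_matrix_operator ::
    "('j \<Rightarrow> 'k \<Rightarrow> 'j \<Rightarrow> 'k \<Rightarrow> complex) \<Rightarrow> (('j \<Rightarrow> 'k \<Rightarrow> complex) \<Rightarrow> ennreal) \<Rightarrow>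
     (('j \<Rightarrow> 'k \<Rightarrow> complex) \<Rightarrow> ennreal) \<Rightarrow> bool" where
  "bounded_matrix_operator M N1 N2 \<longleftrightarrow>
     (\<exists>B::real. \<forall>c. N1 c < \<infinity> \<longrightarrow>
        (\<forall>j' k'. (\<lambda>(j, k). M j' k' j k * c j k) summable_on UNIV) \<and>
        N2 (matrix_apply M c) \<le> ennreal B * N1 c)"

end

theory Submission
  imports Defs
begin

text \<open>
  By Fubini's theorem the matrix entries are, up to normalization and a unimodular factor, Fourier
  integrals of \<open>m\<close> times the product of the two rescaled bumps, evaluated at the difference of
  the two lattice points; in particular they vanish if the bumps have disjoint supports. The centers
  that interact with a given one have comparable norms, so the disjointness of the exclusion balls
  bounds their number by a volume comparison. For interacting families the product lives in a cube
  whose side is a common period of the exponentials indexed by the lattice, because \<open>b * \<rho> * R1 < pi\<close>. Hence Bessel's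
  inequality for exponentials controls the square sum of the entries, and, after moving
  \<open>d div 2 + 1\<close> pure derivatives onto the product, also the square sum weighted by that power of
  the rescaled distance. Only the L2 averages of the weak derivatives over balls enter here. The
  Cauchy-Schwarz inequality turns this into the row and column bounds, and two applications of the
  Schur test, one to each block and one to the band of interacting blocks, give boundedness on the
  mixed norm spaces.
\<close>

section \<open>Calculus of smooth functions\<close>

text \<open>All estimates are made at the scale \<open>s = freq_scale \<alpha> (\<xi> k)\<close>. A
  derivative costs \<open>1 / s\<close> on the bumps and on the averaged symbol alike, so weighting
  by the \<open>N\<close>-th power of \<open>s\<close> times a coordinate loses nothing.
  \<open>N = d div 2 + 1\<close> is the least integer with \<open>2 * N > d\<close>, which makes the
  reciprocal weights summable over a lattice of fixed spacing. The period cube and the volume of the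
  ball together contribute \<open>s ^ d\<close>, which the L2 normalizations of the two packets
  cancel.

  Three obstacles shape the details. The symbol has only weak derivatives, so the product rule is
  rearranged until every term is a derivative of a test function that already contains the
  exponential. These weak derivatives live off the origin, so a cutoff enters; its derivatives have
  size 1 instead of \<open>1 / s\<close>, which matters only for centers of bounded norm. Finally,
  Bessel's inequality needs the lattice of the center around which the supporting ball is taken, so
  the sum over \<open>j'\<close> is localized at \<open>\<xi> k'\<close> and the sum over
  \<open>j\<close> at \<open>\<xi> k\<close>.\<close>

abbreviation pure_deriv :: "'n \<Rightarrow> nat \<Rightarrow> (real^'n \<Rightarrow> complex) \<Rightarrow> real^'n \<Rightarrow> complex" where
  "pure_deriv i n \<equiv> iter_partial (replicate n i)"

abbreviation freq_scale :: "real \<Rightarrow> 'a::real_normed_vector \<Rightarrow> real" where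
  "freq_scale \<alpha> x \<equiv> norm x powr (1 - \<alpha>)"

abbreviation rescale :: "real \<Rightarrow> ('a::real_normed_vector \<Rightarrow> 'b) \<Rightarrow> 'a \<Rightarrow> 'a \<Rightarrow> 'b" where
  "rescale \<alpha> F x \<eta> \<equiv> F ((1 / freq_scale \<alpha> x) *\<^sub>R (\<eta> - x))"

text \<open>A relaxation of "the Fourier supports meet": each support lies in such a ball, and
  comparing or counting centers uses only the balls.\<close>

abbreviation interacting :: "real \<Rightarrow> real \<Rightarrow> 'a::real_normed_vector \<Rightarrow> 'a \<Rightarrow> bool" where
  "interacting \<alpha> R x y \<equiv>
     \<exists>\<eta>. norm (\<eta> - x) \<le> R * freq_scale \<alpha> x \<and> norm (\<eta> - y) \<le> R * freq_scale \<alpha> y"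

abbreviation multiplier_integral ::
    "(real^'n \<Rightarrow> complex) \<Rightarrow> (real^'n \<Rightarrow> complex) \<Rightarrow> real^'n \<Rightarrow> complex" where
  "multiplier_integral m \<Phi> y \<equiv> LINT x|lebesgue. m x * (\<Phi> x * cis (y \<bullet> x))"

lemma has_vector_derivative_axis:
  assumes "(f has_derivative f') (at (x + s *\<^sub>R axis i 1))"
  shows "((\<lambda>t. f (x + t *\<^sub>R axis i 1)) has_vector_derivative f' (axis i 1)) (at s)"
proof -
  have "((\<lambda>t. f (x + t *\<^sub>R axis i 1)) has_derivative (\<lambda>t. f' (t *\<^sub>R axis i 1))) (at s)"
    by (rule has_derivative_compose[where g = f and f = "\<lambda>t. x + t *\<^sub>R axis i 1", simplified])
       (auto intro!: derivative_eq_intros assms)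
  then show ?thesis
    unfolding has_vector_derivative_def by (simp add: linear_cmul[OF has_derivative_linear[OF assms]])
qed

lemma partial_deriv_eqI:
  "(f has_derivative f') (at x) \<Longrightarrow> partial_deriv i f x = f' (axis i 1)"
  unfolding partial_deriv_def
  by (rule vector_derivative_at) (rule has_vector_derivative_axis[where s = 0, simplified])

lemma has_vector_derivative_line:
  assumes "f differentiable_on UNIV"
  shows "((\<lambda>t. f (x + t *\<^sub>R axis i 1)) has_vector_derivative
           partial_deriv i f (x + s *\<^sub>R axis i 1)) (at s)"
proof -
  obtain f' where f': "(f has_derivative f') (at (x + s *\<^sub>R axis i 1))"
    using assms by (auto simp: differentiable_on_def differentiable_def)
  show ?thesis unfolding partial_deriv_eqI[OF f'] by (rule has_vector_derivative_axis[OF f'])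
qed

lemma iter_partial_append: "iter_partial (xs @ ys) f = iter_partial xs (iter_partial ys f)"
  by (induction xs) auto

lemma smooth_differentiable_on: "smooth f \<Longrightarrow> f differentiable_on UNIV"
  unfolding smooth_def by (metis iter_partial.simps(1))

lemma smooth_partial_deriv: "smooth f \<Longrightarrow> smooth (partial_deriv i f)"
  unfolding smooth_def by (metis iter_partial.simps iter_partial_append)

lemma smooth_iter_partial: "smooth f \<Longrightarrow> smooth (iter_partial is f)"
  by (induction "is") (auto intro: smooth_partial_deriv)

lemma smooth_imp_continuous: "smooth f \<Longrightarrow> continuous_on UNIV f"
  by (intro differentiable_imp_continuous_on smooth_differentiable_on)

text \<open>Membership in an invariant class of differentiable functions passes through any list of
  directions, so smoothness can be shown without formulas for higher derivatives.\<close>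

lemma smooth_coinduct:
  assumes "f \<in> S"
    and "\<And>f. f \<in> S \<Longrightarrow> f differentiable_on UNIV"
    and "\<And>f i. f \<in> S \<Longrightarrow> partial_deriv i f \<in> S"
  shows "smooth f"
proof -
  have "iter_partial is f \<in> S" for "is"
    by (induction "is") (auto intro: assms)
  then show ?thesis unfolding smooth_def using assms(2) by blast
qed

lemma has_derivative_of_differentiable_on:
  "f differentiable_on UNIV \<Longrightarrow> (f has_derivative frechet_derivative f (at x)) (at x)"
  by (auto simp: differentiable_on_def frechet_derivative_works)

lemma partial_deriv_frechet:
  "f differentiable_on UNIV \<Longrightarrow> partial_deriv i f x = frechet_derivative f (at x) (axis i 1)"
  by (intro partial_deriv_eqI has_derivative_of_differentiable_on)

lemma partial_deriv_add:
  assumes "f differentiable_on UNIV" "g differentiable_on UNIV"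
  shows "partial_deriv i (\<lambda>x. f x + g x) = (\<lambda>x. partial_deriv i f x + partial_deriv i g x)"
proof
  fix x
  have "((\<lambda>x. f x + g x) has_derivative
      (\<lambda>h. frechet_derivative f (at x) h + frechet_derivative g (at x) h)) (at x)"
    by (intro has_derivative_add has_derivative_of_differentiable_on assms)
  from partial_deriv_eqI[OF this]
  show "partial_deriv i (\<lambda>x. f x + g x) x = partial_deriv i f x + partial_deriv i g x"
    using assms by (simp add: partial_deriv_frechet)
qed

lemma partial_deriv_mult:
  fixes f g :: "real^'n \<Rightarrow> complex"
  assumes "f differentiable_on UNIV" "g differentiable_on UNIV"
  shows "partial_deriv i (\<lambda>x. f x * g x) = (\<lambda>x. partial_deriv i f x * g x + f x * partial_deriv i g x)"
proof
  fix x
  have "((\<lambda>x. f x * g x) has_derivative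
      (\<lambda>h. f x * frechet_derivative g (at x) h + frechet_derivative f (at x) h * g x)) (at x)"
    by (intro has_derivative_mult has_derivative_of_differentiable_on assms)
  from partial_deriv_eqI[OF this]
  show "partial_deriv i (\<lambda>x. f x * g x) x = partial_deriv i f x * g x + f x * partial_deriv i g x"
    using assms by (simp add: partial_deriv_frechet)
qed

inductive_set smooth_algebra :: "(real^'n \<Rightarrow> complex) set \<Rightarrow> (real^'n \<Rightarrow> complex) set" for S where
  base: "f \<in> S \<Longrightarrow> f \<in> smooth_algebra S"
| smooth: "smooth f \<Longrightarrow> f \<in> smooth_algebra S"
| add: "f \<in> smooth_algebra S \<Longrightarrow> g \<in> smooth_algebra S \<Longrightarrow> (\<lambda>x. f x + g x) \<in> smooth_algebra S"
| mult: "f \<in> smooth_algebra S \<Longrightarrow> g \<in> smooth_algebra S \<Longrightarrow> (\<lambda>x. f x * g x) \<in> smooth_algebra S"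

text \<open>Coinduction up to sums and products: derivatives of the functions in question need only be
  polynomial expressions in them and in known smooth functions.\<close>

lemma smooth_coinduct_algebra:
  assumes "f \<in> smooth_algebra S"
    and S: "\<And>f. f \<in> S \<Longrightarrow> f differentiable_on UNIV"
    and S': "\<And>f i. f \<in> S \<Longrightarrow> partial_deriv i f \<in> smooth_algebra S"
  shows "smooth f"
proof (rule smooth_coinduct[where S = "smooth_algebra S"])
  show diff: "f differentiable_on UNIV" if "f \<in> smooth_algebra S" for f
    using that
    by induction (auto intro: S smooth_differentiable_on differentiable_on_add differentiable_on_mult)
  show "partial_deriv i f \<in> smooth_algebra S" if "f \<in> smooth_algebra S" for f i
    using that
    by induction (auto intro: S' smooth_algebra.intros smooth_partial_deriv
        simp: partial_deriv_add partial_deriv_mult diff)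
qed (fact assms(1))

lemma smooth_add:
  fixes f g :: "real^'n \<Rightarrow> complex"
  shows "smooth f \<Longrightarrow> smooth g \<Longrightarrow> smooth (\<lambda>x. f x + g x)"
  by (rule smooth_coinduct_algebra[where S = "{}"]) (auto intro: smooth_algebra.intros)

lemma smooth_mult:
  fixes f g :: "real^'n \<Rightarrow> complex"
  shows "smooth f \<Longrightarrow> smooth g \<Longrightarrow> smooth (\<lambda>x. f x * g x)"
  by (rule smooth_coinduct_algebra[where S = "{}"]) (auto intro: smooth_algebra.intros)

lemma partial_deriv_const: "partial_deriv i (\<lambda>x. c) = (\<lambda>x. 0)"
  using partial_deriv_eqI[OF has_derivative_const] by blast

lemma smooth_const: "smooth (\<lambda>x. c)"
  by (rule smooth_coinduct[where S = "range (\<lambda>c x. c)"]) (auto simp: partial_deriv_const)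

lemma smooth_bounded_linear:
  assumes "bounded_linear f" shows "smooth f"
proof (rule smooth_coinduct[where S = "insert f (range (\<lambda>c x. c))"])
  have "partial_deriv i f = (\<lambda>x. f (axis i 1))" for i
    using partial_deriv_eqI[OF bounded_linear_imp_has_derivative[OF assms]] by blast
  then show "partial_deriv i g \<in> insert f (range (\<lambda>c x. c))"
    if "g \<in> insert f (range (\<lambda>c x. c))" for g i
    using that by (auto simp: partial_deriv_const)
  show "g differentiable_on UNIV" if "g \<in> insert f (range (\<lambda>c x. c))" for g
    using that bounded_linear_imp_differentiable_on[OF assms] by auto
qed simp

lemma partial_deriv_bounded_linear_comp:
  assumes "bounded_linear T" "f differentiable_on UNIV"
  shows "partial_deriv i (\<lambda>x. T (f x)) = (\<lambda>x. T (partial_deriv i f x))"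
proof
  fix x
  have "((\<lambda>x. T (f x)) has_derivative (\<lambda>h. T (frechet_derivative f (at x) h))) (at x)"
    by (intro bounded_linear.has_derivative[OF assms(1)] has_derivative_of_differentiable_on assms)
  from partial_deriv_eqI[OF this]
  show "partial_deriv i (\<lambda>x. T (f x)) x = T (partial_deriv i f x)"
    using assms by (simp add: partial_deriv_frechet)
qed

lemma differentiable_on_bounded_linear_comp:
  assumes "bounded_linear T" "f differentiable_on UNIV"
  shows "(\<lambda>x. T (f x)) differentiable_on UNIV"
  using bounded_linear.has_derivative[OF assms(1) has_derivative_of_differentiable_on[OF assms(2)]]
  unfolding differentiable_on_def differentiable_def by auto

lemma smooth_bounded_linear_comp:
  assumes "bounded_linear T" "smooth f"
  shows "smooth (\<lambda>x. T (f x))"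
  by (rule smooth_coinduct[where S = "{\<lambda>x. T (f x) |f. smooth f}"])
     (use assms in \<open>auto simp: partial_deriv_bounded_linear_comp smooth_differentiable_on
        intro: smooth_partial_deriv differentiable_on_bounded_linear_comp\<close>)

lemma iter_partial_bounded_linear_comp:
  assumes "bounded_linear T" "smooth f"
  shows "iter_partial is (\<lambda>x. T (f x)) = (\<lambda>x. T (iter_partial is f x))"
  by (induction "is") (use assms in \<open>auto simp: partial_deriv_bounded_linear_comp
        smooth_differentiable_on smooth_iter_partial\<close>)

lemma has_derivative_affine_comp:
  assumes "f differentiable_on UNIV"
  shows "((\<lambda>x. f (c *\<^sub>R (x - z))) has_derivative
           (\<lambda>h. frechet_derivative f (at (c *\<^sub>R (x - z))) (c *\<^sub>R h))) (at x)"
  by (rule has_derivative_compose[where g = f and f = "\<lambda>x. c *\<^sub>R (x - z)", simplified])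
     (auto intro!: derivative_eq_intros has_derivative_of_differentiable_on assms)

lemma partial_deriv_affine_comp:
  assumes "f differentiable_on UNIV"
  shows "partial_deriv i (\<lambda>x. f (c *\<^sub>R (x - z))) = (\<lambda>x. c *\<^sub>R partial_deriv i f (c *\<^sub>R (x - z)))"
proof
  fix x
  have "linear (frechet_derivative f (at (c *\<^sub>R (x - z))))"
    by (rule has_derivative_linear[OF has_derivative_of_differentiable_on[OF assms]])
  then show "partial_deriv i (\<lambda>x. f (c *\<^sub>R (x - z))) x = c *\<^sub>R partial_deriv i f (c *\<^sub>R (x - z))"
    using partial_deriv_eqI[OF has_derivative_affine_comp[OF assms], of i c z x]
    by (simp add: partial_deriv_frechet[OF assms] linear_cmul)
qed

lemma smooth_affine_comp:
  fixes f :: "real^'n \<Rightarrow> complex"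
  assumes "smooth f" shows "smooth (\<lambda>x. f (c *\<^sub>R (x - z)))"
\<comment> \<open>The free scalar \<open>a\<close> in the class absorbs the factor \<open>c\<close>
  that every differentiation produces.\<close>
proof (rule smooth_coinduct[where S = "{\<lambda>x. a *\<^sub>R f (c *\<^sub>R (x - z)) |a f. smooth f}"])
  have d: "(\<lambda>x. f (c *\<^sub>R (x - z))) differentiable_on UNIV" if "smooth f" for f :: "real^'n \<Rightarrow> complex"
    using has_derivative_affine_comp[OF smooth_differentiable_on[OF that]]
    unfolding differentiable_on_def differentiable_def by auto
  show "g differentiable_on UNIV" if "g \<in> {\<lambda>x. a *\<^sub>R f (c *\<^sub>R (x - z)) |a f. smooth f}"
    for g :: "real^'n \<Rightarrow> complex"
    using that d by (auto intro!: differentiable_on_bounded_linear_comp[OF bounded_linear_scaleR_right])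
  show "partial_deriv i g \<in> {\<lambda>x. a *\<^sub>R f (c *\<^sub>R (x - z)) |a f. smooth f}"
    if gS: "g \<in> {\<lambda>x. a *\<^sub>R f (c *\<^sub>R (x - z)) |a f. smooth f}"
    for g :: "real^'n \<Rightarrow> complex" and i
  proof -
    obtain a f where g: "g = (\<lambda>x. a *\<^sub>R f (c *\<^sub>R (x - z)))" and f: "smooth f" using gS by auto
    have "partial_deriv i g = (\<lambda>x. (a * c) *\<^sub>R partial_deriv i f (c *\<^sub>R (x - z)))"
      unfolding g partial_deriv_bounded_linear_comp[OF bounded_linear_scaleR_right d[OF f]]
        partial_deriv_affine_comp[OF smooth_differentiable_on[OF f]] by simp
    then show ?thesis using smooth_partial_deriv[OF f] by auto
  qed
  show "(\<lambda>x. f (c *\<^sub>R (x - z))) \<in> {\<lambda>x. a *\<^sub>R f (c *\<^sub>R (x - z)) |a f. smooth f}"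
    using assms by (auto intro!: exI[of _ "1::real"])
qed

lemma iter_partial_replicate_affine_comp:
  fixes f :: "real^'n \<Rightarrow> complex"
  assumes "smooth f"
  shows "pure_deriv i n (\<lambda>x. f (c *\<^sub>R (x - z))) =
           (\<lambda>x. c ^ n *\<^sub>R pure_deriv i n f (c *\<^sub>R (x - z)))"
proof (induction n)
  case (Suc n)
  note s = smooth_iter_partial[OF assms, of "replicate n i"]
  show ?case
    by (simp add: Suc partial_deriv_bounded_linear_comp[OF bounded_linear_scaleR_right]
        smooth_differentiable_on smooth_affine_comp s
        partial_deriv_affine_comp[OF smooth_differentiable_on[OF s]] mult.commute)
qed simp

lemma has_derivative_cis_inner:
  "((\<lambda>x. cis (v \<bullet> x)) has_derivative (\<lambda>h. (v \<bullet> h) *\<^sub>R (\<i> * cis (v \<bullet> x)))) (at x)"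
proof -
  have "((\<lambda>x. v \<bullet> x) has_derivative (\<lambda>h. v \<bullet> h)) (at x)"
    by (auto intro!: derivative_eq_intros)
  moreover have "(cis has_derivative (\<lambda>s. s *\<^sub>R (\<i> * cis t))) (at t)" for t
    unfolding cis_conv_exp
    by (rule has_derivative_eq_rhs, rule has_derivative_compose[of "\<lambda>t. \<i> * of_real t" "\<lambda>s. \<i> * of_real s" _ _ exp])
       (auto intro!: derivative_eq_intros simp: scaleR_conv_of_real algebra_simps)
  ultimately show ?thesis by (rule has_derivative_compose)
qed

lemma partial_deriv_cis_inner:
  "partial_deriv i (\<lambda>x. cis (v \<bullet> x)) = (\<lambda>x. \<i> * complex_of_real (v $ i) * cis (v \<bullet> x))"
  by (rule ext, subst partial_deriv_eqI[OF has_derivative_cis_inner])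
     (simp add: inner_axis scaleR_conv_of_real)

lemma smooth_cis_inner: "smooth (\<lambda>x. cis (v \<bullet> x))"
proof (rule smooth_coinduct_algebra[where S = "{\<lambda>x. cis (v \<bullet> x)}"])
  show "f differentiable_on UNIV" if "f \<in> {\<lambda>x. cis (v \<bullet> x)}" for f
    using that has_derivative_cis_inner unfolding differentiable_on_def differentiable_def by blast
  show "partial_deriv i f \<in> smooth_algebra {\<lambda>x. cis (v \<bullet> x)}" if "f \<in> {\<lambda>x. cis (v \<bullet> x)}" for f i
    using that unfolding singleton_iff
    by (auto simp: partial_deriv_cis_inner intro!: smooth_algebra.mult intro: smooth_algebra.base
        smooth_algebra.smooth smooth_const)
qed (auto intro: smooth_algebra.base)

text \<open>The sequence \<open>h\<close> lists a profile and its successive derivatives. Each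
  partial derivative replaces \<open>h n\<close> by \<open>h (Suc n)\<close> and multiplies by a
  linear function of \<open>x\<close>, so the generated algebra is invariant. This is what makes the
  radial cutoff smooth.\<close>

lemma smooth_comp_norm_squared:
  fixes h :: "nat \<Rightarrow> real \<Rightarrow> complex"
  assumes h: "\<And>n t. (h n has_vector_derivative h (Suc n) t) (at t)"
  shows "smooth (\<lambda>x::real^'n. h 0 (x \<bullet> x))"
proof (rule smooth_coinduct_algebra[where S = "range (\<lambda>n x. h n (x \<bullet> x))"])
  have d: "((\<lambda>x. h n (x \<bullet> x)) has_derivative (\<lambda>k. (2 * (x \<bullet> k)) *\<^sub>R h (Suc n) (x \<bullet> x))) (at x)"
    for n and x :: "real^'n"
  proof -
    have "((\<lambda>x. x \<bullet> x) has_derivative (\<lambda>k. 2 * (x \<bullet> k))) (at x)"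
      by (auto intro!: derivative_eq_intros simp: inner_commute)
    from has_derivative_compose[OF this h[of n, unfolded has_vector_derivative_def]]
    show ?thesis .
  qed
  show "f differentiable_on UNIV" if "f \<in> range (\<lambda>n x::real^'n. h n (x \<bullet> x))" for f
    using that d unfolding differentiable_on_def differentiable_def by blast
  show "partial_deriv i f \<in> smooth_algebra (range (\<lambda>n x::real^'n. h n (x \<bullet> x)))"
    if f: "f \<in> range (\<lambda>n x::real^'n. h n (x \<bullet> x))" for f i
  proof -
    obtain n where n: "f = (\<lambda>x. h n (x \<bullet> x))" using f by auto
    have "partial_deriv i f = (\<lambda>x. complex_of_real (2 * (x $ i)) * h (Suc n) (x \<bullet> x))"
      unfolding n by (rule ext, subst partial_deriv_eqI[OF d])
        (simp add: inner_axis scaleR_conv_of_real)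
    moreover have "smooth (\<lambda>x::real^'n. complex_of_real (2 * (x $ i)))"
      by (intro smooth_bounded_linear bounded_linear_compose[OF bounded_linear_of_real]
          bounded_linear_compose[OF bounded_linear_mult_right] bounded_linear_vec_nth)
    ultimately show ?thesis by (simp only:) (intro smooth_algebra.mult smooth_algebra.smooth[of "\<lambda>x. complex_of_real (2 * (x $ i))"] smooth_algebra.base rangeI)
  qed
qed (auto intro!: smooth_algebra.base)

text \<open>\<open>A\<close> is an amplitude and \<open>L\<close> an inverse length. Putting the
  length into a power makes the notion stable: a product multiplies the amplitudes and doubles
  \<open>L\<close>, a dilation rescales \<open>L\<close>. Only pure derivatives are recorded because
  integration by parts is done along one coordinate at a time.\<close>

definition deriv_bound :: "nat \<Rightarrow> real \<Rightarrow> real \<Rightarrow> (real^'n \<Rightarrow> complex) \<Rightarrow> bool" where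
  "deriv_bound N A L u \<longleftrightarrow> smooth u \<and>
     (\<forall>i n x. n \<le> N \<longrightarrow> cmod (pure_deriv i n u x) \<le> A * L ^ n)"

lemma iter_partial_add:
  fixes f g :: "real^'n \<Rightarrow> complex"
  assumes "smooth f" "smooth g"
  shows "iter_partial is (\<lambda>x. f x + g x) = (\<lambda>x. iter_partial is f x + iter_partial is g x)"
  by (induction "is")
     (use assms in \<open>auto simp: partial_deriv_add smooth_differentiable_on smooth_iter_partial\<close>)

lemma iter_partial_cmult:
  fixes f :: "real^'n \<Rightarrow> complex"
  shows "smooth f \<Longrightarrow> iter_partial is (\<lambda>x. c * f x) = (\<lambda>x. c * iter_partial is f x)"
  using iter_partial_bounded_linear_comp[OF bounded_linear_mult_right] by blast

lemma replicate_Suc_snoc: "replicate (Suc n) x = replicate n x @ [x]"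
  by (simp add: replicate_append_same)

text \<open>The innermost derivative is peeled off, so that both summands are again
  \<open>n\<close>-fold derivatives of products and an induction over \<open>n\<close> can
  continue.\<close>

lemma iter_partial_replicate_Suc_mult:
  fixes u v :: "real^'n \<Rightarrow> complex"
  assumes "smooth u" "smooth v"
  shows "pure_deriv i (Suc n) (\<lambda>x. u x * v x) x =
           pure_deriv i n (\<lambda>x. partial_deriv i u x * v x) x +
           pure_deriv i n (\<lambda>x. u x * partial_deriv i v x) x"
  by (simp only: replicate_Suc_snoc iter_partial_append iter_partial.simps
      partial_deriv_mult[OF assms[THEN smooth_differentiable_on]])
     (subst iter_partial_add, auto intro: smooth_mult smooth_partial_deriv assms)

lemma deriv_bound_mono_order: "deriv_bound N A L u \<Longrightarrow> n \<le> N \<Longrightarrow> deriv_bound n A L u"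
  unfolding deriv_bound_def by auto

lemma deriv_bound_mono:
  assumes "deriv_bound N A L u" "A \<le> A'" "0 \<le> L" "L \<le> L'" "0 \<le> A'"
  shows "deriv_bound N A' L' u"
proof -
  have "A * L ^ n \<le> A' * L' ^ n" for n
    using assms by (intro mult_mono power_mono) auto
  then show ?thesis using assms unfolding deriv_bound_def by (meson order_trans)
qed

text \<open>The innermost derivative falls on one factor or the other and raises that factor's
  amplitude by \<open>L\<close>. Two choices per derivative account for \<open>(2 * L) ^ n\<close>,
  with no binomial coefficients. The induction therefore generalizes over the functions and the
  amplitudes.\<close>

lemma norm_iter_partial_mult_le:
  fixes u v :: "real^'n \<Rightarrow> complex"
  assumes "smooth u" "smooth v"
    and "\<And>k x. k \<le> n \<Longrightarrow> cmod (pure_deriv i k u x) \<le> A * L ^ k"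
    and "\<And>k x. k \<le> n \<Longrightarrow> cmod (pure_deriv i k v x) \<le> B * L ^ k"
  shows "cmod (pure_deriv i n (\<lambda>x. u x * v x) x) \<le> A * B * (2 * L) ^ n"
  using assms
proof (induction n arbitrary: u v A B x)
  case 0
  have "cmod (u x) \<le> A" "cmod (v x) \<le> B" using 0(3)[of 0 x] 0(4)[of 0 x] by auto
  moreover from this have "0 \<le> A" using norm_ge_zero order_trans by blast
  ultimately show ?case by (simp add: norm_mult mult_mono)
next
  case (Suc n)
  have pu: "cmod (pure_deriv i k (partial_deriv i u) x) \<le> A * L * L ^ k" if "k \<le> n" for k x
    using Suc.prems(3)[of "Suc k" x] that
    by (simp only: replicate_Suc_snoc iter_partial_append) (simp add: mult.assoc)
  have pv: "cmod (pure_deriv i k (partial_deriv i v) x) \<le> B * L * L ^ k" if "k \<le> n" for k x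
    using Suc.prems(4)[of "Suc k" x] that
    by (simp only: replicate_Suc_snoc iter_partial_append) (simp add: mult.assoc)
  have 1: "cmod (pure_deriv i n (\<lambda>x. partial_deriv i u x * v x) x) \<le> A * L * B * (2 * L) ^ n"
    by (rule Suc.IH) (use Suc.prems pu in \<open>auto intro: smooth_partial_deriv\<close>)
  have 2: "cmod (pure_deriv i n (\<lambda>x. u x * partial_deriv i v x) x) \<le> A * (B * L) * (2 * L) ^ n"
    by (rule Suc.IH) (use Suc.prems pv in \<open>auto intro: smooth_partial_deriv\<close>)
  have "cmod (pure_deriv i (Suc n) (\<lambda>x. u x * v x) x)
      \<le> A * L * B * (2 * L) ^ n + A * (B * L) * (2 * L) ^ n"
    unfolding iter_partial_replicate_Suc_mult[OF Suc.prems(1,2)]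
    by (rule norm_triangle_le) (intro add_mono 1 2)
  then show ?case by (simp add: algebra_simps)
qed

lemma deriv_bound_mult:
  assumes "deriv_bound N A L u" "deriv_bound N B L v"
  shows "deriv_bound N (A * B) (2 * L) (\<lambda>x. u x * v x)"
  unfolding deriv_bound_def
proof (intro conjI allI impI)
  show "smooth (\<lambda>x. u x * v x)" using assms by (auto simp: deriv_bound_def intro: smooth_mult)
  show "cmod (pure_deriv i n (\<lambda>x. u x * v x) x) \<le> A * B * (2 * L) ^ n"
    if "n \<le> N" for i n x
    by (rule norm_iter_partial_mult_le) (use assms that in \<open>auto simp: deriv_bound_def\<close>)
qed

lemma deriv_bound_affine_comp:
  assumes "deriv_bound N A L u" "0 \<le> c"
  shows "deriv_bound N A (c * L) (\<lambda>x. u (c *\<^sub>R (x - z)))"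
proof -
  have "c ^ n * cmod (pure_deriv i n u y) \<le> A * (c * L) ^ n" if "n \<le> N" for n i y
    using mult_left_mono[of "cmod (pure_deriv i n u y)" "A * L ^ n" "c ^ n"] assms that
    by (auto simp: deriv_bound_def power_mult_distrib mult_ac)
  then show ?thesis
    using assms by (auto simp: deriv_bound_def smooth_affine_comp iter_partial_replicate_affine_comp norm_mult)
qed

section \<open>Supports, test functions and pure multi-indices\<close>

lemma partial_deriv_local:
  assumes "open U" "x \<in> U" "\<And>y. y \<in> U \<Longrightarrow> f y = g y"
  shows "partial_deriv i f x = partial_deriv i g x"
proof -
  have "((\<lambda>t::real. x + t *\<^sub>R axis i 1) \<longlongrightarrow> x + 0 *\<^sub>R axis i 1) (nhds 0)"
    by (intro tendsto_intros) (auto simp: filterlim_ident)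
  then have "\<forall>\<^sub>F t in nhds (0::real). x + t *\<^sub>R axis i 1 \<in> U"
    by (rule topological_tendstoD) (use assms in auto)
  then have "\<forall>\<^sub>F t in nhds 0. f (x + t *\<^sub>R axis i 1) = g (x + t *\<^sub>R axis i 1)"
    by eventually_elim (use assms in auto)
  then show ?thesis unfolding partial_deriv_def
    by (intro vector_derivative_cong_eq) (auto simp: assms)
qed

lemma iter_partial_local:
  assumes "open U" "x \<in> U" "\<And>y. y \<in> U \<Longrightarrow> f y = g y"
  shows "iter_partial is f x = iter_partial is g x"
proof -
  have "\<forall>y\<in>U. iter_partial is f y = iter_partial is g y"
    by (induction "is") (auto simp: assms intro: partial_deriv_local[OF assms(1)])
  then show ?thesis using assms by auto
qed

lemma iter_partial_zero: "iter_partial is (\<lambda>x. 0 :: 'b::real_normed_vector) = (\<lambda>x. 0)"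
  by (induction "is") (auto simp: partial_deriv_const)

lemma supp_subset_closed: "closed C \<Longrightarrow> (\<And>x. x \<notin> C \<Longrightarrow> f x = 0) \<Longrightarrow> supp f \<subseteq> C"
  unfolding supp_def by (intro closure_minimal) auto

lemma not_in_supp: "x \<notin> supp f \<Longrightarrow> f x = 0"
  unfolding supp_def using closure_subset[of "{x. f x \<noteq> 0}"] by auto

lemma supp_iter_partial: "supp (iter_partial is f) \<subseteq> supp f"
proof (rule supp_subset_closed)
  show "closed (supp f)" unfolding supp_def by simp
  then show "iter_partial is f x = 0" if "x \<notin> supp f" for x
    using iter_partial_local[of "- supp f" x f "\<lambda>x. 0" "is"] that
    by (auto simp: iter_partial_zero not_in_supp)
qed

lemma supp_mult_subset:
  fixes f g :: "'a::topological_space \<Rightarrow> complex"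
  shows "supp (\<lambda>x. f x * g x) \<subseteq> supp f" "supp (\<lambda>x. f x * g x) \<subseteq> supp g"
  unfolding supp_def by (rule closure_mono, force)+

lemma test_function_supp_mono:
  assumes "test_function U f" "smooth g" "supp g \<subseteq> supp f"
  shows "test_function U g"
proof -
  have "compact (supp f \<inter> supp g)"
    using assms by (intro compact_Int_closed) (auto simp: test_function_def supp_def)
  then show ?thesis using assms by (auto simp: test_function_def Int_absorb1)
qed

lemma test_function_iter_partial:
  "test_function U f \<Longrightarrow> test_function U (iter_partial is f)"
  by (rule test_function_supp_mono[OF _ smooth_iter_partial supp_iter_partial])
     (auto simp: test_function_def)

lemma test_function_mult:
  "test_function U f \<Longrightarrow> smooth g \<Longrightarrow> test_function U (\<lambda>x. f x * g x)"
  by (rule test_function_supp_mono[OF _ smooth_mult supp_mult_subset(1)])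
     (auto simp: test_function_def)

lemma test_function_bounded:
  assumes "test_function U f" shows "\<exists>A\<ge>0. \<forall>x. cmod (f x) \<le> A"
proof -
  have "compact (f ` supp f)"
    using assms
    by (intro compact_continuous_image continuous_on_subset[OF smooth_imp_continuous])
       (auto simp: test_function_def)
  then obtain A where A: "\<And>x. x \<in> supp f \<Longrightarrow> cmod (f x) \<le> A"
    by (metis bounded_iff compact_imp_bounded imageI)
  have "cmod (f x) \<le> max 0 A" for x
    using A[of x] not_in_supp[of x f] by (cases "x \<in> supp f") auto
  then show ?thesis by (intro exI[of _ "max 0 A"]) auto
qed

lemma test_function_deriv_bound:
  assumes "test_function U f" shows "\<exists>A\<ge>1. deriv_bound N A 1 f"
proof -
  have "\<exists>A. \<forall>p. A p \<ge> 0 \<and> (\<forall>x. cmod (iter_partial (replicate (snd p) (fst p)) f x) \<le> A p)"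
    by (intro choice allI)
       (use test_function_bounded[OF test_function_iter_partial[OF assms]] in auto)
  then obtain A where A: "\<And>p. A p \<ge> 0" "\<And>p x. cmod (iter_partial (replicate (snd p) (fst p)) f x) \<le> A p"
    by blast
  \<comment> \<open>The sum of finitely many nonnegative bounds dominates each of them; the summand
    1 gives the lower bound on the amplitude.\<close>
  define B where "B = 1 + sum A (UNIV \<times> {..N})"
  have "A (i, n) \<le> B" if "n \<le> N" for i n
    unfolding B_def using member_le_sum[of "(i, n)" "UNIV \<times> {..N}" A] A(1) that by auto
  then have "deriv_bound N B 1 f"
    unfolding deriv_bound_def using assms order_trans[OF A(2)[of "(_, _)"]]
    by (auto simp: test_function_def)
  then show ?thesis unfolding B_def by (intro exI[of _ B]) (auto simp: B_def intro!: sum_nonneg A)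
qed

definition unit_multi :: "'n \<Rightarrow> nat \<Rightarrow> 'n::finite \<Rightarrow> nat" where
  "unit_multi i n = (\<lambda>l. if l = i then n else 0)"

lemma multi_order_unit_multi: "multi_order (unit_multi i n) = n"
  by (simp add: multi_order_def unit_multi_def)

text \<open>For a multi-index carried by a single coordinate only one list has the required counts,
  so the choice by \<open>SOME\<close> is determined and no reordering of partial derivatives
  arises. This is the reason for working with pure derivatives.\<close>

lemma multi_deriv_unit_multi: "multi_deriv (unit_multi i n) f = pure_deriv i n f"
proof -
  have c: "count_list (replicate n i) l = unit_multi i n l" for l
    by (induction n) (auto simp: unit_multi_def)
  have u: "is = replicate n i" if "\<forall>l. count_list is l = unit_multi i n l" for "is"
  proof -
    have "l = i" if "l \<in> set is" for l
      using that \<open>\<forall>l. count_list is l = unit_multi i n l\<close>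
      by (metis count_list_0_iff unit_multi_def)
    then have "is = replicate (length is) i" by (metis replicate_eqI)
    moreover have "count_list (replicate k i) i = k" for k by (induction k) auto
    ultimately show ?thesis using that[rule_format, of i] by (metis unit_multi_def)
  qed
  have "(SOME is. \<forall>l. count_list is l = unit_multi i n l) = replicate n i"
    using c u by (intro some_equality) auto
  then show ?thesis by (simp add: multi_deriv_def)
qed

text \<open>Leibniz' rule solved for \<open>\<Phi> D\<^sup>N e\<close>, so that every term is a derivative of a test function.\<close>

lemma dual_leibniz:
  "\<exists>c::nat \<Rightarrow> complex. \<forall>\<Phi> v x. smooth \<Phi> \<longrightarrow>
     (\<i> * complex_of_real (v $ i)) ^ N * (\<Phi> x * cis (v \<bullet> x)) =
     (\<Sum>l\<le>N. c l * pure_deriv i (N - l)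
        (\<lambda>x. pure_deriv i l \<Phi> x * cis (v \<bullet> x)) x)"
proof (induction N)
  case 0
  show ?case by (intro exI[of _ "\<lambda>_. 1"]) auto
next
  case (Suc N)
  then obtain c where c: "\<And>\<Phi> v x. smooth \<Phi> \<Longrightarrow>
     (\<i> * complex_of_real (v $ i)) ^ N * (\<Phi> x * cis (v \<bullet> x)) =
     (\<Sum>l\<le>N. c l * pure_deriv i (N - l)
        (\<lambda>x. pure_deriv i l \<Phi> x * cis (v \<bullet> x)) x)" by blast
  \<comment> \<open>Pascal's recursion with sign, \<open>c l - c (l - 1)\<close> with out-of-range
    terms set to 0; the coefficients are signed binomials and do not depend on
    \<open>\<Phi>\<close>, \<open>v\<close> or \<open>x\<close>.\<close>
  define c' where "c' = (\<lambda>l. (if l \<le> N then c l else 0) - (case l of 0 \<Rightarrow> 0 | Suc k \<Rightarrow> c k))"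
  show ?case
  proof (intro exI[of _ c'] allI impI)
    fix \<Phi> :: "real^'a \<Rightarrow> complex" and v x assume \<Phi>: "smooth \<Phi>"
    define T where "T = (\<lambda>l. iter_partial (replicate (Suc N - l) i)
        (\<lambda>x. pure_deriv i l \<Phi> x * cis (v \<bullet> x)) x)"
    \<comment> \<open>The product rule solved for the term in which the derivative hits the
      exponential. As \<open>T\<close> is indexed by the number of derivatives on
      \<open>\<Phi>\<close>, the result is a difference of neighbours.\<close>
    have step: "\<i> * complex_of_real (v $ i) * pure_deriv i (N - l)
        (\<lambda>x. pure_deriv i l \<Phi> x * cis (v \<bullet> x)) x = T l - T (Suc l)" if "l \<le> N" for l
    proof -
      define u where "u = pure_deriv i l \<Phi>"
      have u: "smooth u" unfolding u_def using \<Phi> by (rule smooth_iter_partial)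
      have "T l = iter_partial (replicate (Suc (N - l)) i) (\<lambda>x. u x * cis (v \<bullet> x)) x"
        unfolding T_def u_def using that by (simp add: Suc_diff_le)
      also have "\<dots> = pure_deriv i (N - l) (\<lambda>x. partial_deriv i u x * cis (v \<bullet> x)) x +
          pure_deriv i (N - l) (\<lambda>x. \<i> * complex_of_real (v $ i) * (u x * cis (v \<bullet> x))) x"
        unfolding iter_partial_replicate_Suc_mult[OF u smooth_cis_inner] partial_deriv_cis_inner
        by (simp add: mult_ac)
      also have "pure_deriv i (N - l) (\<lambda>x. partial_deriv i u x * cis (v \<bullet> x)) x = T (Suc l)"
        unfolding T_def u_def by simp
      finally show ?thesis
        by (simp only: iter_partial_cmult[OF smooth_mult[OF u smooth_cis_inner]])
          (simp add: u_def)
    qed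
    have "(\<i> * complex_of_real (v $ i)) ^ Suc N * (\<Phi> x * cis (v \<bullet> x)) =
        (\<Sum>l\<le>N. c l * (\<i> * complex_of_real (v $ i) * pure_deriv i (N - l)
        (\<lambda>x. pure_deriv i l \<Phi> x * cis (v \<bullet> x)) x))"
      by (simp only: power_Suc mult.assoc c[OF \<Phi>]) (simp add: sum_distrib_left mult_ac)
    also have "\<dots> = (\<Sum>l\<le>N. c l * (T l - T (Suc l)))"
      by (intro sum.cong refl) (simp add: step)
    also have "\<dots> = (\<Sum>l\<le>N. c l * T l) - (\<Sum>l\<le>N. c l * T (Suc l))"
      by (simp add: right_diff_distrib sum_subtractf)
    also have "(\<Sum>l\<le>N. c l * T l) = (\<Sum>l\<le>Suc N. (if l \<le> N then c l else 0) * T l)"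
      by (simp add: sum.atMost_Suc)
    also have "(\<Sum>l\<le>N. c l * T (Suc l)) = (\<Sum>l\<le>Suc N. (case l of 0 \<Rightarrow> 0 | Suc k \<Rightarrow> c k) * T l)"
      by (simp only: sum.atMost_Suc_shift) simp
    finally show "(\<i> * complex_of_real (v $ i)) ^ Suc N * (\<Phi> x * cis (v \<bullet> x)) = (\<Sum>l\<le>Suc N. c' l * T l)"
      by (simp add: c'_def left_diff_distrib sum_subtractf)
  qed
qed

text \<open>The given bump \<open>F\<close> supplies the cutoff: an antiderivative of its squared modulus along a
  coordinate line is a smooth step function, which is composed with the squared norm.\<close>

lemma smooth_cutoff:
  fixes F :: "real^'n \<Rightarrow> complex"
  assumes F: "test_function UNIV F" and F0: "F 0 \<noteq> 0"
  shows "\<exists>\<omega> :: real^'n \<Rightarrow> complex. test_function UNIV \<omega> \<and>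
    (\<forall>x. norm x \<le> 1/2 \<longrightarrow> \<omega> x = 1) \<and> (\<forall>x. 1 \<le> norm x \<longrightarrow> \<omega> x = 0)"
proof -
  obtain i :: 'n where True by simp
  define f where "f = (\<lambda>x. F x * cnj (F x))"
  have f: "smooth f" using F unfolding f_def test_function_def
    by (auto intro!: smooth_mult smooth_bounded_linear_comp[OF bounded_linear_cnj])
  have f_eq: "f x = of_real ((cmod (F x))\<^sup>2)" for x by (simp only: f_def complex_norm_square)
  obtain R where R: "supp F \<subseteq> cball 0 R" "R > 0"
  proof -
    obtain r where r: "\<And>x. x \<in> supp F \<Longrightarrow> norm x \<le> r"
      using compact_imp_bounded[of "supp F"] F unfolding test_function_def bounded_iff by auto
    have "supp F \<subseteq> cball 0 (max 1 r)" using r by fastforce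
    then show ?thesis by (intro that[of "max 1 r"]) auto
  qed
  \<comment> \<open>\<open>b 0\<close> is the squared modulus of \<open>F\<close> along the chosen
    axis, and \<open>b n\<close> is its \<open>n\<close>-th derivative as a function of one
    variable.\<close>
  define b where "b = (\<lambda>n t. pure_deriv i n f (t *\<^sub>R axis i 1))"
  have b: "(b n has_vector_derivative b (Suc n) t) (at t)" for n t
    unfolding b_def
    using has_vector_derivative_line[OF smooth_differentiable_on[OF smooth_iter_partial[OF f, of "replicate n i"]],
       of 0 i t] by simp
  have b0: "b 0 t = of_real ((cmod (F (t *\<^sub>R axis i 1)))\<^sup>2)" for t by (simp add: b_def f_eq)
  have b_cont: "continuous_on UNIV (b 0)"
    using b[of 0] by (meson continuous_at_imp_continuous_on has_vector_derivative_continuous)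
  have "\<exists>G. \<forall>x::real. - \<infinity> < ereal x \<longrightarrow> ereal x < \<infinity> \<longrightarrow> (G has_vector_derivative b 0 x) (at x)"
    by (rule einterval_antiderivative)
       (use b_cont in \<open>auto simp: continuous_on_eq_continuous_at\<close>)
  then obtain G where G: "\<And>x::real. (G has_vector_derivative b 0 x) (at x)" by auto
  have bz: "b 0 t = 0" if "R < \<bar>t\<bar>" for t
  proof -
    have "norm (t *\<^sub>R (axis i 1 :: real^'n)) = \<bar>t\<bar>" by simp
    then have "t *\<^sub>R axis i 1 \<notin> supp F" using R(1) that by fastforce
    then show ?thesis unfolding b0 by (simp add: not_in_supp)
  qed
  have G0: "(G has_vector_derivative 0) (at x within S)" if "R < \<bar>x\<bar>" for x S
    using G[of x] bz[OF that] by (auto intro: has_vector_derivative_at_within)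
  obtain c1 where c1: "\<And>x. x \<in> {R+1..} \<Longrightarrow> G x = c1"
    by (rule has_vector_derivative_zero_constant[of "{R+1..}" G]) (use R G0 in auto)
  obtain c2 where c2: "\<And>x. x \<in> {..-(R+1)} \<Longrightarrow> G x = c2"
    by (rule has_vector_derivative_zero_constant[of "{..-(R+1)}" G]) (use R G0 in auto)
  have Gup: "G t = G (R + 1)" if "R + 1 \<le> t" for t using c1[of t] c1[of "R+1"] that by simp
  have Glo: "G t = G (- (R + 1))" if "t \<le> - (R + 1)" for t
    using c2[of t] c2[of "-(R+1)"] that by simp
  have ReG: "((\<lambda>t. Re (G t)) has_real_derivative (cmod (F (t *\<^sub>R axis i 1)))\<^sup>2) (at t)" for t
    using bounded_linear.has_vector_derivative[OF bounded_linear_Re G[of t]]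
    by (simp add: has_real_derivative_iff_has_vector_derivative b0)
  \<comment> \<open>Were the two end values equal, the nondecreasing function
    \<open>Re (G t)\<close> would be constant in between, and its derivative at 0, the squared
    modulus of \<open>F 0\<close>, would vanish.\<close>
  have ne: "G (R + 1) \<noteq> G (- (R + 1))"
  proof
    assume eq: "G (R + 1) = G (- (R + 1))"
    have mono: "Re (G s) \<le> Re (G t)" if "s \<le> t" for s t
      by (rule DERIV_nonneg_imp_nondecreasing[OF that]) (use ReG in \<open>auto intro!: exI\<close>)
    have const: "Re (G t) = Re (G 0)" if "\<bar>t\<bar> \<le> R + 1" for t
      using mono[of "-(R+1)" t] mono[of t "R+1"] mono[of "-(R+1)" 0] mono[of 0 "R+1"] R(2) eq
        that[unfolded abs_le_iff] by auto
    have "((\<lambda>t. Re (G t)) has_real_derivative 0) (at 0)"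
    proof (rule has_field_derivative_transform_within_open)
      show "((\<lambda>_. Re (G 0)) has_real_derivative 0) (at 0)" by simp
      show "open (ball (0::real) (R + 1))" "0 \<in> ball (0::real) (R + 1)" using R(2) by auto
      show "Re (G 0) = Re (G t)" if "t \<in> ball 0 (R + 1)" for t
        using const[of t] that by simp
    qed
    then have "(cmod (F (0 *\<^sub>R axis i 1)))\<^sup>2 = 0" using ReG[of 0] DERIV_unique by blast
    then show False using F0 by simp
  qed
  define c where "c = G (- (R + 1)) - G (R + 1)"
  have c: "c \<noteq> 0" using ne by (simp add: c_def)
  \<comment> \<open>The affine map \<open>A * t - B\<close> sends \<open>t = 1/4\<close> to
    \<open>- (R + 1)\<close> and \<open>t = 1\<close> to \<open>R + 1\<close>, so the whole
    transition of \<open>G\<close> takes place for norms between 1/2 and 1.\<close>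
  define A where "A = 8 * (R + 1) / 3"
  define B where "B = 5 * (R + 1) / 3"
  \<comment> \<open>\<open>h 0\<close> is \<open>G\<close> normalized to pass from 1 down to 0; the
    later entries are its derivatives by the chain rule.\<close>
  define h where "h = (\<lambda>n t. case n of 0 \<Rightarrow> (G (A * t - B) - G (R + 1)) / c
      | Suc k \<Rightarrow> A ^ Suc k *\<^sub>R b k (A * t - B) / c)"
  have aff: "((\<lambda>t. g (A * t - B)) has_vector_derivative A *\<^sub>R g') (at t)"
    if "(g has_vector_derivative g') (at (A * t - B))" for g :: "real \<Rightarrow> complex" and g' t
  proof -
    have "((\<lambda>t. A * t - B) has_vector_derivative A) (at t)"
      unfolding has_real_derivative_iff_has_vector_derivative[symmetric]
      by (auto intro!: derivative_eq_intros)
    from vector_diff_chain_at[OF this that] show ?thesis by (simp add: o_def)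
  qed
  have h: "(h n has_vector_derivative h (Suc n) t) (at t)" for n t
  proof (cases n)
    case 0
    show ?thesis unfolding 0 h_def using aff[OF G]
      by (auto intro!: derivative_eq_intros has_vector_derivative_divide)
  next
    case (Suc k)
    show ?thesis unfolding Suc h_def using aff[OF b[of k]]
      by (auto intro!: derivative_eq_intros has_vector_derivative_divide)
  qed
  define \<omega> where "\<omega> = (\<lambda>x::real^'n. h 0 (x \<bullet> x))"
  have "smooth \<omega>" unfolding \<omega>_def using h by (rule smooth_comp_norm_squared[of h])
  moreover have 1: "\<omega> x = 1" if "norm x \<le> 1/2" for x
  proof -
    have "x \<bullet> x \<le> 1/4" using power_mono[OF that, of 2] by (simp add: dot_square_norm power_one_over power2_eq_square)
    then have "(R+1) * (x \<bullet> x) \<le> (R+1) * (1/4)" using R by (intro mult_left_mono) auto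
    then have "A * (x \<bullet> x) - B \<le> - (R + 1)" by (simp add: A_def B_def field_simps)
    then show ?thesis using c Glo[of "A * (x \<bullet> x) - B"] by (simp add: \<omega>_def h_def c_def)
  qed
  moreover have 2: "\<omega> x = 0" if "1 \<le> norm x" for x
  proof -
    have "1 \<le> x \<bullet> x" using power_mono[OF that, of 2] by (simp add: dot_square_norm)
    then have "(R+1) * 1 \<le> (R+1) * (x \<bullet> x)" using R by (intro mult_left_mono) auto
    then have "R + 1 \<le> A * (x \<bullet> x) - B" by (simp add: A_def B_def field_simps)
    then show ?thesis using Gup[of "A * (x \<bullet> x) - B"] by (simp add: \<omega>_def h_def)
  qed
  moreover have "supp \<omega> \<subseteq> cball 0 1" by (rule supp_subset_closed) (auto intro: 2)
  moreover have "closed (supp \<omega>)" by (simp add: supp_def)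
  ultimately have "smooth \<omega>" "compact (supp \<omega>)" "\<forall>x. norm x \<le> 1/2 \<longrightarrow> \<omega> x = 1" "\<forall>x. 1 \<le> norm x \<longrightarrow> \<omega> x = 0"
    using compact_Int_closed[OF compact_cball, of "supp \<omega>" 0 1] by (auto simp: Int_absorb1)
  then show ?thesis unfolding test_function_def by blast
qed

section \<open>Bessel's inequality for exponentials\<close>

lemma integrable_mult_L2:
  fixes f g :: "'a \<Rightarrow> complex"
  assumes "f \<in> borel_measurable M" "g \<in> borel_measurable M"
    and "integrable M (\<lambda>x. (cmod (f x))\<^sup>2)" "integrable M (\<lambda>x. (cmod (g x))\<^sup>2)"
  shows "integrable M (\<lambda>x. f x * g x)"
proof (rule Bochner_Integration.integrable_bound)
  show "integrable M (\<lambda>x. (cmod (f x))\<^sup>2 + (cmod (g x))\<^sup>2)" using assms by auto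
  show "AE x in M. norm (f x * g x) \<le> norm ((cmod (f x))\<^sup>2 + (cmod (g x))\<^sup>2)"
  proof (rule AE_I2)
    fix x
    have "2 * (cmod (f x) * cmod (g x)) \<le> (cmod (f x))\<^sup>2 + (cmod (g x))\<^sup>2"
      using sum_squares_bound[of "cmod (f x)" "cmod (g x)"] by (simp add: mult.assoc)
    moreover have "0 \<le> cmod (f x) * cmod (g x)" by simp
    ultimately have "cmod (f x) * cmod (g x) \<le> (cmod (f x))\<^sup>2 + (cmod (g x))\<^sup>2" by linarith
    then show "norm (f x * g x) \<le> norm ((cmod (f x))\<^sup>2 + (cmod (g x))\<^sup>2)"
      by (simp add: norm_mult)
  qed
qed (use assms in measurable)

lemma bessel_inequality:
  fixes H :: "'a \<Rightarrow> complex" and e :: "'j \<Rightarrow> 'a \<Rightarrow> complex"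
  assumes J: "finite J" and V: "0 < V"
    and H: "H \<in> borel_measurable M" "integrable M (\<lambda>x. (cmod (H x))\<^sup>2)"
    and e: "\<And>j. e j \<in> borel_measurable M" "\<And>j. integrable M (\<lambda>x. (cmod (e j x))\<^sup>2)"
    and orth: "\<And>j l. j \<in> J \<Longrightarrow> l \<in> J \<Longrightarrow>
      (LINT x|M. e j x * cnj (e l x)) = (if j = l then complex_of_real V else 0)"
  shows "(\<Sum>j\<in>J. (cmod (LINT x|M. H x * e j x))\<^sup>2) \<le> V * (LINT x|M. (cmod (H x))\<^sup>2)"
proof -
  define c where "c = (\<lambda>j. LINT x|M. H x * e j x)"
  \<comment> \<open>The pairing of \<open>H\<close> with \<open>e j\<close> carries no conjugate, so
    the orthogonal projection is onto the span of the conjugates \<open>cnj (e j)\<close>; the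
    inequality is nonnegativity of the squared distance to it.\<close>
  define S where "S = (\<lambda>x. \<Sum>j\<in>J. c j / V * cnj (e j x))"
  have ce: "(\<lambda>x. cnj (e j x)) \<in> borel_measurable M" for j
    using e(1)[of j] by (rule measurable_compose[where g = cnj]) (auto intro: borel_measurable_continuous_onI continuous_intros)
  have intHe: "integrable M (\<lambda>x. H x * e j x)" for j
    by (rule integrable_mult_L2) (use H e in auto)
  have intee: "integrable M (\<lambda>x. e j x * cnj (e l x))" for j l
    by (rule integrable_mult_L2) (use e ce in auto)
  define s where "s = (\<Sum>j\<in>J. (cmod (c j))\<^sup>2)"
  have HS_eq: "H x * cnj (S x) = (\<Sum>j\<in>J. cnj (c j) / V * (H x * e j x))" for x
    unfolding S_def by (simp add: sum_distrib_left mult_ac)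
  have SS_eq: "S x * cnj (S x) = (\<Sum>l\<in>J. \<Sum>j\<in>J. c l * cnj (c j) / V\<^sup>2 * (e j x * cnj (e l x)))" for x
    unfolding S_def by (simp add: sum_product mult_ac power2_eq_square)
  have intHS: "integrable M (\<lambda>x. H x * cnj (S x))" unfolding HS_eq
    by (intro Bochner_Integration.integrable_sum integrable_mult_right intHe)
  have intSS: "integrable M (\<lambda>x. S x * cnj (S x))" unfolding SS_eq
    by (intro Bochner_Integration.integrable_sum integrable_mult_right intee)
  have "(LINT x|M. H x * cnj (S x)) = (\<Sum>j\<in>J. cnj (c j) / V * c j)"
    unfolding HS_eq c_def by (simp only: integral_mult_right_zero Bochner_Integration.integral_sum intHe integrable_mult_right)
  also have "\<dots> = complex_of_real (s / V)"
    unfolding s_def of_real_divide of_real_sum complex_norm_square sum_divide_distrib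
    by (simp add: mult_ac)
  finally have HS: "(LINT x|M. H x * cnj (S x)) = complex_of_real (s / V)" .
  have "(LINT x|M. S x * cnj (S x)) =
      (\<Sum>l\<in>J. \<Sum>j\<in>J. c l * cnj (c j) / V\<^sup>2 * (LINT x|M. e j x * cnj (e l x)))"
    unfolding SS_eq
    by (simp only: integral_mult_right_zero Bochner_Integration.integral_sum intee
        integrable_mult_right Bochner_Integration.integrable_sum)
  also have "\<dots> = (\<Sum>l\<in>J. \<Sum>j\<in>J. if j = l then c l * cnj (c j) / V\<^sup>2 * V else 0)"
    by (intro sum.cong refl) (simp add: orth)
  also have "\<dots> = (\<Sum>l\<in>J. c l * cnj (c l) / V)"
    using J V by (intro sum.cong refl) (simp add: power2_eq_square)
  also have "\<dots> = complex_of_real (s / V)"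
    unfolding s_def of_real_divide of_real_sum complex_norm_square sum_divide_distrib ..
  finally have SS: "(LINT x|M. S x * cnj (S x)) = complex_of_real (s / V)" .
  have exp: "(cmod (H x - S x))\<^sup>2 = (cmod (H x))\<^sup>2 - 2 * Re (H x * cnj (S x)) + Re (S x * cnj (S x))" for x
    by (simp only: cmod_power2) (simp add: power2_eq_square algebra_simps)
  have "0 \<le> (LINT x|M. (cmod (H x - S x))\<^sup>2)" by simp
  also have "\<dots> = (LINT x|M. (cmod (H x))\<^sup>2) - 2 * (LINT x|M. Re (H x * cnj (S x))) + (LINT x|M. Re (S x * cnj (S x)))"
  proof -
    have "(LINT x|M. (cmod (H x))\<^sup>2 - 2 * p x + q x) =
        (LINT x|M. (cmod (H x))\<^sup>2) - 2 * (LINT x|M. p x) + (LINT x|M. q x)"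
      if "integrable M p" "integrable M q" for p q
      using H(2) that by simp
    from this[OF integrable_Re[OF intHS] integrable_Re[OF intSS]] show ?thesis unfolding exp .
  qed
  also have "(LINT x|M. Re (H x * cnj (S x))) = s / V" using integral_Re[OF intHS] HS by simp
  also have "(LINT x|M. Re (S x * cnj (S x))) = s / V" using integral_Re[OF intSS] SS by simp
  finally have "s / V \<le> (LINT x|M. (cmod (H x))\<^sup>2)" by simp
  then have "s \<le> V * (LINT x|M. (cmod (H x))\<^sup>2)" using V by (simp add: field_simps)
  then show ?thesis by (simp add: s_def c_def)
qed

text \<open>Lebesgue measure on \<open>real^'n\<close> is the image of a product measure indexed by
  \<open>Basis\<close>. The bijection \<open>ax\<close> from coordinates to basis vectors carries
  the product formula for integrals over to coordinates.\<close>

lemma lborel_integral_prod_vec: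
  fixes f :: "'n::finite \<Rightarrow> real \<Rightarrow> complex"
  assumes "\<And>i. integrable lborel (f i)"
  shows "(LINT x|lborel. (\<Prod>i\<in>UNIV. f i ((x::real^'n) $ i))) = (\<Prod>i\<in>UNIV. LINT t|lborel. f i t)"
proof -
  interpret product_sigma_finite "\<lambda>b::real^'n. lborel :: real measure"
    by standard
  define ax where "ax = (\<lambda>i::'n. axis i (1::real))"
  have inj: "inj ax" by (auto simp: ax_def inj_on_def axis_eq_axis)
  have B: "(Basis :: (real^'n) set) = range ax" by (auto simp: ax_def Basis_vec_def)
  define g where "g = (\<lambda>b. f (the_inv ax b))"
  have g: "g (ax i) = f i" for i by (simp add: g_def the_inv_f_f[OF inj])
  have nth: "(\<Sum>b\<in>Basis. y b *\<^sub>R b :: real^'n) $ i = y (ax i)" for y i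
  proof -
    have "(\<Sum>b\<in>Basis. y b *\<^sub>R b :: real^'n) $ i = (\<Sum>l\<in>UNIV. y (ax l) *\<^sub>R (ax l $ i))"
      unfolding B by (simp add: sum.reindex[OF inj] o_def)
    also have "\<dots> = (\<Sum>l\<in>UNIV. if l = i then y (ax i) else 0)"
      by (intro sum.cong refl) (auto simp: ax_def axis_def)
    finally show ?thesis by simp
  qed
  have meas: "(\<lambda>x::real^'n. \<Prod>i\<in>UNIV. f i (x $ i)) \<in> borel_measurable borel"
  proof (rule borel_measurable_prod)
    fix i
    have "(\<lambda>x::real^'n. x $ i) \<in> borel_measurable borel"
      by (intro borel_measurable_continuous_onI continuous_intros)
    moreover have "f i \<in> borel_measurable borel"
      using borel_measurable_integrable[OF assms, of i] by simp
    ultimately show "(\<lambda>x::real^'n. f i (x $ i)) \<in> borel_measurable borel"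
      by (rule measurable_compose)
  qed
  have "(LINT x|lborel. (\<Prod>i\<in>UNIV. f i ((x::real^'n) $ i))) =
      (LINT y|(\<Pi>\<^sub>M b\<in>(Basis::(real^'n) set). lborel). (\<Prod>i\<in>UNIV. f i (y (ax i))))"
    unfolding lborel_eq[where 'a = "real^'n"] by (subst integral_distr) (auto simp: nth meas simp del: sum_component vector_scaleR_component)
  also have "\<dots> = (LINT y|(\<Pi>\<^sub>M b\<in>(Basis::(real^'n) set). lborel). (\<Prod>b\<in>Basis. g b (y b)))"
    unfolding B by (simp add: prod.reindex[OF inj] g)
  also have "\<dots> = (\<Prod>b\<in>(Basis::(real^'n) set). LINT t|lborel. g b t)"
    by (rule product_integral_prod) (use assms in \<open>auto simp: g_def\<close>)
  also have "\<dots> = (\<Prod>i\<in>UNIV. LINT t|lborel. f i t)"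
    unfolding B by (simp add: prod.reindex[OF inj] g)
  finally show ?thesis .
qed

lemma integral_cis_period:
  assumes T: "0 < T"
  shows "(LINT t|lborel. indicator {a..a+T} t *\<^sub>R cis (2 * pi / T * real_of_int k * t)) =
    (if k = 0 then complex_of_real T else 0)"
proof (cases "k = 0")
  case True
  have "(LINT t|lborel. indicat_real {a..a+T} t *\<^sub>R (1::complex)) = T *\<^sub>R 1"
    using T by (subst integral_scaleR_left) auto
  then show ?thesis using True T by (simp add: scaleR_conv_of_real)
next
  case False
  define w where "w = 2 * pi / T * real_of_int k"
  have w: "w \<noteq> 0" using False T by (simp add: w_def)
  have d: "((\<lambda>t. cis (w * t) / (\<i> * w)) has_vector_derivative cis (w * t)) (at t within {a..a+T})" for t
  proof -
    have "((\<lambda>t. exp (\<i> * (w * t)) / (\<i> * w)) has_field_derivative exp (\<i> * (w * t))) (at t within X)" for t X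
      using w by (auto intro!: derivative_eq_intros) (simp add: mult_ac)
    from has_vector_derivative_real_field[OF this] show ?thesis by (simp add: cis_conv_exp)
  qed
  have "(LINT t|lborel. indicator {a..a+T} t *\<^sub>R cis (w * t)) =
      cis (w * (a + T)) / (\<i> * w) - cis (w * a) / (\<i> * w)"
    by (rule integral_FTC_Icc) (use T d in \<open>auto intro!: continuous_intros\<close>)
  also have "cis (w * (a + T)) = cis (w * a) * cis (2 * pi * k)"
  proof -
    have "w * (a + T) = w * a + 2 * pi * k" using T by (simp add: w_def distrib_left)
    then show ?thesis by (simp only: cis_mult)
  qed
  also have "cis (2 * pi * k) = 1"
    by (rule cis_multiple_2pi) simp
  finally show ?thesis using False by (simp add: w_def)
qed

lemma exponential_orthogonality:
  fixes z :: "real^'n" and k :: "int^'n"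
  assumes T: "0 < T"
  shows "(LINT x|lborel. indicator (cbox z (\<chi> i. z $ i + T)) x *\<^sub>R
      cis (2 * pi / T * (\<Sum>i\<in>UNIV. real_of_int (k $ i) * x $ i))) =
    (if k = 0 then complex_of_real (T ^ CARD('n)) else 0)"
proof -
  have ind: "indicator (cbox z (\<chi> i. z $ i + T)) x = (\<Prod>i\<in>UNIV. indicat_real {z $ i..z $ i + T} (x $ i))" for x
  proof (cases "x \<in> cbox z (\<chi> i. z $ i + T)")
    case False
    then obtain i where "x $ i \<notin> {z $ i..z $ i + T}" by (auto simp: mem_box_cart)
    then have "(\<Prod>i\<in>UNIV. indicat_real {z $ i..z $ i + T} (x $ i)) = 0"
      by (intro prod_zero) (auto intro!: exI[of _ i])
    then show ?thesis using False by simp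
  qed (auto simp: mem_box_cart)
  have cisprod: "cis (\<Sum>i\<in>A. u i) = (\<Prod>i\<in>A. cis (u i))" if "finite A" for A :: "'n set" and u
    using that by induction (auto simp: cis_mult[symmetric])
  have "(LINT x|lborel. indicator (cbox z (\<chi> i. z $ i + T)) x *\<^sub>R
      cis (2 * pi / T * (\<Sum>i\<in>UNIV. real_of_int (k $ i) * x $ i))) =
    (LINT x|lborel. (\<Prod>i\<in>UNIV. indicator {z $ i..z $ i + T} (x $ i) *\<^sub>R
       cis (2 * pi / T * real_of_int (k $ i) * x $ i)))"
    by (simp add: ind sum_distrib_left cisprod scaleR_conv_of_real prod.distrib mult.assoc)
  also have "\<dots> = (\<Prod>i\<in>UNIV. LINT t|lborel. indicator {z $ i..z $ i + T} t *\<^sub>R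
       cis (2 * pi / T * real_of_int (k $ i) * t))"
    by (rule lborel_integral_prod_vec)
       (use T in \<open>auto intro!: borel_integrable_atLeastAtMost'[unfolded set_integrable_def] continuous_intros\<close>)
  also have "\<dots> = (\<Prod>i\<in>UNIV. if k $ i = 0 then complex_of_real T else 0)"
    by (simp only: integral_cis_period[OF T])
  also have "\<dots> = (if k = 0 then complex_of_real (T ^ CARD('n)) else 0)"
    using T by (auto simp: vec_eq_iff)
  finally show ?thesis .
qed

lemma bessel_exponentials:
  fixes H :: "real^'n \<Rightarrow> complex" and z :: "real^'n"
  assumes T: "0 < T" and J: "finite (J :: (int^'n) set)"
    and H: "H \<in> borel_measurable lebesgue" "integrable lebesgue (\<lambda>x. (cmod (H x))\<^sup>2)"
    and supp: "\<And>x. x \<notin> cbox z (\<chi> i. z $ i + T) \<Longrightarrow> H x = 0"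
  shows "(\<Sum>j\<in>J. (cmod (LINT x|lebesgue. H x * cis (2 * pi / T * (\<Sum>i\<in>UNIV. real_of_int (j $ i) * x $ i))))\<^sup>2)
    \<le> T ^ CARD('n) * (LINT x|lebesgue. (cmod (H x))\<^sup>2)"
proof -
  define Q where "Q = cbox z (\<chi> i. z $ i + T)"
  \<comment> \<open>The indicator of one period cube makes the exponentials square integrable and
    orthogonal; it disappears at the end because \<open>H\<close> vanishes outside that
    cube.\<close>
  define e where "e = (\<lambda>(j::int^'n) x. indicator Q x *\<^sub>R
      cis (2 * pi / T * (\<Sum>i\<in>UNIV. real_of_int (j $ i) * x $ i)))"
  have emeas: "e j \<in> borel_measurable borel" for j
  proof -
    have "continuous_on UNIV (\<lambda>x::real^'n. 2 * pi / T * (\<Sum>i\<in>UNIV. real_of_int (j $ i) * x $ i))"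
      by (intro continuous_intros)
    then have "(\<lambda>x::real^'n. cis (2 * pi / T * (\<Sum>i\<in>UNIV. real_of_int (j $ i) * x $ i))) \<in> borel_measurable borel"
      by (intro borel_measurable_continuous_onI continuous_on_cis)
    moreover have "indicat_real Q \<in> borel_measurable borel"
      unfolding Q_def by (rule borel_measurable_indicator) simp
    ultimately show ?thesis unfolding e_def by (rule borel_measurable_scaleR[rotated])
  qed
  have "(\<Sum>j\<in>J. (cmod (LINT x|lebesgue. H x * e j x))\<^sup>2) \<le> T ^ CARD('n) * (LINT x|lebesgue. (cmod (H x))\<^sup>2)"
  proof (rule bessel_inequality)
    show "e j \<in> borel_measurable lebesgue" for j
      using emeas by (simp add: measurable_completion)
    have "(\<lambda>x. (cmod (e j x))\<^sup>2) = indicat_real Q" for j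
      by (auto simp: e_def indicator_def)
    then show "integrable lebesgue (\<lambda>x. (cmod (e j x))\<^sup>2)" for j
      by (simp add: Q_def lmeasurable_cbox lmeasurable_iff_integrable[symmetric])
    show "(LINT x|lebesgue. e j x * cnj (e l x)) = (if j = l then complex_of_real (T ^ CARD('n)) else 0)" for j l
    proof -
      have "e j x * cnj (e l x) = indicator Q x *\<^sub>R
          cis (2 * pi / T * (\<Sum>i\<in>UNIV. real_of_int ((j - l) $ i) * x $ i))" for x
        by (auto simp: e_def indicator_def cis_cnj cis_mult left_diff_distrib sum_subtractf right_diff_distrib)
      moreover have "(\<lambda>x. indicator Q x *\<^sub>R
          cis (2 * pi / T * (\<Sum>i\<in>UNIV. real_of_int ((j - l) $ i) * x $ i))) \<in> borel_measurable lborel"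
        using emeas[of "j - l"] by (simp add: e_def)
      ultimately show ?thesis
        using exponential_orthogonality[OF T, of z "j - l"] by (simp add: integral_completion Q_def del: vector_minus_component)
    qed
  qed (use assms in auto)
  moreover have "H x * e j x = H x * cis (2 * pi / T * (\<Sum>i\<in>UNIV. real_of_int (j $ i) * x $ i))" for x j
    using supp[of x] by (cases "x \<in> Q") (auto simp: e_def Q_def)
  ultimately show ?thesis by simp
qed

section \<open>Weighted sums over shifted lattices\<close>

text \<open>The subtracted 1 leaves room for rounding an arbitrary real center to an integer in the
  next lemma. From 2 on, \<open>m - 1\<close> is at least \<open>m / 2\<close>, so the tail is
  dominated by a convergent power series in \<open>m powr (- s)\<close>, and each \<open>m\<close>
  comes from at most two integers.\<close>

lemma int_powr_sum_bounded:
  fixes c s :: real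
  assumes c: "0 < c" and s: "1 < s"
  shows "\<exists>C. \<forall>A. finite A \<longrightarrow> (\<Sum>i\<in>A. max 1 (c * (\<bar>real_of_int i\<bar> - 1)) powr (- s)) \<le> C"
proof -
  define f where "f = (\<lambda>i::int. max 1 (c * (\<bar>real_of_int i\<bar> - 1)) powr (- s))"
  define g where "g = (\<lambda>m::nat. max 1 (c * (real m - 1)) powr (- s))"
  have "summable (\<lambda>m. (c / 2) powr (- s) * real m powr (- s))"
    using s by (intro summable_mult) (simp add: summable_real_powr_iff)
  moreover have "\<forall>m\<ge>2. norm (g m) \<le> (c / 2) powr (- s) * real m powr (- s)"
  proof (intro allI impI)
    fix m :: nat assume m: "2 \<le> m"
    have "c * 2 \<le> c * real m" using c m by (intro mult_left_mono) auto
    then have "c / 2 * real m \<le> c * (real m - 1)" by (simp add: field_simps)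
    then have "g m \<le> (c / 2 * real m) powr (- s)"
      unfolding g_def using c m s by (intro powr_mono2') (auto simp del: times_divide_eq_left)
    also have "\<dots> = (c / 2) powr (- s) * real m powr (- s)"
      using c by (subst powr_mult) auto
    finally show "norm (g m) \<le> (c / 2) powr (- s) * real m powr (- s)" by (simp add: g_def)
  qed
  ultimately have g: "summable g" by (meson summable_comparison_test)
  have g0: "0 \<le> g m" for m by (simp add: g_def)
  have f0: "0 \<le> f i" for i by (simp add: f_def)
  have "sum f A \<le> 2 * suminf g" if A: "finite A" for A
  proof -
    define M where "M = (\<lambda>i. nat \<bar>i\<bar>) ` A"
    have M: "finite M" unfolding M_def using A by simp
    have sub: "A \<subseteq> int ` M \<union> (\<lambda>m. - int m) ` M"
    proof
      fix i assume "i \<in> A"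
      then have "nat \<bar>i\<bar> \<in> M" by (simp add: M_def)
      moreover have "i = int (nat \<bar>i\<bar>) \<or> i = - int (nat \<bar>i\<bar>)" by auto
      ultimately show "i \<in> int ` M \<union> (\<lambda>m. - int m) ` M" by blast
    qed
    have fin: "finite (int ` M)" "finite ((\<lambda>m. - int m) ` M)" using M by auto
    have "sum f A \<le> sum f (int ` M \<union> (\<lambda>m. - int m) ` M)"
      using M sub f0 by (intro sum_mono2) auto
    also have "\<dots> \<le> sum f (int ` M) + sum f ((\<lambda>m. - int m) ` M)"
      using sum.union_inter[OF fin, of f] sum_nonneg[of "int ` M \<inter> (\<lambda>m. - int m) ` M" f] f0
      by auto
    also have "sum f (int ` M) = sum g M"
      by (subst sum.reindex) (auto simp: f_def g_def inj_on_def)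
    also have "sum f ((\<lambda>m. - int m) ` M) = sum g M"
      by (subst sum.reindex) (auto simp: f_def g_def inj_on_def)
    also have "sum g M \<le> suminf g" using g g0 M by (intro sum_le_suminf) auto
    finally show ?thesis by simp
  qed
  then show ?thesis unfolding f_def by blast
qed

text \<open>Replacing \<open>u\<close> by \<open>c\<close> times the floor of \<open>u / c\<close>
  moves it by less than \<open>c\<close>, which the centered sum allows for. Hence the bound is
  uniform in the shift \<open>u\<close>.\<close>

lemma shifted_powr_sum_bounded:
  fixes c s :: real
  assumes c: "0 < c" and s: "1 < s"
  shows "\<exists>C. \<forall>u A. finite A \<longrightarrow> (\<Sum>j\<in>A. max 1 \<bar>u - c * real_of_int j\<bar> powr (- s)) \<le> C"
proof -
  define f where "f = (\<lambda>i::int. max 1 (c * (\<bar>real_of_int i\<bar> - 1)) powr (- s))"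
  obtain C where C: "\<And>A. finite A \<Longrightarrow> sum f A \<le> C"
    using int_powr_sum_bounded[OF assms] unfolding f_def by blast
  have "(\<Sum>j\<in>A. max 1 \<bar>u - c * real_of_int j\<bar> powr (- s)) \<le> C" if A: "finite A" for u A
  proof -
    define k where "k = \<lfloor>u / c\<rfloor>"
    have k: "c * k \<le> u" "u < c * k + c"
      using c floor_correct[of "u / c"] mult_left_mono[OF of_int_floor_le[of "u / c"], of c]
      by (auto simp: k_def field_simps)
    have "max 1 \<bar>u - c * real_of_int j\<bar> powr (- s) \<le> f (k - j)" for j
    proof -
      have "c * \<bar>real_of_int (k - j)\<bar> = \<bar>c * k - c * real_of_int j\<bar>"
        using c by (simp add: abs_mult flip: right_diff_distrib)
      also have "\<dots> \<le> \<bar>u - c * real_of_int j\<bar> + c" using k by linarith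
      finally have "c * (\<bar>real_of_int (k - j)\<bar> - 1) \<le> \<bar>u - c * real_of_int j\<bar>"
        by (simp add: right_diff_distrib)
      then show ?thesis unfolding f_def using s by (intro powr_mono2') auto
    qed
    then have "(\<Sum>j\<in>A. max 1 \<bar>u - c * real_of_int j\<bar> powr (- s)) \<le> (\<Sum>j\<in>A. f (k - j))"
      by (intro sum_mono)
    also have "\<dots> = sum f ((\<lambda>j. k - j) ` A)" by (subst sum.reindex) (auto simp: inj_on_def)
    also have "\<dots> \<le> C" using A by (intro C) auto
    finally show ?thesis .
  qed
  then show ?thesis by blast
qed

text \<open>A finite set of lattice points is enclosed in a finite product set, over which the sum
  of products factors into one-dimensional sums.\<close>

lemma lattice_prod_sum_bounded:
  fixes c s :: real
  assumes c: "0 < c" and s: "1 < s"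
  shows "\<exists>C. \<forall>(u::real^'n) (J :: (int^'n) set). finite J \<longrightarrow>
    (\<Sum>j\<in>J. \<Prod>i\<in>UNIV. max 1 \<bar>u $ i - c * real_of_int (j $ i)\<bar> powr (- s)) \<le> C"
proof -
  obtain C where C: "\<And>u A. finite A \<Longrightarrow> (\<Sum>j\<in>A. max 1 \<bar>u - c * real_of_int j\<bar> powr (- s)) \<le> C"
    using shifted_powr_sum_bounded[OF assms] by blast
  have "(\<Sum>j\<in>J. \<Prod>i\<in>UNIV. max 1 \<bar>u $ i - c * real_of_int (j $ i)\<bar> powr (- s)) \<le> C ^ CARD('n)"
    if J: "finite J" for u :: "real^'n" and J :: "(int^'n) set"
  proof -
    define A where "A = (\<Union>i. (\<lambda>j. j $ i) ` J)"
    have A: "finite A" using J by (simp add: A_def)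
    define h where "h = (\<lambda>i a. max 1 \<bar>u $ i - c * real_of_int a\<bar> powr (- s))"
    have inj: "inj_on (\<lambda>j i. j $ i) J" by (auto simp: inj_on_def vec_eq_iff fun_eq_iff)
    have "(\<Sum>j\<in>J. \<Prod>i\<in>UNIV. h i (j $ i)) = (\<Sum>g\<in>(\<lambda>j i. j $ i) ` J. \<Prod>i\<in>UNIV. h i (g i))"
      by (subst sum.reindex[OF inj]) simp
    also have "\<dots> \<le> (\<Sum>g\<in>PiE UNIV (\<lambda>_. A). \<Prod>i\<in>UNIV. h i (g i))"
      using A by (intro sum_mono2 finite_PiE prod_nonneg) (auto simp: A_def h_def)
    also have "\<dots> = (\<Prod>i\<in>UNIV. \<Sum>a\<in>A. h i a)"
      using A by (subst prod_sum_PiE) auto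
    also have "\<dots> \<le> (\<Prod>i\<in>(UNIV::'n set). C)"
      using A by (intro prod_mono conjI sum_nonneg) (auto simp: h_def intro: C)
    finally show ?thesis by (simp add: h_def)
  qed
  then show ?thesis by blast
qed

text \<open>Let \<open>M\<close> be the largest of the numbers \<open>max 1 \<bar>y i\<bar>\<close>.
  The weight is at least \<open>M ^ (2 * N)\<close>, and spreading this power evenly over the
  \<open>d\<close> coordinates bounds its reciprocal by a product with exponent
  \<open>s = 2 * N / d\<close> each. This exponent exceeds 1 exactly because
  \<open>d < 2 * N\<close>.\<close>

lemma lattice_weight_sum_bounded:
  fixes c :: real
  assumes c: "0 < c" and N: "CARD('n) < 2 * N"
  shows "\<exists>C\<ge>0. \<forall>(u::real^'n) (J :: (int^'n) set). finite J \<longrightarrow>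
    (\<Sum>j\<in>J. 1 / (1 + (\<Sum>i\<in>UNIV. \<bar>u $ i - c * real_of_int (j $ i)\<bar> ^ (2 * N)))) \<le> C"
proof -
  define d where "d = real CARD('n)"
  have d: "d > 0" by (simp add: d_def)
  define s where "s = real (2 * N) / d"
  have s: "1 < s" using N d by (simp add: s_def d_def)
  have weight: "1 / (1 + (\<Sum>i\<in>UNIV. \<bar>y i\<bar> ^ (2 * N))) \<le> (\<Prod>i\<in>UNIV. max 1 \<bar>y i\<bar> powr (- s))"
    for y :: "'n \<Rightarrow> real"
  proof -
    define M where "M = Max (range (\<lambda>i. max 1 \<bar>y i\<bar>))"
    have M: "max 1 \<bar>y i\<bar> \<le> M" for i unfolding M_def by (intro Max_ge) auto
    have M1: "1 \<le> M" using M[of undefined] by auto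
    have "M \<in> range (\<lambda>i. max 1 \<bar>y i\<bar>)" unfolding M_def by (intro Max_in) auto
    then obtain i0 where i0: "M = max 1 \<bar>y i0\<bar>" by blast
    have "\<bar>y i0\<bar> ^ (2 * N) \<le> (\<Sum>i\<in>UNIV. \<bar>y i\<bar> ^ (2 * N))"
      by (intro member_le_sum) auto
    then have "M ^ (2 * N) \<le> 1 + (\<Sum>i\<in>UNIV. \<bar>y i\<bar> ^ (2 * N))"
      unfolding i0 by (auto simp: max_def add_increasing2 intro: sum_nonneg)
    moreover have "(M powr (- s)) ^ CARD('n) = 1 / M ^ (2 * N)"
    proof -
      have "(M powr (- s)) ^ CARD('n) = M powr (- s * d)"
        using M1 by (simp add: powr_powr d_def flip: powr_realpow)
      also have "- s * d = - real (2 * N)" using d by (simp add: s_def)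
      finally show ?thesis using M1 by (simp only: powr_minus powr_realpow) (simp add: divide_inverse powr_realpow)
    qed
    moreover have "(\<Prod>i\<in>(UNIV::'n set). M powr (- s)) \<le> (\<Prod>i\<in>UNIV. max 1 \<bar>y i\<bar> powr (- s))"
      using M s by (intro prod_mono conjI powr_mono2') auto
    moreover have "1 / (1 + (\<Sum>i\<in>UNIV. \<bar>y i\<bar> ^ (2 * N))) \<le> 1 / M ^ (2 * N)"
      using calculation(1) M1 by (intro divide_left_mono mult_pos_pos add_pos_nonneg sum_nonneg) auto
    ultimately show ?thesis by simp
  qed
  obtain C where C: "\<And>(u::real^'n) (J :: (int^'n) set). finite J \<Longrightarrow>
    (\<Sum>j\<in>J. \<Prod>i\<in>UNIV. max 1 \<bar>u $ i - c * real_of_int (j $ i)\<bar> powr (- s)) \<le> C"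
    using lattice_prod_sum_bounded[OF c s, where 'n='n] by blast
  have "(\<Sum>j\<in>J. 1 / (1 + (\<Sum>i\<in>UNIV. \<bar>u $ i - c * real_of_int (j $ i)\<bar> ^ (2 * N)))) \<le> C"
    if "finite J" for u :: "real^'n" and J :: "(int^'n) set"
    by (rule order_trans[OF sum_mono C[OF that, of u]]) (rule weight)
  moreover have "0 \<le> C" using C[of "{}"] by simp
  ultimately show ?thesis by blast
qed

section \<open>Lattice sums of Fourier integrals of the symbol\<close>

lemma test_function_borel:
  fixes u :: "real^'n \<Rightarrow> complex"
  assumes "test_function U u" shows "u \<in> borel_measurable lebesgue"
proof -
  have "u \<in> borel_measurable borel"
    using assms by (intro borel_measurable_continuous_onI smooth_imp_continuous) (simp add: test_function_def)
  then show ?thesis by (simp add: measurable_completion)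
qed

lemma locally_integrable_mult_test:
  fixes g u :: "real^'n \<Rightarrow> complex"
  assumes g: "locally_integrable_on g U" and u: "test_function U u"
  shows "integrable lebesgue (\<lambda>x. g x * u x)"
proof -
  obtain B where B: "\<And>x. cmod (u x) \<le> B" using test_function_bounded[OF u] by blast
  define h where "h = (\<lambda>x. indicator (supp u) x *\<^sub>R g x)"
  have "set_integrable lebesgue (supp u) g"
    using g u by (auto simp: locally_integrable_on_def test_function_def)
  then have i: "integrable lebesgue h" by (simp add: set_integrable_def h_def)
  have eq: "g x * u x = u x * h x" for x
    by (cases "x \<in> supp u") (auto simp: not_in_supp h_def)
  have "integrable lebesgue (\<lambda>x. u x * h x)"
  proof (rule Bochner_Integration.integrable_bound)
    show "integrable lebesgue (\<lambda>x. B * norm (h x))" using i by simp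
    show "AE x in lebesgue. norm (u x * h x) \<le> norm (B * norm (h x))"
    proof (rule AE_I2)
      fix x
      have "norm (u x) * norm (h x) \<le> B * norm (h x)"
        by (intro mult_right_mono B) simp
      also have "\<dots> \<le> norm (B * norm (h x))" by simp
      finally show "norm (u x * h x) \<le> norm (B * norm (h x))"
        by (simp add: norm_mult)
    qed
    show "(\<lambda>x. u x * h x) \<in> borel_measurable lebesgue"
      by (intro borel_measurable_times test_function_borel[OF u] borel_measurable_integrable[OF i])
  qed
  then show ?thesis by (simp add: eq)
qed

lemma locally_L2_mult_test:
  fixes g u :: "real^'n \<Rightarrow> complex"
  assumes g: "locally_integrable_on g U" and u: "test_function U u"
    and S: "supp u \<subseteq> ball c r" and B: "\<And>x. cmod (u x) \<le> B"
    and g2: "set_integrable lebesgue (ball c r) (\<lambda>x. (cmod (g x))\<^sup>2)"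
  shows "integrable lebesgue (\<lambda>x. (cmod (g x * u x))\<^sup>2)"
    and "(LINT x|lebesgue. (cmod (g x * u x))\<^sup>2) \<le> B\<^sup>2 * (LINT x:ball c r|lebesgue. (cmod (g x))\<^sup>2)"
proof -
  have i: "integrable lebesgue (\<lambda>x. B\<^sup>2 * (indicator (ball c r) x *\<^sub>R (cmod (g x))\<^sup>2))"
    using g2 by (simp add: set_integrable_def)
  have le: "(cmod (g x * u x))\<^sup>2 \<le> B\<^sup>2 * (indicator (ball c r) x *\<^sub>R (cmod (g x))\<^sup>2)" for x
  proof (cases "x \<in> ball c r")
    case True
    have "(cmod (u x))\<^sup>2 \<le> B\<^sup>2" by (intro power_mono B) simp
    then have "(cmod (u x))\<^sup>2 * (cmod (g x))\<^sup>2 \<le> B\<^sup>2 * (cmod (g x))\<^sup>2" by (rule mult_right_mono) simp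
    then show ?thesis using True by (simp add: norm_mult power_mult_distrib mult.commute)
  next
    case False
    then have "u x = 0" using S not_in_supp by blast
    then show ?thesis by simp
  qed
  show 1: "integrable lebesgue (\<lambda>x. (cmod (g x * u x))\<^sup>2)"
  proof (rule Bochner_Integration.integrable_bound[OF i])
    show "(\<lambda>x. (cmod (g x * u x))\<^sup>2) \<in> borel_measurable lebesgue"
      using borel_measurable_integrable[OF locally_integrable_mult_test[OF g u]]
      by measurable
    show "AE x in lebesgue. norm ((cmod (g x * u x))\<^sup>2) \<le> norm (B\<^sup>2 * (indicator (ball c r) x *\<^sub>R (cmod (g x))\<^sup>2))"
      using le by (intro AE_I2) (simp only: real_norm_def abs_of_nonneg zero_le_power2 order_trans[OF zero_le_power2 le])
  qed
  have "(LINT x|lebesgue. (cmod (g x * u x))\<^sup>2) \<le> (LINT x|lebesgue. B\<^sup>2 * (indicator (ball c r) x *\<^sub>R (cmod (g x))\<^sup>2))"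
    by (rule integral_mono[OF 1 i le])
  then show "(LINT x|lebesgue. (cmod (g x * u x))\<^sup>2) \<le> B\<^sup>2 * (LINT x:ball c r|lebesgue. (cmod (g x))\<^sup>2)"
    by (simp add: set_lebesgue_integral_def)
qed

lemma weak_deriv_pure:
  assumes "weak_deriv U (unit_multi i n) m g" "test_function U \<psi>"
  shows "(LINT x|lebesgue. m x * pure_deriv i n \<psi> x) = (-1) ^ n * (LINT x|lebesgue. g x * \<psi> x)"
  using assms unfolding weak_deriv_def multi_deriv_unit_multi multi_order_unit_multi by blast

text \<open>In \<open>dual_leibniz\<close> every term is a pure derivative of a test function, the
  exponential being part of it, so the definition of the weak derivative moves that derivative onto
  \<open>m\<close> directly. The constant is the sum of the moduli of the coefficients, hence
  uniform in \<open>\<Phi>\<close> and \<open>y\<close>.\<close>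

lemma weak_dual_leibniz:
  fixes m :: "real^'n \<Rightarrow> complex" and g :: "nat \<Rightarrow> real^'n \<Rightarrow> complex"
  assumes g: "\<And>n. n \<le> N \<Longrightarrow> weak_deriv U (unit_multi i n) m (g n)"
  shows "\<exists>C\<ge>0. \<forall>\<Phi> y. test_function U \<Phi> \<longrightarrow>
    \<bar>y $ i\<bar> ^ N * cmod (multiplier_integral m \<Phi> y) \<le>
    C * (\<Sum>l\<le>N. cmod (LINT x|lebesgue. g (N - l) x * (pure_deriv i l \<Phi> x * cis (y \<bullet> x))))"
proof -
  obtain c where c: "\<And>\<Phi> (v::real^'n) x. smooth \<Phi> \<Longrightarrow>
     (\<i> * complex_of_real (v $ i)) ^ N * (\<Phi> x * cis (v \<bullet> x)) =
     (\<Sum>l\<le>N. c l * pure_deriv i (N - l)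
        (\<lambda>x. pure_deriv i l \<Phi> x * cis (v \<bullet> x)) x)"
    using dual_leibniz[of i N] by blast
  define C where "C = (\<Sum>l\<le>N. cmod (c l))"
  have m: "locally_integrable_on m U" using g[of 0] by (simp add: weak_deriv_def)
  have "\<bar>y $ i\<bar> ^ N * cmod (multiplier_integral m \<Phi> y) \<le>
    C * (\<Sum>l\<le>N. cmod (LINT x|lebesgue. g (N - l) x * (pure_deriv i l \<Phi> x * cis (y \<bullet> x))))"
    if \<Phi>: "test_function U \<Phi>" for \<Phi> y
  proof -
    define \<psi> where "\<psi> = (\<lambda>l x. pure_deriv i l \<Phi> x * cis (y \<bullet> x))"
    define J where "J = (\<lambda>l. LINT x|lebesgue. g (N - l) x * \<psi> l x)"
    have \<psi>: "test_function U (\<psi> l)" for l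
      unfolding \<psi>_def by (intro test_function_mult test_function_iter_partial \<Phi> smooth_cis_inner)
    have sm: "smooth \<Phi>" using \<Phi> by (simp add: test_function_def)
    have int: "integrable lebesgue (\<lambda>x. m x * pure_deriv i (N - l) (\<psi> l) x)" for l
      by (intro locally_integrable_mult_test[OF m] test_function_iter_partial \<psi>)
    have "(\<i> * complex_of_real (y $ i)) ^ N * (multiplier_integral m \<Phi> y) =
        (LINT x|lebesgue. m x * ((\<i> * complex_of_real (y $ i)) ^ N * (\<Phi> x * cis (y \<bullet> x))))"
      by (simp only: integral_mult_right_zero[symmetric]) (simp only: mult.left_commute)
    also have "\<dots> = (LINT x|lebesgue. (\<Sum>l\<le>N. c l * (m x * pure_deriv i (N - l) (\<psi> l) x)))"
      by (simp only: c[OF sm] sum_distrib_left \<psi>_def) (simp only: mult.left_commute)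
    also have "\<dots> = (\<Sum>l\<le>N. c l * (LINT x|lebesgue. m x * pure_deriv i (N - l) (\<psi> l) x))"
      by (simp only: Bochner_Integration.integral_sum int integrable_mult_right integral_mult_right_zero)
    also have "\<dots> = (\<Sum>l\<le>N. c l * ((-1) ^ (N - l) * J l))"
    proof (intro sum.cong refl)
      fix l
      show "c l * (LINT x|lebesgue. m x * pure_deriv i (N - l) (\<psi> l) x) = c l * ((-1) ^ (N - l) * J l)"
        unfolding J_def weak_deriv_pure[OF g[OF diff_le_self] \<psi>] ..
    qed
    finally have eq: "(\<i> * complex_of_real (y $ i)) ^ N * (multiplier_integral m \<Phi> y) =
        (\<Sum>l\<le>N. c l * ((-1) ^ (N - l) * J l))" .
    have "\<bar>y $ i\<bar> ^ N * cmod (multiplier_integral m \<Phi> y) =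
        cmod (\<Sum>l\<le>N. c l * ((-1) ^ (N - l) * J l))"
      unfolding eq[symmetric] by (simp add: norm_mult norm_power)
    also have "\<dots> \<le> (\<Sum>l\<le>N. cmod (c l) * cmod (J l))"
      by (rule order_trans[OF norm_sum]) (simp add: norm_mult norm_power)
    also have "\<dots> \<le> (\<Sum>l\<le>N. C * cmod (J l))"
      unfolding C_def by (intro sum_mono mult_right_mono member_le_sum) auto
    also have "\<dots> = C * (\<Sum>l\<le>N. cmod (J l))" by (simp add: sum_distrib_left)
    finally show ?thesis unfolding J_def \<psi>_def .
  qed
  moreover have "0 \<le> C" unfolding C_def by (intro sum_nonneg) auto
  ultimately show ?thesis by blast
qed

lemma inner_lattice_point:
  "lattice_point \<alpha> b \<rho> \<xi> j \<bullet> x = b * \<rho> * norm \<xi> powr (\<alpha> - 1) * (\<Sum>i\<in>UNIV. real_of_int (j $ i) * x $ i)"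
  by (simp add: lattice_point_def inner_vec_def sum_distrib_left mult.assoc)

text \<open>The lattice at \<open>\<xi>\<close> has spacing \<open>b * \<rho> / s\<close>, so its
  exponentials have the common period \<open>T = 2 * pi * s / (b * \<rho>)\<close> in each
  coordinate. The condition \<open>b * \<rho> * R < pi\<close> says that the ball of radius
  \<open>R * s\<close> fits into the cube of side \<open>T\<close> around \<open>\<xi>\<close>. The
  translation \<open>v\<close> only contributes a unimodular factor to \<open>H\<close>.\<close>

lemma bessel_lattice:
  fixes H :: "real^'n \<Rightarrow> complex"
  assumes \<xi>: "\<xi> \<noteq> 0" and b: "0 < b" "0 < \<rho>" "0 < R" "b * \<rho> * R < pi" and J: "finite J"
    and H: "H \<in> borel_measurable lebesgue" "integrable lebesgue (\<lambda>x. (cmod (H x))\<^sup>2)"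
    and supp: "\<And>x. x \<notin> ball \<xi> (R * freq_scale \<alpha> \<xi>) \<Longrightarrow> H x = 0"
  shows "(\<Sum>j\<in>J. (cmod (LINT x|lebesgue. H x * cis ((v + lattice_point \<alpha> b \<rho> \<xi> j) \<bullet> x)))\<^sup>2)
    \<le> (2 * pi / (b * \<rho>) * freq_scale \<alpha> \<xi>) ^ CARD('n) * (LINT x|lebesgue. (cmod (H x))\<^sup>2)"
proof -
  define s where "s = freq_scale \<alpha> \<xi>"
  have s: "0 < s" using \<xi> by (simp add: s_def)
  have s': "norm \<xi> powr (\<alpha> - 1) = 1 / s"
    unfolding s_def by (simp flip: powr_minus_divide)
  define T where "T = 2 * pi / (b * \<rho>) * s"
  have T: "0 < T" unfolding T_def using s b by simp
  have T': "2 * pi / T = b * \<rho> * norm \<xi> powr (\<alpha> - 1)" unfolding T_def s' using s b by simp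
  define z where "z = (\<chi> i. \<xi> $ i - T / 2)"
  have RT: "R * s < T / 2"
  proof -
    have "(b * \<rho> * R) * s < pi * s" using s b by (intro mult_strict_right_mono) auto
    then show ?thesis unfolding T_def using b by (simp add: field_simps)
  qed
  have cism: "(\<lambda>x::real^'n. cis (v \<bullet> x)) \<in> borel_measurable lebesgue"
  proof -
    have "(\<lambda>x::real^'n. cis (v \<bullet> x)) \<in> borel_measurable borel"
      by (intro borel_measurable_continuous_onI continuous_intros)
    then show ?thesis by (simp add: measurable_completion)
  qed
  have "(\<Sum>j\<in>J. (cmod (LINT x|lebesgue. (H x * cis (v \<bullet> x)) * cis (2 * pi / T * (\<Sum>i\<in>UNIV. real_of_int (j $ i) * x $ i))))\<^sup>2)
    \<le> T ^ CARD('n) * (LINT x|lebesgue. (cmod (H x * cis (v \<bullet> x)))\<^sup>2)"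
  proof (rule bessel_exponentials[OF T J, where z = z])
    show "(\<lambda>x. H x * cis (v \<bullet> x)) \<in> borel_measurable lebesgue"
      by (intro borel_measurable_times H cism)
    show "integrable lebesgue (\<lambda>x. (cmod (H x * cis (v \<bullet> x)))\<^sup>2)" using H by (simp add: norm_mult)
    show "H x * cis (v \<bullet> x) = 0" if nx: "x \<notin> cbox z (\<chi> i. z $ i + T)" for x
    proof -
      have "\<not> (\<forall>i. z $ i \<le> x $ i \<and> x $ i \<le> z $ i + T)" using nx by (simp add: mem_box_cart)
      then obtain i where "\<not> (z $ i \<le> x $ i \<and> x $ i \<le> z $ i + T)" by blast
      then have "x $ i \<notin> {\<xi> $ i - T / 2 .. \<xi> $ i + T / 2}" by (auto simp: z_def)
      then have "T / 2 < \<bar>(x - \<xi>) $ i\<bar>"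
        unfolding atLeastAtMost_iff vector_minus_component by linarith
      also have "\<dots> \<le> norm (x - \<xi>)" by (rule component_le_norm_cart)
      finally have "x \<notin> ball \<xi> (R * freq_scale \<alpha> \<xi>)"
        using RT by (simp add: s_def dist_norm norm_minus_commute)
      then show ?thesis using supp by simp
    qed
  qed
  also have "(\<lambda>x. (cmod (H x * cis (v \<bullet> x)))\<^sup>2) = (\<lambda>x. (cmod (H x))\<^sup>2)" by (simp add: norm_mult)
  also have "(\<Sum>j\<in>J. (cmod (LINT x|lebesgue. (H x * cis (v \<bullet> x)) * cis (2 * pi / T * (\<Sum>i\<in>UNIV. real_of_int (j $ i) * x $ i))))\<^sup>2)
     = (\<Sum>j\<in>J. (cmod (LINT x|lebesgue. H x * cis ((v + lattice_point \<alpha> b \<rho> \<xi> j) \<bullet> x)))\<^sup>2)"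
    unfolding T' by (simp only: mult.assoc[of "H _"] cis_mult inner_add_left inner_lattice_point)
  finally show ?thesis unfolding T_def s_def .
qed

text \<open>The condition is used for the multi-index \<open>unit_multi i n\<close> with \<kappa> =
  \<open>R\<close>, on balls of radius exactly \<open>R\<close> times the scale. Multiplying the
  average by the volume of the ball, a constant times \<open>s ^ d\<close>, gives the
  integral.\<close>

lemma hoermander_miyachi_pure:
  fixes m :: "real^'n \<Rightarrow> complex"
  assumes hm: "hoermander_miyachi \<alpha> \<mu> m" and \<alpha>: "0 < \<alpha>" and R: "1 \<le> R" and n: "n \<le> CARD('n) div 2 + 1"
  shows "\<exists>g C. 0 \<le> C \<and> weak_deriv (- {0}) (unit_multi i n) m g \<and>
    (\<forall>\<xi>. 1 \<le> norm \<xi> \<longrightarrow>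
      set_integrable lebesgue (ball \<xi> (R * freq_scale \<alpha> \<xi>)) (\<lambda>x. (cmod (g x))\<^sup>2) \<and>
      (LINT x:ball \<xi> (R * freq_scale \<alpha> \<xi>)|lebesgue. (cmod (g x))\<^sup>2) \<le>
        C * (norm \<xi> powr (- \<mu>) * (1 / freq_scale \<alpha> \<xi>) ^ n)\<^sup>2 * (freq_scale \<alpha> \<xi>) ^ CARD('n))"
proof -
  have "\<exists>g. weak_deriv (- {0}) (unit_multi i n) m g \<and>
           (\<forall>\<kappa>\<ge>1. \<exists>C. \<forall>c r.
              norm c powr \<alpha> \<ge> 1 \<and> 1 / \<kappa> \<le> r / freq_scale \<alpha> c \<and> r / freq_scale \<alpha> c \<le> \<kappa> \<longrightarrow>
              set_integrable lebesgue (ball c r) (\<lambda>\<xi>. (cmod (g \<xi>))\<^sup>2) \<and>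
              norm c powr (\<mu> + (1 - \<alpha>) * real n) *
                sqrt ((LINT \<xi>:ball c r|lebesgue. (cmod (g \<xi>))\<^sup>2) / measure lebesgue (ball c r)) \<le> C)"
    using hm[unfolded hoermander_miyachi_def, THEN spec, of "unit_multi i n"] n
    by (simp only: multi_order_unit_multi)
  then obtain g where wd: "weak_deriv (- {0}) (unit_multi i n) m g"
    and g: "\<forall>\<kappa>\<ge>1. \<exists>C. \<forall>c r.
              norm c powr \<alpha> \<ge> 1 \<and> 1 / \<kappa> \<le> r / freq_scale \<alpha> c \<and> r / freq_scale \<alpha> c \<le> \<kappa> \<longrightarrow>
              set_integrable lebesgue (ball c r) (\<lambda>\<xi>. (cmod (g \<xi>))\<^sup>2) \<and>
              norm c powr (\<mu> + (1 - \<alpha>) * real n) *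
                sqrt ((LINT \<xi>:ball c r|lebesgue. (cmod (g \<xi>))\<^sup>2) / measure lebesgue (ball c r)) \<le> C"
    by (elim exE conjE) (rule that)
  obtain C0 where C0: "\<forall>c r.
              norm c powr \<alpha> \<ge> 1 \<and> 1 / R \<le> r / freq_scale \<alpha> c \<and> r / freq_scale \<alpha> c \<le> R \<longrightarrow>
              set_integrable lebesgue (ball c r) (\<lambda>\<xi>. (cmod (g \<xi>))\<^sup>2) \<and>
              norm c powr (\<mu> + (1 - \<alpha>) * real n) *
                sqrt ((LINT \<xi>:ball c r|lebesgue. (cmod (g \<xi>))\<^sup>2) / measure lebesgue (ball c r)) \<le> C0"
    using g R by (elim allE[of _ R] impE exE) (simp, rule that)
  define V where "V = unit_ball_vol (real CARD('n)) * R ^ CARD('n)"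
  have V: "0 < V" using R by (simp add: V_def)
  have "set_integrable lebesgue (ball \<xi> (R * freq_scale \<alpha> \<xi>)) (\<lambda>x. (cmod (g x))\<^sup>2) \<and>
      (LINT x:ball \<xi> (R * freq_scale \<alpha> \<xi>)|lebesgue. (cmod (g x))\<^sup>2) \<le>
        (V * C0\<^sup>2) * (norm \<xi> powr (- \<mu>) * (1 / freq_scale \<alpha> \<xi>) ^ n)\<^sup>2 * (freq_scale \<alpha> \<xi>) ^ CARD('n)"
    if \<xi>: "1 \<le> norm \<xi>" for \<xi> :: "real^'n"
  proof -
    define s where "s = freq_scale \<alpha> \<xi>"
    have pos: "0 < norm \<xi>" using \<xi> by linarith
    have s: "0 < s" unfolding s_def using pos by simp
    define I where "I = (LINT x:ball \<xi> (R * s)|lebesgue. (cmod (g x))\<^sup>2)"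
    define P where "P = norm \<xi> powr (- \<mu>) * (1 / s) ^ n"
    have P: "0 < P" unfolding P_def using pos s by simp
    have Pi: "norm \<xi> powr (\<mu> + (1 - \<alpha>) * real n) = 1 / P"
    proof -
      have "s ^ n = norm \<xi> powr ((1 - \<alpha>) * real n)"
        unfolding s_def using pos by (simp add: powr_powr flip: powr_realpow)
      then show ?thesis unfolding P_def powr_add using pos s
        by (simp add: powr_minus power_one_over field_simps)
    qed
    have "1 \<le> norm \<xi> powr \<alpha>" using \<xi> \<alpha> by (intro ge_one_powr_ge_zero) auto
    moreover have "1 / R \<le> R * s / s" "R * s / s \<le> R"
      using s R mult_mono[OF R R] by (auto simp: field_simps)
    ultimately have *: "set_integrable lebesgue (ball \<xi> (R * s)) (\<lambda>x. (cmod (g x))\<^sup>2)"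
      "1 / P * sqrt (I / measure lebesgue (ball \<xi> (R * s))) \<le> C0"
      using C0[THEN spec, THEN spec, of \<xi> "R * s"] unfolding I_def Pi s_def by blast+
    have meas: "measure lebesgue (ball \<xi> (R * s)) = V * s ^ CARD('n)"
      using R s by (simp add: content_ball V_def power_mult_distrib)
    have I0: "0 \<le> I" unfolding I_def set_lebesgue_integral_def by (rule integral_nonneg_AE) (auto simp: indicator_def)
    have "sqrt (I / (V * s ^ CARD('n))) \<le> C0 * P"
      using *(2) P by (simp add: meas field_simps)
    then have "(sqrt (I / (V * s ^ CARD('n))))\<^sup>2 \<le> (C0 * P)\<^sup>2"
      using I0 V s by (intro power_mono) auto
    then have "I / (V * s ^ CARD('n)) \<le> (C0 * P)\<^sup>2" using I0 V s by simp
    then have "I \<le> V * C0\<^sup>2 * P\<^sup>2 * s ^ CARD('n)"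
      using V s by (simp add: field_simps power_mult_distrib)
    then show ?thesis using *(1) unfolding I_def P_def s_def by blast
  qed
  then show ?thesis using wd V by (intro exI[of _ g] exI[of _ "V * C0\<^sup>2"]) auto
qed

text \<open>In the \<open>l\<close>-th term \<open>l\<close> derivatives fall on
  \<open>\<Phi>\<close> and \<open>n - l\<close> on the symbol; they cost \<open>(L / s) ^ l\<close>
  and \<open>(1 / s) ^ (n - l)\<close>, and the weight \<open>s ^ n\<close> compensates both. What
  remains is \<open>s ^ d\<close> from the period cube and \<open>s ^ d\<close> from the volume of
  the ball, that is, the square of \<open>s ^ d\<close>. The constant may depend on \<open>L\<close>
  but not on the center, the test function or the shift.\<close>

lemma weighted_bessel:
  fixes m :: "real^'n \<Rightarrow> complex"
  assumes hm: "hoermander_miyachi \<alpha> \<mu> m" and \<alpha>: "0 < \<alpha>" and R: "1 \<le> R"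
    and b: "0 < b" "0 < \<rho>" "b * \<rho> * R < pi" and n: "n \<le> CARD('n) div 2 + 1"
  shows "\<exists>C\<ge>0. \<forall>\<xi> \<Phi> A v J. 1 \<le> norm \<xi> \<longrightarrow> finite J \<longrightarrow> test_function (- {0}) \<Phi> \<longrightarrow>
    supp \<Phi> \<subseteq> ball \<xi> (R * freq_scale \<alpha> \<xi>) \<longrightarrow> 0 \<le> A \<longrightarrow> deriv_bound n A (L / freq_scale \<alpha> \<xi>) \<Phi> \<longrightarrow>
    (\<Sum>j\<in>J. ((freq_scale \<alpha> \<xi> * \<bar>(v + lattice_point \<alpha> b \<rho> \<xi> j) $ i\<bar>) ^ n *
        cmod (multiplier_integral m \<Phi> (v + lattice_point \<alpha> b \<rho> \<xi> j)))\<^sup>2)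
      \<le> C * (A * (freq_scale \<alpha> \<xi>) ^ CARD('n) * norm \<xi> powr (- \<mu>))\<^sup>2"
proof -
  have "\<forall>l. \<exists>g C. l \<le> n \<longrightarrow> 0 \<le> C \<and> weak_deriv (- {0}) (unit_multi i l) m g \<and>
    (\<forall>\<xi>. 1 \<le> norm \<xi> \<longrightarrow>
      set_integrable lebesgue (ball \<xi> (R * freq_scale \<alpha> \<xi>)) (\<lambda>x. (cmod (g x))\<^sup>2) \<and>
      (LINT x:ball \<xi> (R * freq_scale \<alpha> \<xi>)|lebesgue. (cmod (g x))\<^sup>2) \<le>
        C * (norm \<xi> powr (- \<mu>) * (1 / freq_scale \<alpha> \<xi>) ^ l)\<^sup>2 * (freq_scale \<alpha> \<xi>) ^ CARD('n))"
    (is "\<forall>l. \<exists>g C. l \<le> n \<longrightarrow> ?P l g C")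
  proof
    fix l show "\<exists>g C. l \<le> n \<longrightarrow> ?P l g C"
      using hoermander_miyachi_pure[OF hm \<alpha> R, of l i] n by (cases "l \<le> n") auto
  qed
  then obtain g Cg where gC: "\<And>l. l \<le> n \<Longrightarrow> ?P l (g l) (Cg l)" by metis
  have Cg: "0 \<le> Cg l" and wd: "weak_deriv (- {0}) (unit_multi i l) m (g l)"
    and g2: "\<And>\<xi>. 1 \<le> norm \<xi> \<Longrightarrow> set_integrable lebesgue (ball \<xi> (R * freq_scale \<alpha> \<xi>)) (\<lambda>x. (cmod (g l x))\<^sup>2)"
    and g2_le: "\<And>\<xi>. 1 \<le> norm \<xi> \<Longrightarrow> (LINT x:ball \<xi> (R * freq_scale \<alpha> \<xi>)|lebesgue. (cmod (g l x))\<^sup>2) \<le>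
        Cg l * (norm \<xi> powr (- \<mu>) * (1 / freq_scale \<alpha> \<xi>) ^ l)\<^sup>2 * (freq_scale \<alpha> \<xi>) ^ CARD('n)"
    if "l \<le> n" for l
    using gC[OF that] by blast+
  obtain C1 where C1: "0 \<le> C1" and leib: "\<And>\<Phi> (y::real^'n). test_function (- {0}) \<Phi> \<Longrightarrow>
    \<bar>y $ i\<bar> ^ n * cmod (multiplier_integral m \<Phi> y) \<le>
    C1 * (\<Sum>l\<le>n. cmod (LINT x|lebesgue. g (n - l) x * (pure_deriv i l \<Phi> x * cis (y \<bullet> x))))"
    using weak_dual_leibniz[of n "- {0}" i m g] wd by blast
  define K where "K = (2 * pi / (b * \<rho>)) ^ CARD('n)"
  have K: "0 \<le> K" unfolding K_def using b by simp
  define C where "C = C1\<^sup>2 * (\<Sum>l\<le>n. K * Cg (n - l) * (L ^ l)\<^sup>2) * real (Suc n)"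
  have "(\<Sum>j\<in>J. ((freq_scale \<alpha> \<xi> * \<bar>(v + lattice_point \<alpha> b \<rho> \<xi> j) $ i\<bar>) ^ n *
        cmod (multiplier_integral m \<Phi> (v + lattice_point \<alpha> b \<rho> \<xi> j)))\<^sup>2)
      \<le> C * (A * (freq_scale \<alpha> \<xi>) ^ CARD('n) * norm \<xi> powr (- \<mu>))\<^sup>2"
    if \<xi>: "1 \<le> norm \<xi>" and J: "finite J" and \<Phi>: "test_function (- {0}) \<Phi>"
      and S: "supp \<Phi> \<subseteq> ball \<xi> (R * freq_scale \<alpha> \<xi>)" and A: "0 \<le> A"
      and D: "deriv_bound n A (L / freq_scale \<alpha> \<xi>) \<Phi>" for \<xi> \<Phi> A v J
  proof -
    define s where "s = freq_scale \<alpha> \<xi>"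
    have pos: "0 < norm \<xi>" using \<xi> by linarith
    have s: "0 < s" unfolding s_def using pos by simp
    define y where "y = (\<lambda>j. v + lattice_point \<alpha> b \<rho> \<xi> j)"
    define W where "W = norm \<xi> powr (- \<mu>)"
    define h where "h = (\<lambda>l j. cmod (LINT x|lebesgue. g (n - l) x * (pure_deriv i l \<Phi> x * cis (y j \<bullet> x))))"
    have hsum: "s ^ (2 * n) * (\<Sum>j\<in>J. (h l j)\<^sup>2) \<le> K * Cg (n - l) * (L ^ l)\<^sup>2 * (A * s ^ CARD('n) * W)\<^sup>2"
      if l: "l \<le> n" for l
    proof -
      define u where "u = pure_deriv i l \<Phi>"
      have u: "test_function (- {0}) u" unfolding u_def by (rule test_function_iter_partial[OF \<Phi>])
      have uS: "supp u \<subseteq> ball \<xi> (R * freq_scale \<alpha> \<xi>)"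
        unfolding u_def using supp_iter_partial S by (rule order_trans)
      have uB: "cmod (u x) \<le> A * (L / s) ^ l" for x
        using D l unfolding deriv_bound_def u_def s_def by blast
      have nl: "n - l \<le> n" by simp
      have gl: "locally_integrable_on (g (n - l)) (- {0})" using wd[OF nl] by (simp add: weak_deriv_def)
      note L2 = locally_L2_mult_test[OF gl u uS uB g2[OF nl \<xi>]]
      have "(\<Sum>j\<in>J. (h l j)\<^sup>2) =
          (\<Sum>j\<in>J. (cmod (LINT x|lebesgue. (g (n - l) x * u x) * cis ((v + lattice_point \<alpha> b \<rho> \<xi> j) \<bullet> x)))\<^sup>2)"
        unfolding h_def u_def y_def by (simp only: mult.assoc)
      also have "\<dots> \<le> (2 * pi / (b * \<rho>) * s) ^ CARD('n) * (LINT x|lebesgue. (cmod (g (n - l) x * u x))\<^sup>2)"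
        unfolding s_def
      proof (rule bessel_lattice)
        show "\<xi> \<noteq> 0" using pos by auto
        show "0 < R" using R by simp
        show "(\<lambda>x. g (n - l) x * u x) \<in> borel_measurable lebesgue"
          using locally_integrable_mult_test[OF gl u] by (rule borel_measurable_integrable)
        show "g (n - l) x * u x = 0" if "x \<notin> ball \<xi> (R * freq_scale \<alpha> \<xi>)" for x
        proof -
          have "u x = 0" using uS that by (intro not_in_supp) auto
          then show ?thesis by simp
        qed
      qed (use b J L2(1) in auto)
      also have "\<dots> \<le> (2 * pi / (b * \<rho>) * s) ^ CARD('n) * ((A * (L / s) ^ l)\<^sup>2 *
          (Cg (n - l) * (W * (1 / s) ^ (n - l))\<^sup>2 * s ^ CARD('n)))"
        using L2(2) mult_left_mono[OF g2_le[OF nl \<xi>], of "(A * (L / s) ^ l)\<^sup>2"] b s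
        unfolding s_def W_def by (intro mult_left_mono) auto
      finally have "s ^ (2 * n) * (\<Sum>j\<in>J. (h l j)\<^sup>2) \<le> s ^ (2 * n) * ((2 * pi / (b * \<rho>) * s) ^ CARD('n) * ((A * (L / s) ^ l)\<^sup>2 *
          (Cg (n - l) * (W * (1 / s) ^ (n - l))\<^sup>2 * s ^ CARD('n))))"
        using s by (intro mult_left_mono) auto
      also have "\<dots> = K * Cg (n - l) * (L ^ l)\<^sup>2 * (A * s ^ CARD('n) * W)\<^sup>2 * (s ^ n * ((1 / s) ^ l * (1 / s) ^ (n - l)))\<^sup>2"
        unfolding K_def power_mult_distrib power_divide
        by (simp add: power2_eq_square power_mult mult_2 power_add)
      also have "s ^ n * ((1 / s) ^ l * (1 / s) ^ (n - l)) = 1"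
        using s l by (simp add: power_one_over flip: power_add)
      finally show ?thesis by simp
    qed
    have "(\<Sum>j\<in>J. ((s * \<bar>y j $ i\<bar>) ^ n * cmod (multiplier_integral m \<Phi> (y j)))\<^sup>2)
        \<le> (\<Sum>j\<in>J. s ^ (2 * n) * (C1\<^sup>2 * ((\<Sum>l\<le>n. (h l j)\<^sup>2) * real (Suc n))))"
    proof (rule sum_mono)
      fix j
      have "(s * \<bar>y j $ i\<bar>) ^ n * cmod (multiplier_integral m \<Phi> (y j)) \<le> s ^ n * (C1 * (\<Sum>l\<le>n. h l j))"
        using mult_left_mono[OF leib[OF \<Phi>, of "y j"], of "s ^ n"] s
        unfolding h_def power_mult_distrib by (simp add: mult.assoc)
      then have "((s * \<bar>y j $ i\<bar>) ^ n * cmod (multiplier_integral m \<Phi> (y j)))\<^sup>2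
          \<le> (s ^ n * (C1 * (\<Sum>l\<le>n. h l j)))\<^sup>2"
        using s by (intro power_mono mult_nonneg_nonneg) auto
      also have "\<dots> = s ^ (2 * n) * (C1\<^sup>2 * (\<Sum>l\<le>n. h l j)\<^sup>2)"
        by (simp add: power_mult_distrib power_mult mult.commute)
      also have "\<dots> \<le> s ^ (2 * n) * (C1\<^sup>2 * ((\<Sum>l\<le>n. (h l j)\<^sup>2) * real (card {..n})))"
        using s by (intro mult_left_mono sum_squared_le_sum_of_squares) auto
      finally show "((s * \<bar>y j $ i\<bar>) ^ n * cmod (multiplier_integral m \<Phi> (y j)))\<^sup>2
          \<le> s ^ (2 * n) * (C1\<^sup>2 * ((\<Sum>l\<le>n. (h l j)\<^sup>2) * real (Suc n)))" by simp
    qed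
    also have "\<dots> = C1\<^sup>2 * (\<Sum>l\<le>n. s ^ (2 * n) * (\<Sum>j\<in>J. (h l j)\<^sup>2)) * real (Suc n)"
      by (simp only: sum_distrib_left sum_distrib_right sum.swap[of _ J] mult_ac)
    also have "\<dots> \<le> C1\<^sup>2 * (\<Sum>l\<le>n. K * Cg (n - l) * (L ^ l)\<^sup>2 * (A * s ^ CARD('n) * W)\<^sup>2) * real (Suc n)"
      by (intro mult_right_mono mult_left_mono sum_mono hsum) auto
    also have "\<dots> = C * (A * s ^ CARD('n) * W)\<^sup>2"
      unfolding C_def by (simp only: sum_distrib_left sum_distrib_right mult_ac)
    finally show ?thesis unfolding s_def W_def y_def .
  qed
  moreover have "0 \<le> C" unfolding C_def
    using K Cg by (intro mult_nonneg_nonneg sum_nonneg) auto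
  ultimately show ?thesis by blast
qed

text \<open>The unweighted square sum and those weighted by the \<open>N\<close>-th power of each
  coordinate add up to a square sum with weight \<open>w j\<close>. The Cauchy-Schwarz inequality
  trades it for the sum of \<open>1 / w j\<close>, bounded uniformly in the shift.\<close>

lemma multiplier_lattice_sum:
  fixes m :: "real^'n \<Rightarrow> complex"
  assumes hm: "hoermander_miyachi \<alpha> \<mu> m" and \<alpha>: "0 < \<alpha>" and R: "1 \<le> R"
    and b: "0 < b" "0 < \<rho>" "b * \<rho> * R < pi"
  shows "\<exists>C\<ge>0. \<forall>\<xi> \<Phi> A v J. 1 \<le> norm \<xi> \<longrightarrow> finite J \<longrightarrow> test_function (- {0}) \<Phi> \<longrightarrow>
    supp \<Phi> \<subseteq> ball \<xi> (R * freq_scale \<alpha> \<xi>) \<longrightarrow> 0 \<le> A \<longrightarrow>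
    deriv_bound (CARD('n) div 2 + 1) A (L / freq_scale \<alpha> \<xi>) \<Phi> \<longrightarrow>
    (\<Sum>j\<in>J. cmod (multiplier_integral m \<Phi> (v + lattice_point \<alpha> b \<rho> \<xi> j)))
      \<le> C * (A * (freq_scale \<alpha> \<xi>) ^ CARD('n) * norm \<xi> powr (- \<mu>))"
proof -
  define N where "N = CARD('n) div 2 + 1"
  have N: "CARD('n) < 2 * N" unfolding N_def by simp
  let ?P = "\<lambda>n i C. 0 \<le> C \<and> (\<forall>\<xi> \<Phi> A v J. 1 \<le> norm \<xi> \<longrightarrow> finite J \<longrightarrow> test_function (- {0}) \<Phi> \<longrightarrow>
    supp \<Phi> \<subseteq> ball \<xi> (R * freq_scale \<alpha> \<xi>) \<longrightarrow> 0 \<le> A \<longrightarrow> deriv_bound n A (L / freq_scale \<alpha> \<xi>) \<Phi> \<longrightarrow>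
    (\<Sum>j\<in>J. ((freq_scale \<alpha> \<xi> * \<bar>(v + lattice_point \<alpha> b \<rho> \<xi> j) $ i\<bar>) ^ n *
        cmod (multiplier_integral m \<Phi> (v + lattice_point \<alpha> b \<rho> \<xi> j)))\<^sup>2)
      \<le> C * (A * (freq_scale \<alpha> \<xi>) ^ CARD('n) * norm \<xi> powr (- \<mu>))\<^sup>2)"
  have ex: "\<exists>C. ?P n i C" if "n \<le> N" for n i
    using weighted_bessel[OF hm \<alpha> R b, where n = n and i = i and L = L] that unfolding N_def by blast
  \<comment> \<open>With exponent 0 the weight is 1 for every coordinate, so
    \<open>undefined\<close> serves as the index.\<close>
  obtain C0 where C0: "?P 0 undefined C0" using ex[of 0 undefined] by auto
  have "\<forall>i. \<exists>C. ?P N i C" using ex[of N] by blast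
  then obtain C1 where C1: "\<And>i. ?P N i (C1 i)" by (auto dest!: choice)
  obtain C2 where C2: "0 \<le> C2" and lat: "\<And>(u::real^'n) (J :: (int^'n) set). finite J \<Longrightarrow>
    (\<Sum>j\<in>J. 1 / (1 + (\<Sum>i\<in>UNIV. \<bar>u $ i - b * \<rho> * real_of_int (j $ i)\<bar> ^ (2 * N)))) \<le> C2"
    using lattice_weight_sum_bounded[OF mult_pos_pos[OF b(1,2)] N] by blast
  define C3 where "C3 = C0 + (\<Sum>i\<in>UNIV. C1 i)"
  have C3: "0 \<le> C3" unfolding C3_def using C0 C1 by (intro add_nonneg_nonneg sum_nonneg) auto
  have "(\<Sum>j\<in>J. cmod (multiplier_integral m \<Phi> (v + lattice_point \<alpha> b \<rho> \<xi> j)))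
      \<le> sqrt (C2 * C3) * (A * (freq_scale \<alpha> \<xi>) ^ CARD('n) * norm \<xi> powr (- \<mu>))"
    if \<xi>: "1 \<le> norm \<xi>" and J: "finite J" and \<Phi>: "test_function (- {0}) \<Phi>"
      and S: "supp \<Phi> \<subseteq> ball \<xi> (R * freq_scale \<alpha> \<xi>)" and A: "0 \<le> A"
      and D: "deriv_bound N A (L / freq_scale \<alpha> \<xi>) \<Phi>" for \<xi> \<Phi> A v J
  proof -
    define s where "s = freq_scale \<alpha> \<xi>"
    have pos: "0 < norm \<xi>" using \<xi> by linarith
    have s: "0 < s" unfolding s_def using pos by simp
    define y where "y = (\<lambda>j. v + lattice_point \<alpha> b \<rho> \<xi> j)"
    define I where "I = (\<lambda>j. cmod (multiplier_integral m \<Phi> (y j)))"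
    define Q where "Q = A * s ^ CARD('n) * norm \<xi> powr (- \<mu>)"
    have Q: "0 \<le> Q" unfolding Q_def using A s by simp
    have D0: "deriv_bound 0 A (L / freq_scale \<alpha> \<xi>) \<Phi>" using D by (rule deriv_bound_mono_order) simp
    have b0: "(\<Sum>j\<in>J. (I j)\<^sup>2) \<le> C0 * Q\<^sup>2"
      using conjunct2[OF C0, rule_format, OF \<xi> J \<Phi> S A D0, of v] unfolding I_def Q_def y_def s_def by simp
    have b1: "(\<Sum>j\<in>J. ((s * \<bar>y j $ i\<bar>) ^ N * I j)\<^sup>2) \<le> C1 i * Q\<^sup>2" for i
      using conjunct2[OF C1, rule_format, OF \<xi> J \<Phi> S A D, of v] unfolding I_def Q_def y_def s_def .
    define w where "w = (\<lambda>j. 1 + (\<Sum>i\<in>UNIV. (s * \<bar>y j $ i\<bar>) ^ (2 * N)))"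
    have w: "0 < w j" for j unfolding w_def using s by (intro add_pos_nonneg sum_nonneg) auto
    \<comment> \<open>Multiplication by \<open>s\<close> cancels the factor
      \<open>norm \<xi> powr (\<alpha> - 1)\<close> in the lattice, whose spacing becomes
      \<open>b * \<rho>\<close>, the same for all centers; \<open>v\<close> turns into an arbitrary
      shift.\<close>
    have sy: "s * \<bar>y j $ i\<bar> = \<bar>(- s *\<^sub>R v) $ i - b * \<rho> * real_of_int (j $ i)\<bar>" for i j
    proof -
      have "s * norm \<xi> powr (\<alpha> - 1) = 1" unfolding s_def using pos by (simp flip: powr_add)
      then have "s * (b * \<rho> * norm \<xi> powr (\<alpha> - 1)) = b * \<rho>" by (simp add: mult_ac)
      then have "s * (y j $ i) = s * v $ i + b * \<rho> * real_of_int (j $ i)"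
        unfolding y_def lattice_point_def
        by (simp only: vector_add_component vector_scaleR_component distrib_left vec_lambda_beta real_scaleR_def mult.assoc[symmetric])
      moreover have "s * \<bar>y j $ i\<bar> = \<bar>s * (y j $ i)\<bar>" using s by (simp add: abs_mult)
      ultimately show ?thesis by (simp add: abs_minus_commute[of "- _"])
    qed
    have lw: "(\<Sum>j\<in>J. 1 / w j) \<le> C2" unfolding w_def sy by (rule lat[OF J])
    have "(\<Sum>j\<in>J. w j * (I j)\<^sup>2) = (\<Sum>j\<in>J. (I j)\<^sup>2) + (\<Sum>i\<in>UNIV. \<Sum>j\<in>J. ((s * \<bar>y j $ i\<bar>) ^ N * I j)\<^sup>2)"
      unfolding w_def
      by (simp add: distrib_right sum.distrib sum_distrib_right sum.swap[of _ J] power_mult_distrib mult.commute[of 2] flip: power_mult)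
    also have "\<dots> \<le> C0 * Q\<^sup>2 + (\<Sum>i\<in>UNIV. C1 i * Q\<^sup>2)" by (intro add_mono sum_mono b0 b1)
    also have "\<dots> = C3 * Q\<^sup>2" by (simp add: C3_def distrib_right sum_distrib_right)
    finally have ww: "(\<Sum>j\<in>J. w j * (I j)\<^sup>2) \<le> C3 * Q\<^sup>2" .
    have "(\<Sum>j\<in>J. I j)\<^sup>2 = (\<Sum>j\<in>J. sqrt (1 / w j) * (sqrt (w j) * I j))\<^sup>2"
      using w by (simp add: real_sqrt_divide less_imp_neq[symmetric])
    also have "\<dots> \<le> (\<Sum>j\<in>J. (sqrt (1 / w j))\<^sup>2) * (\<Sum>j\<in>J. (sqrt (w j) * I j)\<^sup>2)"
      by (rule Cauchy_Schwarz_ineq_sum)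
    also have "\<dots> = (\<Sum>j\<in>J. 1 / w j) * (\<Sum>j\<in>J. w j * (I j)\<^sup>2)"
      using w by (simp add: power_mult_distrib less_imp_le)
    also have "\<dots> \<le> C2 * (C3 * Q\<^sup>2)"
      using w by (intro mult_mono lw ww C2 sum_nonneg mult_nonneg_nonneg) (auto simp: less_imp_le)
    finally have "(\<Sum>j\<in>J. I j)\<^sup>2 \<le> C2 * C3 * Q\<^sup>2" by (simp add: mult.assoc)
    then have "sqrt ((\<Sum>j\<in>J. I j)\<^sup>2) \<le> sqrt (C2 * C3 * Q\<^sup>2)" by (rule real_sqrt_le_mono)
    then have "(\<Sum>j\<in>J. I j) \<le> sqrt (C2 * C3) * Q"
      using Q by (simp add: real_sqrt_mult I_def sum_nonneg)
    then show ?thesis unfolding I_def Q_def y_def s_def .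
  qed
  then show ?thesis using C2 C3 unfolding N_def by (intro exI[of _ "sqrt (C2 * C3)"]) auto
qed

section \<open>Fourier transforms of packets\<close>

text \<open>Needed for Fubini's theorem on two copies of the completed measure. Completion does not
  change the measure of Borel sets, so a countable cover for \<open>lborel\<close> serves
  again.\<close>

lemma sigma_finite_lebesgue: "sigma_finite_measure (lebesgue :: 'a::euclidean_space measure)"
proof
  obtain A :: "'a set set" where A: "countable A" "A \<subseteq> sets lborel" "\<Union>A = space lborel"
      "\<forall>a\<in>A. emeasure lborel a \<noteq> \<infinity>"
    using lborel.sigma_finite_countable by (elim exE conjE) (rule that)
  have "A \<subseteq> sets lebesgue" using A(2) by (auto intro: sets_completionI_sets)
  moreover have "emeasure lebesgue a \<noteq> \<infinity>" if "a \<in> A" for a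
    using subsetD[OF A(2) that] bspec[OF A(4) that] by (simp add: emeasure_completion)
  moreover have "\<Union>A = space lebesgue" using A(3) by simp
  ultimately show "\<exists>A :: 'a set set. countable A \<and> A \<subseteq> sets lebesgue \<and> \<Union>A = space lebesgue \<and>
      (\<forall>a\<in>A. emeasure lebesgue a \<noteq> \<infinity>)"
    using A(1) by blast
qed

lemma lborel_integral_affine:
  fixes f :: "'a::euclidean_space \<Rightarrow> 'b::{banach, second_countable_topology}"
  assumes c: "c \<noteq> 0" and f: "f \<in> borel_measurable borel"
  shows "(LINT x|lborel. f x) = \<bar>c\<bar> ^ DIM('a) *\<^sub>R (LINT x|lborel. f (t + c *\<^sub>R x))"
  by (subst lborel_affine[OF c, of t])
     (simp add: f integral_density integral_distr)

lemma lborel_integrable_affine: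
  fixes f :: "'a::euclidean_space \<Rightarrow> 'b::{banach, second_countable_topology}"
  assumes c: "c \<noteq> 0" and f: "integrable lborel f"
  shows "integrable lborel (\<lambda>x. f (t + c *\<^sub>R x))"
proof -
  have m: "f \<in> borel_measurable borel" using f by auto
  have "integrable (density (distr lborel borel (\<lambda>x. t + c *\<^sub>R x)) (\<lambda>_. \<bar>c\<bar> ^ DIM('a))) f"
    using f lborel_affine[OF c, of t] by simp
  then have "integrable lborel (\<lambda>x. \<bar>c\<bar> ^ DIM('a) *\<^sub>R f (t + c *\<^sub>R x))"
    using m by (simp add: integrable_density integrable_distr_eq)
  from integrable_scaleR_right[OF this, of "1 / \<bar>c\<bar> ^ DIM('a)"] show ?thesis using c by simp
qed

lemma borel_measurable_cis_inner: "(\<lambda>t::real^'n. cis (t \<bullet> \<eta>)) \<in> borel_measurable borel"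
  by (intro borel_measurable_continuous_onI continuous_intros)

context
  fixes \<phi> :: "real^'n \<Rightarrow> real"
  assumes \<phi>: "integrable lborel \<phi>"
begin

lemma packet_eq:
  "packet \<alpha> \<phi> x \<xi> t = complex_of_real (norm \<xi> powr (real CARD('n) / 2 * (1 - \<alpha>))) *
    (complex_of_real (\<phi> (- (freq_scale \<alpha> \<xi>) *\<^sub>R x + freq_scale \<alpha> \<xi> *\<^sub>R t)) * cis (t \<bullet> \<xi>))"
  by (simp add: packet_def algebra_simps)

lemma integrable_packet:
  assumes "\<xi> \<noteq> 0"
  shows "integrable lborel (packet \<alpha> \<phi> x \<xi>)"
proof -
  have "integrable lborel (\<lambda>t. \<phi> (- (freq_scale \<alpha> \<xi>) *\<^sub>R x + freq_scale \<alpha> \<xi> *\<^sub>R t))"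
    using assms \<phi> by (intro lborel_integrable_affine) auto
  then have i: "integrable lborel (\<lambda>t. complex_of_real (\<phi> (- (freq_scale \<alpha> \<xi>) *\<^sub>R x + freq_scale \<alpha> \<xi> *\<^sub>R t)))"
    by (rule integrable_of_real)
  have "integrable lborel (\<lambda>t. complex_of_real (\<phi> (- (freq_scale \<alpha> \<xi>) *\<^sub>R x + freq_scale \<alpha> \<xi> *\<^sub>R t)) * cis (t \<bullet> \<xi>))"
    by (rule Bochner_Integration.integrable_bound[OF i])
       (use i borel_measurable_cis_inner[of \<xi>] in \<open>auto simp: norm_mult\<close>)
  then show ?thesis unfolding packet_eq[abs_def] by (rule integrable_mult_right)
qed

text \<open>The substitution \<open>t = x + (1 / s) u\<close> removes translation and dilation. Its
  Jacobian \<open>s ^ (- d)\<close> turns the normalizing factor, \<open>s\<close> to the power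
  \<open>d / 2\<close>, into its reciprocal.\<close>

lemma fourier_packet:
  assumes "\<xi> \<noteq> 0"
  shows "fourier (packet \<alpha> \<phi> x \<xi>) \<eta> =
    complex_of_real (norm \<xi> powr (- (real CARD('n) / 2 * (1 - \<alpha>)))) * cis (- (x \<bullet> (\<eta> - \<xi>))) *
    fourier (\<lambda>t. complex_of_real (\<phi> t)) ((1 / freq_scale \<alpha> \<xi>) *\<^sub>R (\<eta> - \<xi>))"
proof -
  define s where "s = freq_scale \<alpha> \<xi>"
  have s: "0 < s" using assms by (simp add: s_def)
  have \<phi>m: "\<phi> \<in> borel_measurable borel" using \<phi> by auto
  have cism: "(\<lambda>t::real^'n. cis (- (t \<bullet> \<eta>))) \<in> borel_measurable borel" for \<eta>
    using borel_measurable_cis_inner[of "- \<eta>"] by simp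
  have pm: "(\<lambda>t. packet \<alpha> \<phi> x \<xi> t * cis (- (t \<bullet> \<eta>))) \<in> borel_measurable borel"
    using integrable_packet[OF assms, of \<alpha> x] cism[of \<eta>] by auto
  have "fourier (packet \<alpha> \<phi> x \<xi>) \<eta> = (LINT t|lborel. packet \<alpha> \<phi> x \<xi> t * cis (- (t \<bullet> \<eta>)))"
    unfolding fourier_def using pm by (simp add: integral_completion)
  also have "\<dots> = \<bar>1 / s\<bar> ^ CARD('n) *\<^sub>R
      (LINT u|lborel. packet \<alpha> \<phi> x \<xi> (x + (1 / s) *\<^sub>R u) * cis (- ((x + (1 / s) *\<^sub>R u) \<bullet> \<eta>)))"
    using lborel_integral_affine[OF _ pm, of "1 / s" x] s by simp
  also have "(\<lambda>u. packet \<alpha> \<phi> x \<xi> (x + (1 / s) *\<^sub>R u) * cis (- ((x + (1 / s) *\<^sub>R u) \<bullet> \<eta>))) =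
      (\<lambda>u. complex_of_real (norm \<xi> powr (real CARD('n) / 2 * (1 - \<alpha>))) * cis (- (x \<bullet> (\<eta> - \<xi>))) *
        (complex_of_real (\<phi> u) * cis (- (u \<bullet> ((1 / s) *\<^sub>R (\<eta> - \<xi>))))))"
  proof
    fix u
    have "cis ((x + (1 / s) *\<^sub>R u) \<bullet> \<xi>) * cis (- ((x + (1 / s) *\<^sub>R u) \<bullet> \<eta>)) =
        cis (- (x \<bullet> (\<eta> - \<xi>))) * cis (- (u \<bullet> ((1 / s) *\<^sub>R (\<eta> - \<xi>))))"
      unfolding cis_mult by (rule arg_cong[where f = cis]) (simp add: inner_simps algebra_simps)
    then show "packet \<alpha> \<phi> x \<xi> (x + (1 / s) *\<^sub>R u) * cis (- ((x + (1 / s) *\<^sub>R u) \<bullet> \<eta>)) =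
      complex_of_real (norm \<xi> powr (real CARD('n) / 2 * (1 - \<alpha>))) * cis (- (x \<bullet> (\<eta> - \<xi>))) *
        (complex_of_real (\<phi> u) * cis (- (u \<bullet> ((1 / s) *\<^sub>R (\<eta> - \<xi>)))))"
      unfolding packet_def s_def[symmetric] using s by (simp add: mult_ac)
  qed
  also have "(LINT u|lborel. complex_of_real (norm \<xi> powr (real CARD('n) / 2 * (1 - \<alpha>))) * cis (- (x \<bullet> (\<eta> - \<xi>))) *
        (complex_of_real (\<phi> u) * cis (- (u \<bullet> ((1 / s) *\<^sub>R (\<eta> - \<xi>)))))) =
     complex_of_real (norm \<xi> powr (real CARD('n) / 2 * (1 - \<alpha>))) * cis (- (x \<bullet> (\<eta> - \<xi>))) *
      fourier (\<lambda>t. complex_of_real (\<phi> t)) ((1 / s) *\<^sub>R (\<eta> - \<xi>))"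
    unfolding fourier_def using \<phi>m cism[of "(1 / s) *\<^sub>R (\<eta> - \<xi>)"] by (simp add: integral_completion)
  also have "\<bar>1 / s\<bar> ^ CARD('n) *\<^sub>R (complex_of_real (norm \<xi> powr (real CARD('n) / 2 * (1 - \<alpha>))) * cis (- (x \<bullet> (\<eta> - \<xi>))) *
      fourier (\<lambda>t. complex_of_real (\<phi> t)) ((1 / s) *\<^sub>R (\<eta> - \<xi>))) =
    complex_of_real (\<bar>1 / s\<bar> ^ CARD('n) * norm \<xi> powr (real CARD('n) / 2 * (1 - \<alpha>))) * cis (- (x \<bullet> (\<eta> - \<xi>))) *
      fourier (\<lambda>t. complex_of_real (\<phi> t)) ((1 / s) *\<^sub>R (\<eta> - \<xi>))"
    by (simp add: scaleR_conv_of_real mult.assoc)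
  also have "\<bar>1 / s\<bar> ^ CARD('n) * norm \<xi> powr (real CARD('n) / 2 * (1 - \<alpha>)) =
      norm \<xi> powr (- (real CARD('n) / 2 * (1 - \<alpha>)))"
  proof -
    have "\<bar>1 / s\<bar> ^ CARD('n) = norm \<xi> powr (- (real CARD('n) * (1 - \<alpha>)))"
      using s assms by (simp add: s_def powr_minus powr_power divide_inverse power_inverse mult.commute)
    then have "\<bar>1 / s\<bar> ^ CARD('n) * norm \<xi> powr (real CARD('n) / 2 * (1 - \<alpha>)) =
        norm \<xi> powr (- (real CARD('n) * (1 - \<alpha>)) + real CARD('n) / 2 * (1 - \<alpha>))"
      by (simp only: powr_add)
    also have "- (real CARD('n) * (1 - \<alpha>)) + real CARD('n) / 2 * (1 - \<alpha>) = - (real CARD('n) / 2 * (1 - \<alpha>))"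
      by (simp add: field_simps)
    finally show ?thesis .
  qed
  finally show ?thesis by (simp add: s_def)
qed

end

text \<open>An instance of Parseval's identity for integrable functions: the kernel is unimodular,
  so the double integrand is dominated by the product of the two moduli and the integrals may be
  exchanged.\<close>

lemma l2_inner_inv_fourier:
  fixes G g :: "real^'n \<Rightarrow> complex"
  assumes G: "integrable lebesgue G" and g: "integrable lebesgue g"
  shows "l2_inner (inv_fourier G) g =
    (LINT \<eta>|lebesgue. G \<eta> * cnj (fourier g \<eta>)) / complex_of_real ((2 * pi) ^ CARD('n))"
proof -
  interpret sigma_finite_measure "lebesgue :: (real^'n) measure" by (rule sigma_finite_lebesgue)
  interpret P: pair_sigma_finite "lebesgue :: (real^'n) measure" "lebesgue :: (real^'n) measure" ..
  define f where "f = (\<lambda>t \<eta> :: real^'n. cnj (g t) * (G \<eta> * cis (t \<bullet> \<eta>)))"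
  have id: "(\<lambda>x::real^'n. x) \<in> borel_measurable lebesgue" by (simp add: measurable_completion)
  have "(\<lambda>p::(real^'n) \<times> (real^'n). fst p \<bullet> snd p) \<in> borel_measurable (lebesgue \<Otimes>\<^sub>M lebesgue)"
    by (intro borel_measurable_inner measurable_compose[OF measurable_fst id] measurable_compose[OF measurable_snd id])
  moreover have "cis \<in> borel_measurable borel"
    by (intro borel_measurable_continuous_onI continuous_intros)
  ultimately have cism: "(\<lambda>p::(real^'n) \<times> (real^'n). cis (fst p \<bullet> snd p)) \<in> borel_measurable (lebesgue \<Otimes>\<^sub>M lebesgue)"
    by (rule measurable_compose)
  have cg: "integrable lebesgue (\<lambda>t. cnj (g t))" using g by simp
  have meas: "case_prod f \<in> borel_measurable (lebesgue \<Otimes>\<^sub>M lebesgue)"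
  proof -
    have "(\<lambda>p. cnj (g (fst p)) * (G (snd p) * cis (fst p \<bullet> snd p))) \<in> borel_measurable (lebesgue \<Otimes>\<^sub>M lebesgue)"
      by (intro borel_measurable_times cism measurable_compose[OF measurable_fst borel_measurable_integrable[OF cg]]
          measurable_compose[OF measurable_snd borel_measurable_integrable[OF G]])
    then show ?thesis by (simp add: f_def case_prod_beta')
  qed
  have Gc: "integrable lebesgue (\<lambda>\<eta>. G \<eta> * cis (t \<bullet> \<eta>))" for t
  proof (rule Bochner_Integration.integrable_bound[OF G])
    have "(\<lambda>\<eta>::real^'n. cis (t \<bullet> \<eta>)) \<in> borel_measurable lebesgue"
      using borel_measurable_cis_inner[of t] by (simp add: measurable_completion inner_commute)
    then show "(\<lambda>\<eta>. G \<eta> * cis (t \<bullet> \<eta>)) \<in> borel_measurable lebesgue" using G by auto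
  qed (simp add: norm_mult)
  have int: "integrable (lebesgue \<Otimes>\<^sub>M lebesgue) (case_prod f)"
  proof (rule P.Fubini_integrable[OF meas])
    have "(LINT \<eta>|lebesgue. norm (f t \<eta>)) = norm (g t) * (LINT \<eta>|lebesgue. norm (G \<eta>))" for t
      by (simp add: f_def norm_mult)
    then show "integrable lebesgue (\<lambda>t. LINT \<eta>|lebesgue. norm (case_prod f (t, \<eta>)))"
      using g by simp
    show "AE t in lebesgue. integrable lebesgue (\<lambda>\<eta>. case_prod f (t, \<eta>))"
      using Gc by (simp add: f_def)
  qed
  have "l2_inner (inv_fourier G) g = (LINT t|lebesgue. (LINT \<eta>|lebesgue. f t \<eta>)) / complex_of_real ((2 * pi) ^ CARD('n))"
    unfolding l2_inner_def inv_fourier_def f_def by (simp add: mult.commute)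
  also have "(LINT t|lebesgue. (LINT \<eta>|lebesgue. f t \<eta>)) = (LINT \<eta>|lebesgue. (LINT t|lebesgue. f t \<eta>))"
    by (rule P.Fubini_integral[OF int, symmetric])
  also have "(\<lambda>\<eta>. LINT t|lebesgue. f t \<eta>) = (\<lambda>\<eta>. G \<eta> * cnj (fourier g \<eta>))"
  proof
    fix \<eta>
    have "(LINT t|lebesgue. f t \<eta>) = (LINT t|lebesgue. G \<eta> * cnj (g t * cis (- (t \<bullet> \<eta>))))"
      unfolding f_def by (simp add: cis_cnj mult_ac)
    also have "\<dots> = G \<eta> * cnj (fourier g \<eta>)"
      unfolding fourier_def by (simp only: integral_mult_right_zero Bochner_Integration.integral_cnj)
    finally show "(LINT t|lebesgue. f t \<eta>) = G \<eta> * cnj (fourier g \<eta>)" .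
  qed
  finally show ?thesis .
qed

section \<open>Geometry of subdyadic centers\<close>

lemma retained_subset: "retained \<alpha> a \<rho> c N \<subseteq> range c"
  by (induction N) auto

lemma retained_mono: "M \<le> N \<Longrightarrow> retained \<alpha> a \<rho> c M \<subseteq> retained \<alpha> a \<rho> c N"
  by (induction rule: dec_induct) auto

lemma retained_disjoint:
  "x \<in> retained \<alpha> a \<rho> c N \<Longrightarrow> y \<in> retained \<alpha> a \<rho> c N \<Longrightarrow> x \<noteq> y \<Longrightarrow>
    exclusion_ball \<alpha> a \<rho> x \<inter> exclusion_ball \<alpha> a \<rho> y = {}"
proof (induction N arbitrary: x y)
  case (Suc N)
  then show ?case by (auto split: if_splits)
qed simp

lemma subdyadic_centers_norm_ge_1:
  assumes "subdyadic_centers \<alpha> a \<rho> \<xi>" shows "1 \<le> norm (\<xi> k)"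
proof -
  obtain C c where C: "candidate_sets \<alpha> \<rho> C" and c: "candidate_order C c"
    and \<xi>: "bij_betw \<xi> UNIV (\<Union>N. retained \<alpha> a \<rho> c N)"
    using assms unfolding subdyadic_centers_def by blast
  have "\<xi> k \<in> range c" using bij_betwE[OF \<xi>] retained_subset by fastforce
  then obtain n where "\<xi> k \<in> C n" using c unfolding candidate_order_def bij_betw_def by blast
  moreover obtain P p where "\<forall>Q\<in>P. Q \<inter> annulus n \<noteq> {} \<longrightarrow> p Q \<in> Q \<inter> annulus n"
    "C n = p ` {Q \<in> P. Q \<inter> annulus n \<noteq> {}}"
    using C[unfolded candidate_sets_def, THEN spec, of n] by (elim exE conjE) (rule that)
  ultimately have "\<xi> k \<in> annulus n" by auto
  then show ?thesis using one_le_power[of "2::real" n] unfolding annulus_def by (simp only: mem_Collect_eq) linarith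
qed

lemma subdyadic_centers_disjoint:
  assumes "subdyadic_centers \<alpha> a \<rho> \<xi>" "k \<noteq> l"
  shows "exclusion_ball \<alpha> a \<rho> (\<xi> k) \<inter> exclusion_ball \<alpha> a \<rho> (\<xi> l) = {}"
proof -
  obtain c where \<xi>: "bij_betw \<xi> UNIV (\<Union>N. retained \<alpha> a \<rho> c N)"
    using assms unfolding subdyadic_centers_def by blast
  obtain M N where "\<xi> k \<in> retained \<alpha> a \<rho> c M" "\<xi> l \<in> retained \<alpha> a \<rho> c N"
    using bij_betwE[OF \<xi>] by blast
  \<comment> \<open>The two centers may be selected at different stages; retained points are never
    dropped, so both are present at the later one.\<close>
  then have "\<xi> k \<in> retained \<alpha> a \<rho> c (max M N)" "\<xi> l \<in> retained \<alpha> a \<rho> c (max M N)"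
    using retained_mono by (meson max.cobounded1 max.cobounded2 subsetD)+
  moreover have "\<xi> k \<noteq> \<xi> l" using \<xi> assms(2) by (auto simp: bij_betw_def inj_on_def)
  ultimately show ?thesis by (rule retained_disjoint)
qed

text \<open>If \<open>norm x powr \<alpha>\<close> is at least \<open>2 * R\<close>, the radius is
  at most half of \<open>norm x\<close>, and \<open>y\<close> stays away from the origin. Otherwise
  \<open>norm x\<close> is at most \<open>(2 * R) powr (1 / \<alpha>)\<close>; the ball may then
  contain the origin, which is why \<open>max 1 (norm y)\<close> appears.\<close>

lemma subdyadic_ball_norm_bounds:
  fixes \<alpha> R :: real
  assumes \<alpha>: "0 < \<alpha>" and R: "0 < R"
  shows "\<exists>K\<ge>1. \<forall>x y :: 'a::real_normed_vector. 1 \<le> norm x \<longrightarrow> norm (y - x) \<le> R * freq_scale \<alpha> x \<longrightarrow>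
    norm y \<le> K * norm x \<and> norm x \<le> K * max 1 (norm y)"
proof -
  define K where "K = max (1 + R) (max 2 ((2 * R) powr (1 / \<alpha>)))"
  have "norm y \<le> K * norm x \<and> norm x \<le> K * max 1 (norm y)"
    if x: "1 \<le> norm x" and yx: "norm (y - x) \<le> R * freq_scale \<alpha> x" for x y :: 'a
  proof
    have "freq_scale \<alpha> x \<le> norm x powr 1" using x \<alpha> by (intro powr_mono) auto
    then have "R * freq_scale \<alpha> x \<le> R * norm x" using R x by (intro mult_left_mono) auto
    then have "norm y \<le> (1 + R) * norm x"
      using norm_triangle_sub[of y x] yx by (simp add: algebra_simps)
    also have "\<dots> \<le> K * norm x" by (intro mult_right_mono) (auto simp: K_def)
    finally show "norm y \<le> K * norm x" .
    show "norm x \<le> K * max 1 (norm y)"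
    proof (cases "2 * R \<le> norm x powr \<alpha>")
      case True
      have "2 * (R * freq_scale \<alpha> x) \<le> norm x powr \<alpha> * freq_scale \<alpha> x"
        using mult_right_mono[OF True, of "freq_scale \<alpha> x"] by simp
      also have "\<dots> = norm x" using x by (simp flip: powr_add)
      finally have "norm x \<le> 2 * norm y"
        using norm_triangle_sub[of x y] yx by (simp add: norm_minus_commute)
      also have "\<dots> \<le> K * max 1 (norm y)" by (intro mult_mono) (auto simp: K_def)
      finally show ?thesis .
    next
      case False
      then have "(norm x powr \<alpha>) powr (1 / \<alpha>) \<le> (2 * R) powr (1 / \<alpha>)"
        using \<alpha> by (intro powr_mono2) auto
      then have "norm x \<le> K * 1" using \<alpha> x by (simp add: powr_powr K_def)
      also have "\<dots> \<le> K * max 1 (norm y)" using R by (intro mult_left_mono) (auto simp: K_def)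
      finally show ?thesis .
    qed
  qed
  moreover have "1 \<le> K" by (auto simp: K_def)
  ultimately show ?thesis by blast
qed

text \<open>Both norms are compared with \<open>max 1 (norm z)\<close> for the common point
  \<open>z\<close>, which gives the square of the previous constant.\<close>

lemma interacting_norm_le:
  fixes \<alpha> R :: real
  assumes \<alpha>: "0 < \<alpha>" and R: "0 < R"
  shows "\<exists>K\<ge>1. \<forall>x y z :: 'a::real_normed_vector. 1 \<le> norm x \<longrightarrow> 1 \<le> norm y \<longrightarrow>
    norm (z - x) \<le> R * freq_scale \<alpha> x \<longrightarrow> norm (z - y) \<le> R * freq_scale \<alpha> y \<longrightarrow>
    norm y \<le> K * norm x"
proof -
  obtain K where K: "1 \<le> K" and le: "\<And>x y :: 'a. 1 \<le> norm x \<Longrightarrow> norm (y - x) \<le> R * freq_scale \<alpha> x \<Longrightarrow>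
    norm y \<le> K * norm x \<and> norm x \<le> K * max 1 (norm y)"
    using subdyadic_ball_norm_bounds[OF assms, where 'a='a] by blast
  have "norm y \<le> K * K * norm x"
    if "1 \<le> norm x" "1 \<le> norm y" "norm (z - x) \<le> R * freq_scale \<alpha> x"
      "norm (z - y) \<le> R * freq_scale \<alpha> y" for x y z :: 'a
  proof -
    have "norm y \<le> K * max 1 (norm z)" using le[OF that(2,4)] by simp
    also have "max 1 (norm z) \<le> K * norm x"
      using le[OF that(1,3)] mult_mono[OF K that(1)] K by simp
    finally show ?thesis using K by (simp add: mult.assoc)
  qed
  moreover have "1 \<le> K * K" using mult_mono[OF K K] K by simp
  ultimately show ?thesis by blast
qed

lemma powr_comparable:
  fixes x y K s :: real
  assumes "0 < x" "0 < y" "y \<le> K * x" "x \<le> K * y" "1 \<le> K"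
  shows "y powr s \<le> K powr \<bar>s\<bar> * x powr s"
proof (cases "0 \<le> s")
  case True
  have "y powr s \<le> (K * x) powr s" using True assms by (intro powr_mono2) auto
  then show ?thesis using True assms by (simp add: powr_mult)
next
  case False
  have "x / K \<le> y" using assms by (simp add: field_simps)
  then have "y powr s \<le> (x / K) powr s" using False assms by (intro powr_mono2') auto
  also have "\<dots> = K powr (- s) * x powr s" using assms by (simp add: powr_divide powr_minus_divide)
  finally show ?thesis using False by simp
qed

lemma packing_bound:
  fixes x :: "'k \<Rightarrow> 'a::euclidean_space"
  assumes r: "0 < r" and D: "0 \<le> D"
    and in_ball: "\<And>k. k \<in> S \<Longrightarrow> norm (x k - z) \<le> D"
    and disj: "\<And>k l. k \<in> S \<Longrightarrow> l \<in> S \<Longrightarrow> k \<noteq> l \<Longrightarrow> ball (x k) r \<inter> ball (x l) r = {}"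
    and M: "((D + r) / r) ^ DIM('a) \<le> real M"
  shows "finite S \<and> card S \<le> M"
proof (rule finite_if_finite_subsets_card_bdd)
  fix T assume T: "T \<subseteq> S" "finite T"
  define V where "V = unit_ball_vol (real DIM('a))"
  have V: "0 < V" by (simp add: V_def)
  have "real (card T) * (V * r ^ DIM('a)) = (\<Sum>k\<in>T. measure lebesgue (ball (x k) r))"
    using r by (simp add: content_ball V_def)
  also have "\<dots> = measure lebesgue (\<Union>k\<in>T. ball (x k) r)"
  proof (rule measure_finite_Union[symmetric])
    show "disjoint_family_on (\<lambda>k. ball (x k) r) T"
      using T disj unfolding disjoint_family_on_def by blast
    show "emeasure lebesgue (ball (x k) r) \<noteq> \<infinity>" for k
      using fmeasurableD2[OF lmeasurable_ball] by simp
  qed (use T in auto)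
  also have "\<dots> \<le> measure lebesgue (ball z (D + r))"
  proof (rule measure_mono_fmeasurable)
    show "(\<Union>k\<in>T. ball (x k) r) \<subseteq> ball z (D + r)"
    proof clarify
      fix k y assume k: "k \<in> T" and y: "y \<in> ball (x k) r"
      have "dist z y \<le> dist z (x k) + dist (x k) y" by (rule dist_triangle)
      moreover have "dist z (x k) \<le> D" using in_ball[of k] k T by (auto simp: dist_norm norm_minus_commute)
      ultimately show "y \<in> ball z (D + r)" using y by simp
    qed
  qed (use T in auto)
  also have "\<dots> = V * (D + r) ^ DIM('a)" using r D by (simp add: content_ball V_def)
  finally have "real (card T) \<le> ((D + r) / r) ^ DIM('a)"
    using V r by (simp add: field_simps)
  then show "card T \<le> M" using M by linarith
qed

lemma finitely_many_neighbours:
  fixes \<xi> :: "nat \<Rightarrow> real^'n"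
  assumes \<alpha>: "0 < \<alpha>" and R: "0 < R" and a: "0 < a" and \<rho>: "0 < \<rho>"
    and \<xi>: "subdyadic_centers \<alpha> a \<rho> \<xi>"
  shows "\<exists>M::nat. \<forall>k. finite {k'. interacting \<alpha> R (\<xi> k) (\<xi> k')} \<and>
    card {k'. interacting \<alpha> R (\<xi> k) (\<xi> k')} \<le> M"
proof -
  obtain K where K: "1 \<le> K" and le: "\<And>x y z :: real^'n. 1 \<le> norm x \<Longrightarrow> 1 \<le> norm y \<Longrightarrow>
    norm (z - x) \<le> R * freq_scale \<alpha> x \<Longrightarrow> norm (z - y) \<le> R * freq_scale \<alpha> y \<Longrightarrow>
    norm y \<le> K * norm x"
    using interacting_norm_le[OF \<alpha> R, where 'a="real^'n"] by blast
  note ge1 = subdyadic_centers_norm_ge_1[OF \<xi>]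
  define sc where "sc = (\<lambda>k. freq_scale \<alpha> (\<xi> k))"
  define L where "L = K powr \<bar>1 - \<alpha>\<bar>"
  have sc: "0 < sc k" for k using ge1[of k] by (auto simp: sc_def)
  have L: "0 < L" using K by (simp add: L_def)
  \<comment> \<open>Interacting centers have scales within a factor \<open>L\<close> of each other,
    so balls of the common radius \<open>a * \<rho> / L * sc k\<close> lie inside all the exclusion
    balls involved. \<open>q\<close> is the ratio of outer to inner radius; \<open>sc k\<close>
    cancels, so the count is uniform in \<open>k\<close>.\<close>
  define q where "q = (R + R * L + a * \<rho> / L) / (a * \<rho> / L)"
  define M where "M = nat \<lceil>q ^ CARD('n)\<rceil>"
  have "finite {k'. \<exists>\<eta>. norm (\<eta> - \<xi> k) \<le> R * sc k \<and> norm (\<eta> - \<xi> k') \<le> R * sc k'} \<and>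
      card {k'. \<exists>\<eta>. norm (\<eta> - \<xi> k) \<le> R * sc k \<and> norm (\<eta> - \<xi> k') \<le> R * sc k'} \<le> M" (is "finite ?S \<and> _") for k
  proof (rule packing_bound[where x = \<xi> and z = "\<xi> k" and r = "a * \<rho> / L * sc k" and D = "(R + R * L) * sc k"])
    show "0 < a * \<rho> / L * sc k" "0 \<le> (R + R * L) * sc k" using a \<rho> L R sc[of k] by auto
    have comp: "sc k' \<le> L * sc k" "sc k \<le> L * sc k'" if S: "k' \<in> ?S" for k'
    proof -
      obtain \<eta> where \<eta>: "norm (\<eta> - \<xi> k) \<le> R * sc k" "norm (\<eta> - \<xi> k') \<le> R * sc k'" using S by blast
      have 1: "norm (\<xi> k') \<le> K * norm (\<xi> k)" using \<eta> by (intro le ge1) (auto simp: sc_def)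
      have 2: "norm (\<xi> k) \<le> K * norm (\<xi> k')" using \<eta> by (intro le ge1) (auto simp: sc_def)
      have pos: "0 < norm (\<xi> k)" "0 < norm (\<xi> k')"
        using ge1[of k] ge1[of k'] by linarith+
      show "sc k' \<le> L * sc k" "sc k \<le> L * sc k'" unfolding sc_def L_def
        using 1 2 K pos by (auto intro!: powr_comparable simp del: zero_less_norm_iff)
    qed
    show "norm (\<xi> k' - \<xi> k) \<le> (R + R * L) * sc k" if S: "k' \<in> ?S" for k'
    proof -
      obtain \<eta> where \<eta>: "norm (\<eta> - \<xi> k) \<le> R * sc k" "norm (\<eta> - \<xi> k') \<le> R * sc k'" using S by blast
      have "norm (\<xi> k' - \<xi> k) \<le> norm (\<eta> - \<xi> k) + norm (\<eta> - \<xi> k')"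
        using norm_triangle_ineq4[of "\<eta> - \<xi> k" "\<eta> - \<xi> k'"] by (simp add: algebra_simps)
      also have "\<dots> \<le> R * sc k + R * (L * sc k)"
        using \<eta> comp(1)[OF S] R by (intro add_mono order_trans[OF \<eta>(2)] mult_left_mono) auto
      finally show ?thesis by (simp add: algebra_simps)
    qed
    have sub: "ball (\<xi> k') (a * \<rho> / L * sc k) \<subseteq> exclusion_ball \<alpha> a \<rho> (\<xi> k')" if "k' \<in> ?S" for k'
    proof -
      have "a * \<rho> / L * sc k \<le> a * \<rho> * sc k'"
        using mult_left_mono[OF comp(2)[OF that], of "a * \<rho>"] a \<rho> L by (simp add: field_simps)
      then show ?thesis unfolding exclusion_ball_def sc_def by (rule subset_ball)
    qed
    show "ball (\<xi> i) (a * \<rho> / L * sc k) \<inter> ball (\<xi> j) (a * \<rho> / L * sc k) = {}"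
      if "i \<in> ?S" "j \<in> ?S" "i \<noteq> j" for i j
      using sub[OF that(1)] sub[OF that(2)] subdyadic_centers_disjoint[OF \<xi> that(3)] by blast
    have "((R + R * L) * sc k + a * \<rho> / L * sc k) / (a * \<rho> / L * sc k) = q"
      unfolding q_def distrib_right[symmetric] using sc[of k] by simp
    then show "(((R + R * L) * sc k + a * \<rho> / L * sc k) / (a * \<rho> / L * sc k)) ^ DIM(real^'n) \<le> real M"
      by (simp add: M_def real_nat_ceiling_ge)
  qed
  then show ?thesis unfolding sc_def by blast
qed

section \<open>Schur test and banded block matrices\<close>

lemma ennreal_sum_le_infsum:
  fixes f :: "'a \<Rightarrow> ennreal"
  shows "finite F \<Longrightarrow> sum f F \<le> infsum f UNIV"
  by (subst nonneg_infsum_complete) (auto intro: SUP_upper)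

lemma ennreal_infsum_le:
  fixes f :: "'a \<Rightarrow> ennreal"
  assumes "\<And>F. finite F \<Longrightarrow> sum f F \<le> b"
  shows "infsum f UNIV \<le> b"
  by (subst nonneg_infsum_complete) (auto intro: SUP_least assms)

lemma ennreal_infsum_mono:
  fixes f g :: "'a \<Rightarrow> ennreal"
  shows "(\<And>x. f x \<le> g x) \<Longrightarrow> infsum f UNIV \<le> infsum g UNIV"
  by (intro infsum_mono nonneg_summable_on_complete) auto

lemma ennreal_infsum_cmult:
  fixes f :: "'a \<Rightarrow> ennreal"
  shows "(\<Sum>\<^sub>\<infinity>x. c * f x) = c * infsum f UNIV"
  by (subst (1 2) nonneg_infsum_complete)
     (auto simp: SUP_mult_left_ennreal sum_distrib_left)

lemma ennreal_infsum_sum: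
  fixes f :: "'i \<Rightarrow> 'a \<Rightarrow> ennreal"
  shows "finite I \<Longrightarrow> (\<Sum>\<^sub>\<infinity>x. \<Sum>i\<in>I. f i x) = (\<Sum>i\<in>I. infsum (f i) UNIV)"
  by (induction rule: finite_induct)
     (simp_all add: infsum_add nonneg_summable_on_complete)

lemma ennreal_powr_ennreal: "0 \<le> x \<Longrightarrow> ennreal_powr (ennreal x) r = ennreal (x powr r)"
  by (simp add: ennreal_powr_def)

lemma ennreal_powr_mono: "x \<le> y \<Longrightarrow> 0 \<le> r \<Longrightarrow> ennreal_powr x r \<le> ennreal_powr y r"
  by (cases x; cases y) (auto simp: ennreal_powr_def top_unique intro: powr_mono2)

lemma ennreal_powr_powr:
  "ennreal_powr (ennreal_powr x r) s = ennreal_powr x (r * s)"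
  by (cases x) (auto simp: ennreal_powr_def powr_powr)

lemma ennreal_powr_one [simp]: "ennreal_powr x 1 = x"
  by (cases x) (auto simp: ennreal_powr_def)

lemma ennreal_powr_mult:
  "0 < c \<Longrightarrow> ennreal_powr (ennreal c * x) r = ennreal (c powr r) * ennreal_powr x r"
  by (cases x) (auto simp: ennreal_powr_def powr_mult ennreal_mult_top ennreal_mult[symmetric])

text \<open>When one of the two points is 0, convexity reduces to \<open>u powr r \<le> u\<close> on
  the open unit interval; otherwise it is convexity on the positive half-line.\<close>

lemma powr_convex_nonneg:
  fixes r :: real
  assumes r: "1 \<le> r" shows "convex_on {0..} (\<lambda>x. x powr r)"
proof (rule convex_onI)
  fix t x y :: real
  assume t: "0 < t" "t < 1" and xy: "x \<in> {0..}" "y \<in> {0..}"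
  have small: "u powr r \<le> u" if "0 < u" "u < 1" for u
    using powr_mono'[of 1 r u] r that by simp
  show "((1 - t) *\<^sub>R x + t *\<^sub>R y) powr r \<le> (1 - t) * x powr r + t * y powr r"
  proof (cases "x = 0 \<or> y = 0")
    case True
    then show ?thesis using t xy small[of t] small[of "1 - t"]
      by (auto simp: powr_mult intro!: mult_right_mono)
  next
    case False
    then show ?thesis
      using convex_onD[OF powr_convex[OF r], of t x y] t xy by auto
  qed
qed simp

text \<open>Jensen's inequality for the probability weights \<open>a j / s\<close>, where
  \<open>s\<close> is the actual total mass. Passing from \<open>s\<close> to its bound
  \<open>C\<close> is possible because \<open>r - 1\<close> is nonnegative.\<close>

lemma sum_powr_jensen:
  fixes a x :: "'j \<Rightarrow> real"
  assumes F: "finite F" and a: "\<And>j. 0 \<le> a j" and x: "\<And>j. 0 \<le> x j"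
    and C: "sum a F \<le> C" and r: "1 \<le> r"
  shows "(\<Sum>j\<in>F. a j * x j) powr r \<le> C powr (r - 1) * (\<Sum>j\<in>F. a j * x j powr r)"
proof (cases "sum a F = 0")
  case True
  then have "\<forall>j\<in>F. a j = 0" using F a by (simp add: sum_nonneg_eq_0_iff)
  then show ?thesis by simp
next
  case False
  define s where "s = sum a F"
  have s: "0 < s" using False a by (simp add: s_def order_less_le sum_nonneg)
  have "(\<Sum>j\<in>F. (a j / s) *\<^sub>R x j) powr r \<le> (\<Sum>j\<in>F. (a j / s) * x j powr r)"
  proof (rule convex_on_sum[where C = "{0..}" and f = "\<lambda>x. x powr r"])
    show "convex_on {0..} (\<lambda>x. x powr r)" by (rule powr_convex_nonneg[OF r])
    show "(\<Sum>j\<in>F. a j / s) = 1" using s by (simp add: s_def flip: sum_divide_distrib)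
    show "F \<noteq> {}" using False by auto
  qed (use F a x s in auto)
  then have "((\<Sum>j\<in>F. a j * x j) / s) powr r \<le> (\<Sum>j\<in>F. a j * x j powr r) / s"
    by (simp add: sum_divide_distrib)
  then have "(\<Sum>j\<in>F. a j * x j) powr r \<le> s powr r * ((\<Sum>j\<in>F. a j * x j powr r) / s)"
    using s by (subst (asm) powr_divide) (auto simp: sum_nonneg a x field_simps)
  also have "\<dots> = s powr (r - 1) * (\<Sum>j\<in>F. a j * x j powr r)"
    using s by (simp add: powr_diff)
  also have "\<dots> \<le> C powr (r - 1) * (\<Sum>j\<in>F. a j * x j powr r)"
    using s C r by (intro mult_right_mono powr_mono2 sum_nonneg) (auto simp: s_def a)
  finally show ?thesis .
qed

lemma one_le_ennreal_cases:
  assumes "1 \<le> (p::ennreal)"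
  obtains "p = \<infinity>" | r where "p \<noteq> \<infinity>" "enn2real p = r" "1 \<le> r"
proof (cases p)
  case (real r)
  then have "1 \<le> r" using assms by (metis ennreal_1 ennreal_le_iff)
  then show ?thesis using that(2)[of r] real by auto
qed (use that in auto)

text \<open>For infinite \<open>p\<close> the row sums suffice. For finite \<open>r\<close>,
  Jensen's inequality in each row yields \<open>C powr (r - 1)\<close>, and summing over the rows
  first yields one more factor \<open>C\<close> from the columns; the \<open>r\<close>-th root
  leaves \<open>C\<close>.\<close>

lemma schur_test:
  fixes A :: "'i \<Rightarrow> 'j \<Rightarrow> real" and x :: "'j \<Rightarrow> real"
  assumes A: "\<And>i j. 0 \<le> A i j" and x: "\<And>j. 0 \<le> x j" and C: "0 < C"
    and row: "\<And>i F. finite F \<Longrightarrow> (\<Sum>j\<in>F. A i j) \<le> C"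
    and col: "\<And>j F. finite F \<Longrightarrow> (\<Sum>i\<in>F. A i j) \<le> C"
    and p: "1 \<le> p"
  shows "lp_norm p (\<lambda>i. \<Sum>\<^sub>\<infinity>j. ennreal (A i j * x j)) \<le> ennreal C * lp_norm p (\<lambda>j. ennreal (x j))"
  using p
proof (cases rule: one_le_ennreal_cases)
  case 1
  define s where "s = (SUP j. ennreal (x j))"
  have "(\<Sum>\<^sub>\<infinity>j. ennreal (A i j * x j)) \<le> ennreal C * s" for i
  proof (rule ennreal_infsum_le)
    fix F :: "'j set" assume F: "finite F"
    have "(\<Sum>j\<in>F. ennreal (A i j * x j)) = (\<Sum>j\<in>F. ennreal (A i j) * ennreal (x j))"
      by (simp add: ennreal_mult A x)
    also have "\<dots> \<le> (\<Sum>j\<in>F. ennreal (A i j) * s)"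
      by (intro sum_mono mult_left_mono) (auto simp: s_def intro: SUP_upper)
    also have "\<dots> = ennreal (\<Sum>j\<in>F. A i j) * s"
      by (simp add: sum_distrib_right[symmetric] sum_ennreal A)
    also have "\<dots> \<le> ennreal C * s" using row[OF F] by (intro mult_right_mono ennreal_leI) auto
    finally show "(\<Sum>j\<in>F. ennreal (A i j * x j)) \<le> ennreal C * s" .
  qed
  then show ?thesis using 1 by (auto simp: lp_norm_def s_def intro: SUP_least)
next
  case (2 r)
  define v where "v = (\<lambda>i. \<Sum>\<^sub>\<infinity>j. ennreal (A i j * x j))"
  define W where "W = (\<lambda>i. ennreal (C powr (r - 1)) * (\<Sum>\<^sub>\<infinity>j. ennreal (A i j * x j powr r)))"
  define U where "U = (\<Sum>\<^sub>\<infinity>j. ennreal_powr (ennreal (x j)) r)"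
  have U: "U = (\<Sum>\<^sub>\<infinity>j. ennreal (x j powr r))" unfolding U_def by (simp add: ennreal_powr_ennreal x)
  have v: "ennreal_powr (v i) r \<le> W i" for i
  proof -
    \<comment> \<open>The \<open>r\<close>-th root is put on the right so that the claim bounds an
      infinite sum itself and can be tested on finite partial sums; it is undone afterwards.\<close>
    have "v i \<le> ennreal_powr (W i) (1 / r)"
      unfolding v_def
    proof (rule ennreal_infsum_le)
      fix F :: "'j set" assume F: "finite F"
      define t where "t = (\<Sum>j\<in>F. A i j * x j)"
      have t: "0 \<le> t" unfolding t_def by (intro sum_nonneg mult_nonneg_nonneg A x)
      have "ennreal_powr (ennreal t) r \<le> ennreal (C powr (r - 1) * (\<Sum>j\<in>F. A i j * x j powr r))"
        using sum_powr_jensen[of F "A i" x C r] F A x row 2 t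
        by (simp add: ennreal_powr_ennreal t_def ennreal_leI)
      also have "\<dots> = ennreal (C powr (r - 1)) * (\<Sum>j\<in>F. ennreal (A i j * x j powr r))"
        by (subst sum_ennreal) (simp_all add: A ennreal_mult[symmetric] sum_nonneg)
      also have "\<dots> \<le> W i" unfolding W_def
        by (intro mult_left_mono ennreal_sum_le_infsum F) auto
      finally have "ennreal_powr (ennreal_powr (ennreal t) r) (1 / r) \<le> ennreal_powr (W i) (1 / r)"
        using 2 by (intro ennreal_powr_mono) auto
      moreover have "(\<Sum>j\<in>F. ennreal (A i j * x j)) = ennreal t"
        unfolding t_def by (simp add: A x)
      ultimately show "(\<Sum>j\<in>F. ennreal (A i j * x j)) \<le> ennreal_powr (W i) (1 / r)"
        using 2 by (simp add: ennreal_powr_powr)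
    qed
    then have "ennreal_powr (v i) r \<le> ennreal_powr (ennreal_powr (W i) (1 / r)) r"
      using 2 by (intro ennreal_powr_mono) auto
    then show ?thesis using 2 by (simp add: ennreal_powr_powr)
  qed
  have "(\<Sum>\<^sub>\<infinity>i. ennreal_powr (v i) r) \<le> ennreal (C powr r) * U"
  proof (rule ennreal_infsum_le)
    fix F :: "'i set" assume F: "finite F"
    have "(\<Sum>i\<in>F. ennreal_powr (v i) r) \<le> (\<Sum>i\<in>F. W i)" by (intro sum_mono v)
    also have "\<dots> = ennreal (C powr (r - 1)) * (\<Sum>\<^sub>\<infinity>j. \<Sum>i\<in>F. ennreal (A i j * x j powr r))"
      unfolding W_def by (simp add: ennreal_infsum_sum[OF F] flip: sum_distrib_left)
    also have "\<dots> \<le> ennreal (C powr (r - 1)) * (\<Sum>\<^sub>\<infinity>j. ennreal C * ennreal (x j powr r))"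
    proof (intro mult_left_mono ennreal_infsum_mono)
      fix j
      have "(\<Sum>i\<in>F. ennreal (A i j * x j powr r)) = ennreal ((\<Sum>i\<in>F. A i j) * x j powr r)"
        by (simp add: sum_distrib_right A)
      also have "\<dots> \<le> ennreal (C * x j powr r)"
        using col[OF F] by (intro ennreal_leI mult_right_mono) auto
      also have "\<dots> = ennreal C * ennreal (x j powr r)" using C by (simp add: ennreal_mult)
      finally show "(\<Sum>i\<in>F. ennreal (A i j * x j powr r)) \<le> ennreal C * ennreal (x j powr r)" .
    qed auto
    also have "\<dots> = ennreal (C powr (r - 1) * C) * U"
      using C by (simp add: ennreal_infsum_cmult U ennreal_mult mult.assoc)
    also have "C powr (r - 1) * C = C powr r" using C by (simp add: powr_diff)
    finally show "(\<Sum>i\<in>F. ennreal_powr (v i) r) \<le> ennreal (C powr r) * U" .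
  qed
  then have "ennreal_powr (\<Sum>\<^sub>\<infinity>i. ennreal_powr (v i) r) (1 / r) \<le> ennreal_powr (ennreal (C powr r) * U) (1 / r)"
    using 2 by (intro ennreal_powr_mono) auto
  also have "\<dots> = ennreal C * ennreal_powr U (1 / r)"
    using C 2 by (simp add: ennreal_powr_mult powr_powr)
  finally show ?thesis using 2 by (simp add: lp_norm_def v_def U_def)
qed

section \<open>Norms of finite sums of blocks, and banded matrices\<close>

lemma lp_norm_mono:
  assumes "\<And>i. u i \<le> v i" "1 \<le> p"
  shows "lp_norm p u \<le> lp_norm p v"
  using assms(2)
proof (cases rule: one_le_ennreal_cases)
  case 1
  then show ?thesis using assms(1) by (auto simp: lp_norm_def intro!: SUP_mono)
next
  case (2 r)
  then show ?thesis using assms(1)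
    by (auto simp: lp_norm_def intro!: ennreal_powr_mono ennreal_infsum_mono)
qed

lemma le_lp_norm:
  assumes "1 \<le> p" shows "u i \<le> lp_norm p u"
  using assms
proof (cases rule: one_le_ennreal_cases)
  case 1
  then show ?thesis by (auto simp: lp_norm_def intro: SUP_upper)
next
  case (2 r)
  have "ennreal_powr (u i) r \<le> (\<Sum>\<^sub>\<infinity>i. ennreal_powr (u i) r)"
    using ennreal_sum_le_infsum[of "{i}" "\<lambda>i. ennreal_powr (u i) r"] by simp
  then have "ennreal_powr (ennreal_powr (u i) r) (1 / r) \<le> lp_norm p u"
    using 2 by (auto simp: lp_norm_def intro!: ennreal_powr_mono)
  then show ?thesis using 2 by (simp add: ennreal_powr_powr)
qed

text \<open>A crude substitute for Minkowski's inequality: a sum of at most \<open>M\<close> terms is at most \<open>M\<close> times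
  the largest one.\<close>

lemma lp_norm_sum_le:
  assumes S: "finite S" "card S \<le> M" and p: "1 \<le> p"
  shows "lp_norm p (\<lambda>j. \<Sum>k\<in>S. b k j) \<le> ennreal ((real M)\<^sup>2) * (\<Sum>k\<in>S. lp_norm p (b k))"
proof (cases "S = {}")
  case True
  then show ?thesis by (simp add: lp_norm_def ennreal_powr_def)
next
  case False
  have M: "1 \<le> real M" using S False
    by (metis One_nat_def Suc_leI card_gt_0_iff le_trans of_nat_1 of_nat_le_iff)
  have sum_le: "(\<Sum>k\<in>S. y k) \<le> ennreal (real M) * y k0" if "\<And>k. k \<in> S \<Longrightarrow> y k \<le> y k0" for y :: "_ \<Rightarrow> ennreal" and k0
  proof -
    have "(\<Sum>k\<in>S. y k) \<le> of_nat (card S) * y k0" using that by (rule sum_bounded_above)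
    also have "\<dots> \<le> of_nat M * y k0" using S by (intro mult_right_mono) auto
    finally show ?thesis by (simp add: ennreal_of_nat_eq_real_of_nat)
  qed
  have ex_max: "\<exists>k0\<in>S. \<forall>k\<in>S. y k \<le> y k0" for y :: "_ \<Rightarrow> ennreal"
  proof -
    have "Max (y ` S) \<in> y ` S" using S False by (intro Max_in) auto
    moreover have "y k \<le> Max (y ` S)" if "k \<in> S" for k using S that by (intro Max_ge) auto
    ultimately show ?thesis by (metis imageE)
  qed
  obtain k1 where k1: "k1 \<in> S" "\<And>k. k \<in> S \<Longrightarrow> lp_norm p (b k) \<le> lp_norm p (b k1)"
    using ex_max[of "\<lambda>k. lp_norm p (b k)"] by blast
  have k1_le: "lp_norm p (b k1) \<le> (\<Sum>k\<in>S. lp_norm p (b k))"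
    using k1(1) S by (intro member_le_sum) auto
  have "lp_norm p (\<lambda>j. \<Sum>k\<in>S. b k j) \<le> ennreal ((real M)\<^sup>2) * lp_norm p (b k1)"
    using p
  proof (cases rule: one_le_ennreal_cases)
    case 1
    have "(\<Sum>k\<in>S. b k j) \<le> ennreal ((real M)\<^sup>2) * lp_norm p (b k1)" for j
    proof -
      have "(\<Sum>k\<in>S. b k j) \<le> (\<Sum>k\<in>S. lp_norm p (b k))" by (intro sum_mono le_lp_norm p)
      also have "\<dots> \<le> ennreal (real M) * lp_norm p (b k1)" by (rule sum_le) (rule k1)
      also have "\<dots> \<le> ennreal ((real M)\<^sup>2) * lp_norm p (b k1)"
        using M by (intro mult_right_mono ennreal_leI) (auto simp: power2_eq_square)
      finally show ?thesis .
    qed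
    then show ?thesis using 1 by (auto simp: lp_norm_def intro: SUP_least)
  next
    case (2 r)
    define B where "B = (\<lambda>k. \<Sum>\<^sub>\<infinity>j. ennreal_powr (b k j) r)"
    have lpB: "lp_norm p (b k) = ennreal_powr (B k) (1 / r)" for k using 2 by (simp add: lp_norm_def B_def)
    have Bk1: "B k \<le> B k1" if "k \<in> S" for k
    proof -
      have "ennreal_powr (ennreal_powr (B k) (1 / r)) r \<le> ennreal_powr (ennreal_powr (B k1) (1 / r)) r"
        using k1(2)[OF that] 2 unfolding lpB by (simp add: ennreal_powr_mono[where r = r])
      then show ?thesis using 2 by (simp add: ennreal_powr_powr)
    qed
    have pt: "ennreal_powr (\<Sum>k\<in>S. b k j) r \<le> ennreal (real M powr r) * (\<Sum>k\<in>S. ennreal_powr (b k j) r)" for j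
    proof -
      obtain k0 where k0: "k0 \<in> S" "\<And>k. k \<in> S \<Longrightarrow> b k j \<le> b k0 j"
        using ex_max[of "\<lambda>k. b k j"] by blast
      have "ennreal_powr (\<Sum>k\<in>S. b k j) r \<le> ennreal_powr (ennreal (real M) * b k0 j) r"
        using 2 by (intro ennreal_powr_mono sum_le k0) auto
      also have "\<dots> = ennreal (real M powr r) * ennreal_powr (b k0 j) r"
        using M by (simp add: ennreal_powr_mult)
      also have "\<dots> \<le> ennreal (real M powr r) * (\<Sum>k\<in>S. ennreal_powr (b k j) r)"
        using k0(1) S by (intro mult_left_mono member_le_sum[of k0 S "\<lambda>k. ennreal_powr (b k j) r"]) auto
      finally show ?thesis .
    qed
    have "(\<Sum>\<^sub>\<infinity>j. ennreal_powr (\<Sum>k\<in>S. b k j) r) \<le> ennreal (real M powr r) * (\<Sum>k\<in>S. B k)"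
      unfolding B_def ennreal_infsum_sum[OF S(1), symmetric] ennreal_infsum_cmult[symmetric]
      by (rule ennreal_infsum_mono) (rule pt)
    also have "\<dots> \<le> ennreal (real M powr r) * (ennreal (real M) * B k1)"
      by (intro mult_left_mono sum_le Bk1) auto
    \<comment> \<open>Here \<open>M \<le> M powr r\<close>, as \<open>M\<close> and \<open>r\<close>
      are at least 1. Together with the factor from \<open>pt\<close> this is
      \<open>M\<^sup>2\<close> to the power \<open>r\<close>, which gives the constant after taking
      the root.\<close>
    also have "\<dots> \<le> ennreal (real M powr r) * (ennreal (real M powr r) * B k1)"
      using M 2 powr_mono[of 1 r "real M"] by (intro mult_left_mono mult_right_mono ennreal_leI) auto
    also have "\<dots> = ennreal ((real M)\<^sup>2 powr r) * B k1"
      using M by (simp add: power2_eq_square powr_mult ennreal_mult mult.assoc)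
    finally have "ennreal_powr (\<Sum>\<^sub>\<infinity>j. ennreal_powr (\<Sum>k\<in>S. b k j) r) (1 / r)
        \<le> ennreal_powr (ennreal ((real M)\<^sup>2 powr r) * B k1) (1 / r)"
      using 2 by (intro ennreal_powr_mono) auto
    also have "\<dots> = ennreal ((real M)\<^sup>2) * ennreal_powr (B k1) (1 / r)"
      using M 2 by (simp add: ennreal_powr_mult powr_powr)
    finally show ?thesis using 2 lpB by (simp add: lp_norm_def)
  qed
  also have "\<dots> \<le> ennreal ((real M)\<^sup>2) * (\<Sum>k\<in>S. lp_norm p (b k))"
    using k1_le by (intro mult_left_mono) auto
  finally show ?thesis .
qed

text \<open>The passage from bounds for finite sums of moduli in \<open>ennreal\<close> to absolute
  convergence of the complex series that defines the matrix action.\<close>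

lemma summable_on_of_ennreal_bound:
  fixes f :: "'a \<Rightarrow> complex"
  assumes "\<And>F. finite F \<Longrightarrow> (\<Sum>x\<in>F. ennreal (cmod (f x))) \<le> B" "B < \<infinity>"
  shows "f summable_on UNIV" "ennreal (cmod (infsum f UNIV)) \<le> B"
proof -
  obtain b where b: "B = ennreal b" "0 \<le> b" using assms(2) by (cases B) auto
  have le: "(\<Sum>x\<in>F. cmod (f x)) \<le> b" if "finite F" for F
    using assms(1)[OF that] b by (simp add: sum_nonneg)
  have s: "(\<lambda>x. norm (f x)) summable_on UNIV"
    by (rule nonneg_bdd_above_summable_on) (auto intro!: bdd_aboveI[of _ b] le)
  show "f summable_on UNIV" using s by (rule abs_summable_summable)
  have "cmod (infsum f UNIV) \<le> (\<Sum>\<^sub>\<infinity>x. cmod (f x))" using s by (rule norm_infsum_bound)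
  also have "\<dots> \<le> b" using s le by (intro infsum_le_finite_sums) auto
  finally show "ennreal (cmod (infsum f UNIV)) \<le> B" using b by (simp add: ennreal_leI)
qed

text \<open>\<open>\<omega> k\<close> bounds every block in column \<open>k\<close> of the band. The
  hypothesis on the weights lets it carry \<open>W k'\<close> back to \<open>V k\<close>, after
  which the blocks are dominated by a scalar matrix that is constant on the band.\<close>

lemma banded_matrix_bounded:
  fixes G :: "'j \<Rightarrow> 'k \<Rightarrow> 'j \<Rightarrow> 'k \<Rightarrow> complex" and S :: "'k \<Rightarrow> 'k set" and \<omega> V W :: "'k \<Rightarrow> real"
  assumes S: "\<And>k. finite (S k)" "\<And>k. card (S k) \<le> M" "\<And>k k'. k \<in> S k' \<longleftrightarrow> k' \<in> S k"
    and zero: "\<And>j j' k k'. k \<notin> S k' \<Longrightarrow> G j' k' j k = 0"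
    and \<omega>: "\<And>k. 0 < \<omega> k"
    and row: "\<And>j' k k' F. k \<in> S k' \<Longrightarrow> finite F \<Longrightarrow> (\<Sum>j\<in>F. cmod (G j' k' j k)) \<le> \<omega> k"
    and col: "\<And>j k k' F. k \<in> S k' \<Longrightarrow> finite F \<Longrightarrow> (\<Sum>j'\<in>F. cmod (G j' k' j k)) \<le> \<omega> k"
    and V: "\<And>k. 0 < V k" and W: "\<And>k. 0 < W k"
    and weights: "\<And>k k'. k \<in> S k' \<Longrightarrow> \<omega> k * W k' \<le> L * V k"
    and p: "1 \<le> p" and q: "1 \<le> q"
  shows "bounded_matrix_operator G
    (\<lambda>c. lp_norm q (\<lambda>k. lp_norm p (\<lambda>j. ennreal (cmod (c j k))) * ennreal (V k)))
    (\<lambda>c. lp_norm q (\<lambda>k. lp_norm p (\<lambda>j. ennreal (cmod (c j k))) * ennreal (W k)))"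
proof -
  define D where "D = (real M)\<^sup>2 * max L 0"
  \<comment> \<open>The summand 1 keeps \<open>B\<close> positive, as the Schur test demands, even
    when \<open>D\<close> or \<open>M\<close> is 0.\<close>
  define B where "B = D * real M + 1"
  have D: "0 \<le> D" by (simp add: D_def)
  have B: "0 < B" unfolding B_def using D by (intro add_nonneg_pos mult_nonneg_nonneg) auto
  show ?thesis
    unfolding bounded_matrix_operator_def
  proof (intro exI[of _ B] allI impI conjI)
    fix c :: "'j \<Rightarrow> 'k \<Rightarrow> complex"
    define n where "n = (\<lambda>k. lp_norm p (\<lambda>j. ennreal (cmod (c j k))))"
    define X where "X = (\<lambda>k. n k * ennreal (V k))"
    assume "lp_norm q (\<lambda>k. lp_norm p (\<lambda>j. ennreal (cmod (c j k))) * ennreal (V k)) < \<infinity>"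
    then have fin: "lp_norm q X < \<infinity>" by (simp add: X_def n_def)
    have X: "X k < \<infinity>" for k using le_lp_norm[OF q, of X k] fin by (rule le_less_trans)
    have n: "n k < \<infinity>" for k
      using X[of k] V[of k] by (auto simp: X_def ennreal_mult_less_top less_top ennreal_top_mult)
    define x where "x = (\<lambda>k. enn2real (X k))"
    have Xx: "X k = ennreal (x k)" for k using X[of k] by (simp add: x_def less_top)
    define b where "b = (\<lambda>k' k j'. \<Sum>\<^sub>\<infinity>j. ennreal (cmod (G j' k' j k) * cmod (c j k)))"
    have b_lp: "lp_norm p (b k' k) \<le> ennreal (\<omega> k) * n k" if "k \<in> S k'" for k k'
      unfolding b_def n_def by (rule schur_test) (use row[OF that] col[OF that] \<omega> p in auto)
    have b_fin: "b k' k j' < \<infinity>" if "k \<in> S k'" for k k' j'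
    proof -
      have "b k' k j' \<le> ennreal (\<omega> k) * n k" by (rule order_trans[OF le_lp_norm[OF p] b_lp[OF that]])
      also have "\<dots> < \<infinity>" using n by (simp add: ennreal_mult_less_top)
      finally show ?thesis .
    qed
    define v where "v = (\<lambda>k' j'. \<Sum>k\<in>S k'. b k' k j')"
    have v_fin: "v k' j' < \<infinity>" for k' j'
      unfolding v_def using S b_fin by (simp add: less_top)
    \<comment> \<open>Entries off the band vanish, so any finite set of index pairs may be replaced
      by a finite rectangle over the finite set \<open>S k'\<close>.\<close>
    have finite_sums: "(\<Sum>z\<in>F. ennreal (cmod (case z of (j, k) \<Rightarrow> G j' k' j k * c j k))) \<le> v k' j'"
      if F: "finite F" for F :: "('j \<times> 'k) set" and j' k'
    proof -
      define f where "f = (\<lambda>(j, k). ennreal (cmod (G j' k' j k) * cmod (c j k)))"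
      have "(\<Sum>z\<in>F. ennreal (cmod (case z of (j, k) \<Rightarrow> G j' k' j k * c j k))) = sum f F"
        by (intro sum.cong refl) (auto simp: f_def norm_mult)
      also have "\<dots> = sum f {z\<in>F. snd z \<in> S k'}"
      proof (intro sum.mono_neutral_right F)
        have "f z = 0" if "snd z \<notin> S k'" for z using zero[OF that] by (simp add: f_def split_beta)
        then show "\<forall>z\<in>F - {z \<in> F. snd z \<in> S k'}. f z = 0" by auto
      qed auto
      also have "\<dots> \<le> sum f (fst ` F \<times> S k')"
        using F S by (intro sum_mono2) force+
      also have "\<dots> = (\<Sum>k\<in>S k'. \<Sum>j\<in>fst ` F. f (j, k))"
        by (simp add: sum.cartesian_product' sum.swap[of _ "S k'"])
      also have "\<dots> \<le> v k' j'"
        unfolding v_def b_def f_def using F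
        by (auto simp del: sum_ennreal intro!: sum_mono ennreal_sum_le_infsum)
      finally show ?thesis .
    qed
    show "(\<lambda>(j, k). G j' k' j k * c j k) summable_on UNIV" for j' k'
      by (rule summable_on_of_ennreal_bound(1)[OF finite_sums v_fin])
    have entry: "ennreal (cmod (matrix_apply G c j' k')) \<le> v k' j'" for j' k'
      unfolding matrix_apply_def by (rule summable_on_of_ennreal_bound(2)[OF finite_sums v_fin])
    define A where "A = (\<lambda>k' k. if k \<in> S k' then D else 0)"
    have block: "lp_norm p (\<lambda>j'. ennreal (cmod (matrix_apply G c j' k'))) * ennreal (W k')
        \<le> (\<Sum>\<^sub>\<infinity>k. ennreal (A k' k * x k))" for k'
    proof -
      have "lp_norm p (\<lambda>j'. ennreal (cmod (matrix_apply G c j' k'))) \<le> lp_norm p (v k')"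
        by (rule lp_norm_mono[OF entry p])
      also have "\<dots> \<le> ennreal ((real M)\<^sup>2) * (\<Sum>k\<in>S k'. lp_norm p (b k' k))"
        unfolding v_def by (rule lp_norm_sum_le[OF S(1,2) p])
      also have "\<dots> \<le> ennreal ((real M)\<^sup>2) * (\<Sum>k\<in>S k'. ennreal (\<omega> k) * n k)"
        by (intro mult_left_mono sum_mono b_lp) auto
      finally have "lp_norm p (\<lambda>j'. ennreal (cmod (matrix_apply G c j' k'))) * ennreal (W k')
          \<le> ennreal ((real M)\<^sup>2) * (\<Sum>k\<in>S k'. ennreal (\<omega> k) * n k) * ennreal (W k')"
        by (rule mult_right_mono) auto
      also have "\<dots> = ennreal ((real M)\<^sup>2) * (\<Sum>k\<in>S k'. ennreal (\<omega> k * W k') * n k)"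
        using \<omega> W by (simp add: sum_distrib_left sum_distrib_right ennreal_mult less_imp_le mult_ac)
      also have "\<dots> \<le> ennreal ((real M)\<^sup>2) * (\<Sum>k\<in>S k'. ennreal (max L 0 * V k) * n k)"
        using V by (intro mult_left_mono sum_mono mult_right_mono ennreal_leI order_trans[OF weights])
          (auto simp: less_imp_le intro!: mult_right_mono)
      also have "\<dots> = (\<Sum>k\<in>S k'. ennreal D * ennreal (x k))"
        using V by (simp add: D_def Xx[symmetric] X_def ennreal_mult less_imp_le sum_distrib_left mult_ac)
      also have "\<dots> = (\<Sum>k\<in>S k'. ennreal (A k' k * x k))"
        using D by (simp add: A_def ennreal_mult x_def)
      also have "\<dots> \<le> (\<Sum>\<^sub>\<infinity>k. ennreal (A k' k * x k))" by (rule ennreal_sum_le_infsum[OF S(1)])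
      finally show ?thesis .
    qed
    have sumA: "(\<Sum>k\<in>F. if k \<in> S k' then D else 0) \<le> B" if "finite F" for F k'
    proof -
      have "(\<Sum>k\<in>F. if k \<in> S k' then D else 0) = real (card (F \<inter> S k')) * D"
        using that by (simp add: sum.If_cases)
      also have "\<dots> \<le> real M * D"
        using D S(1) card_mono[of "S k'" "F \<inter> S k'"] S(2)[of k'] by (intro mult_right_mono) auto
      finally show ?thesis by (simp add: B_def mult.commute)
    qed
    have "lp_norm q (\<lambda>k'. lp_norm p (\<lambda>j'. ennreal (cmod (matrix_apply G c j' k'))) * ennreal (W k'))
        \<le> lp_norm q (\<lambda>k'. \<Sum>\<^sub>\<infinity>k. ennreal (A k' k * x k))"
      by (rule lp_norm_mono[OF block q])
    also have "\<dots> \<le> ennreal B * lp_norm q (\<lambda>k. ennreal (x k))"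
    proof (rule schur_test[OF _ _ B _ _ q])
      show "(\<Sum>k\<in>F. A k' k) \<le> B" if "finite F" for F k' unfolding A_def by (rule sumA[OF that])
      \<comment> \<open>Symmetry of the band turns the column sum into a row sum.\<close>
      show "(\<Sum>k'\<in>F. A k' k) \<le> B" if "finite F" for F k
        using sumA[OF that, of k] by (simp add: A_def S(3))
    qed (auto simp: A_def D x_def)
    finally show "lp_norm q (\<lambda>k. lp_norm p (\<lambda>j. ennreal (cmod (matrix_apply G c j k))) * ennreal (W k))
        \<le> ennreal B * lp_norm q (\<lambda>k. lp_norm p (\<lambda>j. ennreal (cmod (c j k))) * ennreal (V k))"
      by (simp add: Xx[symmetric] X_def n_def)
  qed
qed

section \<open>Estimates for the matrix\<close>

lemma iter_partial_replicate_const: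
  "cmod (pure_deriv i n (\<lambda>x::real^'n. 1) x) \<le> 1"
proof (cases n)
  case (Suc k)
  show ?thesis unfolding Suc replicate_Suc_snoc iter_partial_append
    by (simp add: partial_deriv_const iter_partial_zero)
qed simp

lemma deriv_bound_one_minus:
  assumes "deriv_bound N A 1 \<omega>"
  shows "deriv_bound N (1 + A) 1 (\<lambda>x. 1 - \<omega> x)"
proof -
  have eq: "(\<lambda>x. 1 - \<omega> x) = (\<lambda>x. 1 + (- 1) * \<omega> x)" by auto
  have s: "smooth \<omega>" using assms by (simp add: deriv_bound_def)
  have s': "smooth (\<lambda>x. - 1 * \<omega> x)" by (rule smooth_mult[OF smooth_const s])
  have "cmod (pure_deriv i n (\<lambda>x. 1 + (- 1) * \<omega> x) x) \<le> 1 + A" if "n \<le> N" for n i x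
  proof -
    have "cmod (pure_deriv i n \<omega> x) \<le> A" using assms that by (simp add: deriv_bound_def)
    moreover have "pure_deriv i n (\<lambda>x. 1 + (- 1) * \<omega> x) x =
        pure_deriv i n (\<lambda>x. 1) x + (- 1) * pure_deriv i n \<omega> x"
      unfolding iter_partial_add[OF smooth_const s'] iter_partial_cmult[OF s] ..
    ultimately show ?thesis
      using iter_partial_replicate_const[of n i x]
        norm_triangle_ineq[of "pure_deriv i n (\<lambda>x. 1) x" "(- 1) * pure_deriv i n \<omega> x"]
      by simp
  qed
  moreover have "smooth (\<lambda>x. 1 + (- 1) * \<omega> x)" by (rule smooth_add[OF smooth_const s'])
  ultimately show ?thesis unfolding eq deriv_bound_def power_one mult_1_right by blast
qed

lemma supp_affine_comp:
  fixes F :: "'a::real_normed_vector \<Rightarrow> complex"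
  assumes "0 < s"
  shows "supp (\<lambda>\<eta>. F ((1 / s) *\<^sub>R (\<eta> - x))) \<subseteq> {\<eta>. (1 / s) *\<^sub>R (\<eta> - x) \<in> supp F}"
    and "closed {\<eta>. (1 / s) *\<^sub>R (\<eta> - x) \<in> supp F}"
proof -
  have "closed ((\<lambda>\<eta>. (1 / s) *\<^sub>R (\<eta> - x)) -` supp F)"
    by (intro closed_vimage continuous_intros) (simp add: supp_def)
  then show c: "closed {\<eta>. (1 / s) *\<^sub>R (\<eta> - x) \<in> supp F}" by (simp add: vimage_def)
  show "supp (\<lambda>\<eta>. F ((1 / s) *\<^sub>R (\<eta> - x))) \<subseteq> {\<eta>. (1 / s) *\<^sub>R (\<eta> - x) \<in> supp F}"
    by (rule supp_subset_closed[OF c]) (auto simp: not_in_supp)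
qed

lemma rescaled_in_ball:
  assumes "0 < s" "(1 / s) *\<^sub>R (\<eta> - x) \<in> ball 0 R"
  shows "norm (\<eta> - x) < R * s"
proof -
  have "norm ((1 / s) *\<^sub>R (\<eta> - x)) = norm (\<eta> - x) / s"
    unfolding norm_scaleR using assms(1) by simp
  then show ?thesis using assms by (simp add: pos_divide_less_eq del: norm_scaleR)
qed

lemma test_function_affine_comp:
  assumes "test_function UNIV F" "0 < s" "supp F \<subseteq> ball 0 R"
  shows "test_function UNIV (\<lambda>\<eta>. F ((1 / s) *\<^sub>R (\<eta> - x)))"
    and "supp (\<lambda>\<eta>. F ((1 / s) *\<^sub>R (\<eta> - x))) \<subseteq> ball x (R * s)"
proof -
  have sub: "{\<eta>. (1 / s) *\<^sub>R (\<eta> - x) \<in> supp F} \<subseteq> ball x (R * s)"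
    using rescaled_in_ball[OF assms(2)] assms(3) by (force simp: dist_norm norm_minus_commute)
  then show "supp (\<lambda>\<eta>. F ((1 / s) *\<^sub>R (\<eta> - x))) \<subseteq> ball x (R * s)"
    by (rule order_trans[OF supp_affine_comp(1)[OF assms(2)]])
  then have "bounded (supp (\<lambda>\<eta>. F ((1 / s) *\<^sub>R (\<eta> - x))))" using bounded_ball bounded_subset by blast
  then have "compact (supp (\<lambda>\<eta>. F ((1 / s) *\<^sub>R (\<eta> - x))))"
    by (simp add: compact_eq_bounded_closed supp_def)
  then show "test_function UNIV (\<lambda>\<eta>. F ((1 / s) *\<^sub>R (\<eta> - x)))"
    using assms(1) by (simp add: test_function_def smooth_affine_comp)
qed

lemma test_function_cnj:
  assumes "test_function U F" shows "test_function U (\<lambda>x. cnj (F x))" "supp (\<lambda>x. cnj (F x)) = supp F"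
proof -
  show "supp (\<lambda>x. cnj (F x)) = supp F" by (simp add: supp_def)
  then show "test_function U (\<lambda>x. cnj (F x))"
    using assms by (simp add: test_function_def smooth_bounded_linear_comp[OF bounded_linear_cnj])
qed

lemma test_function_cutoff_mult:
  assumes u: "test_function UNIV u" and \<omega>: "test_function UNIV \<omega>"
    and \<omega>1: "\<And>x. norm x \<le> 1/2 \<Longrightarrow> \<omega> x = 1"
  shows "test_function (- {0}) (\<lambda>x. (1 - \<omega> x) * u x)"
proof -
  obtain A where "deriv_bound 0 A 1 \<omega>" using test_function_deriv_bound[OF \<omega>] by blast
  then have s: "smooth (\<lambda>x. 1 - \<omega> x)" using deriv_bound_one_minus deriv_bound_def by blast
  have "test_function UNIV (\<lambda>x. u x * (1 - \<omega> x))" by (rule test_function_mult[OF u s])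
  then have t: "test_function UNIV (\<lambda>x. (1 - \<omega> x) * u x)" by (simp add: mult.commute)
  have "supp (\<lambda>x. (1 - \<omega> x) * u x) \<subseteq> - ball 0 (1/2)"
    by (rule supp_subset_closed) (auto simp: \<omega>1)
  then have "supp (\<lambda>x. (1 - \<omega> x) * u x) \<subseteq> - {0}" by (auto simp: subset_eq)
  then show ?thesis using t by (simp add: test_function_def)
qed

text \<open>The weak derivatives of the symbol live on the punctured space, so test functions have to
  vanish near the origin. This can be arranged because the symbol vanishes on the punctured unit
  ball; its value at the origin itself is arbitrary.\<close>

lemma integral_mult_test_cutoff:
  fixes m u :: "real^'n \<Rightarrow> complex"
  assumes m: "locally_integrable_on m (- {0})" and m0: "\<And>\<eta>. \<eta> \<noteq> 0 \<Longrightarrow> m \<eta> \<noteq> 0 \<Longrightarrow> 1 \<le> norm \<eta>"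
    and u: "test_function UNIV u" and \<omega>: "test_function UNIV \<omega>"
    and \<omega>1: "\<And>x. norm x \<le> 1/2 \<Longrightarrow> \<omega> x = 1" and \<omega>0: "\<And>x. 1 \<le> norm x \<Longrightarrow> \<omega> x = 0"
  shows "integrable lebesgue (\<lambda>\<eta>. m \<eta> * u \<eta>)"
    and "(LINT \<eta>|lebesgue. m \<eta> * u \<eta>) = (LINT \<eta>|lebesgue. m \<eta> * ((1 - \<omega> \<eta>) * u \<eta>))"
proof -
  have i1: "integrable lebesgue (\<lambda>\<eta>. m \<eta> * ((1 - \<omega> \<eta>) * u \<eta>))"
    by (rule locally_integrable_mult_test[OF m test_function_cutoff_mult[OF u \<omega> \<omega>1]])
  have i2: "integrable lebesgue (\<lambda>\<eta>::real^'n. indicat_real {0} \<eta> *\<^sub>R (m 0 * u 0))" by simp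
  \<comment> \<open>The integrands agree off the origin, where \<open>m\<close> or
    \<open>\<omega>\<close> vanishes. At the origin \<open>1 - \<omega>\<close> vanishes while
    \<open>m\<close> may not; the last term records that single value and integrates to 0.\<close>
  have eq: "m \<eta> * u \<eta> = m \<eta> * ((1 - \<omega> \<eta>) * u \<eta>) + indicat_real {0} \<eta> *\<^sub>R (m 0 * u 0)" for \<eta>
  proof (cases "\<eta> = 0")
    case False
    then have "m \<eta> = 0 \<or> \<omega> \<eta> = 0" using m0[of \<eta>] \<omega>0[of \<eta>] by blast
    then show ?thesis using False by auto
  qed (simp add: \<omega>1)
  have eq': "(\<lambda>\<eta>. m \<eta> * u \<eta>) = (\<lambda>\<eta>. m \<eta> * ((1 - \<omega> \<eta>) * u \<eta>) + indicat_real {0} \<eta> *\<^sub>R (m 0 * u 0))"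
    using eq by blast
  show "integrable lebesgue (\<lambda>\<eta>. m \<eta> * u \<eta>)" unfolding eq' by (intro Bochner_Integration.integrable_add i1 i2)
  have "(LINT \<eta>|lebesgue. m \<eta> * u \<eta>) = (LINT \<eta>|lebesgue. m \<eta> * ((1 - \<omega> \<eta>) * u \<eta>)) +
      (LINT \<eta>|lebesgue. indicat_real {0::real^'n} \<eta> *\<^sub>R (m 0 * u 0))"
    unfolding eq' by (rule Bochner_Integration.integral_add[OF i1 i2])
  also have "(LINT \<eta>|lebesgue. indicat_real {0::real^'n} \<eta> *\<^sub>R (m 0 * u 0)) = 0"
    by (subst integral_scaleR_left) auto
  finally show "(LINT \<eta>|lebesgue. m \<eta> * u \<eta>) = (LINT \<eta>|lebesgue. m \<eta> * ((1 - \<omega> \<eta>) * u \<eta>))" by simp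
qed

text \<open>Two independent bumps are allowed so that the same estimate serves row and column sums,
  with the conjugate on either factor; the sum always runs over the lattice of the first center
  \<open>x\<close>. All three factors need derivative bounds at the scale of \<open>x\<close>: the
  second bump has them because the norms are comparable, the cutoff by a case distinction on
  \<open>norm x\<close>.\<close>

lemma packet_product_sum:
  fixes m F G \<omega> :: "real^'n \<Rightarrow> complex"
  assumes hm: "hoermander_miyachi \<alpha> \<mu> m" and \<alpha>: "0 < \<alpha>" and R: "1 \<le> R"
    and b: "0 < b" "0 < \<rho>" "b * \<rho> * R < pi"
    and F: "test_function UNIV F" "supp F \<subseteq> ball 0 R"
    and G: "test_function UNIV G" "supp G \<subseteq> ball 0 R"
    and \<omega>: "test_function UNIV \<omega>" and \<omega>1: "\<And>x. norm x \<le> 1/2 \<Longrightarrow> \<omega> x = 1"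
    and \<omega>0: "\<And>x. 1 \<le> norm x \<Longrightarrow> \<omega> x = 0" and K: "1 \<le> K"
  shows "\<exists>C\<ge>0. \<forall>x y v J. 1 \<le> norm x \<longrightarrow> 1 \<le> norm y \<longrightarrow> norm x \<le> K * norm y \<longrightarrow> norm y \<le> K * norm x \<longrightarrow>
    finite J \<longrightarrow>
    (\<Sum>j\<in>J. cmod (LINT \<eta>|lebesgue. m \<eta> * (((1 - \<omega> \<eta>) * (rescale \<alpha> F x \<eta> *
        rescale \<alpha> G y \<eta>)) * cis ((v + lattice_point \<alpha> b \<rho> x j) \<bullet> \<eta>))))
      \<le> C * ((freq_scale \<alpha> x) ^ CARD('n) * norm x powr (- \<mu>))"
proof -
  define N where "N = CARD('n) div 2 + 1"
  have R0: "0 < R" using R by simp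
  obtain AF where AF: "1 \<le> AF" "deriv_bound N AF 1 F" using test_function_deriv_bound[OF F(1)] by blast
  obtain AG where AG: "1 \<le> AG" "deriv_bound N AG 1 G" using test_function_deriv_bound[OF G(1)] by blast
  obtain A\<omega> where A\<omega>: "1 \<le> A\<omega>" "deriv_bound N A\<omega> 1 \<omega>" using test_function_deriv_bound[OF \<omega>] by blast
  obtain K2 where K2: "1 \<le> K2" and ball: "\<And>x y :: real^'n. 1 \<le> norm x \<Longrightarrow> norm (y - x) \<le> R * freq_scale \<alpha> x \<Longrightarrow>
      norm y \<le> K2 * norm x \<and> norm x \<le> K2 * max 1 (norm y)"
    using subdyadic_ball_norm_bounds[OF \<alpha> R0, where 'a="real^'n"] by blast
  \<comment> \<open>The power of \<open>K\<close> converts the scale of \<open>y\<close> into that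
    of \<open>x\<close>; the power of \<open>K2\<close> bounds the scale of those \<open>x\<close>
    whose ball can reach the unit ball. The factor 2 lets each bump have rate \<open>L0 / 2\<close>,
    so that their product has rate \<open>L0\<close>.\<close>
  define L0 where "L0 = 2 * max (K powr \<bar>1 - \<alpha>\<bar>) (K2 powr \<bar>1 - \<alpha>\<bar>)"
  define A where "A = (1 + A\<omega>) * (AF * AG)"
  have A: "0 \<le> A" unfolding A_def using AF AG A\<omega> by simp
  have L0: "2 * K powr \<bar>1 - \<alpha>\<bar> \<le> L0" "2 * K2 powr \<bar>1 - \<alpha>\<bar> \<le> L0" "2 \<le> L0"
    unfolding L0_def using ge_one_powr_ge_zero[OF K, of "\<bar>1 - \<alpha>\<bar>"] by auto
  obtain C where C: "0 \<le> C" and main: "\<And>\<xi> \<Phi> A v J. 1 \<le> norm \<xi> \<Longrightarrow> finite J \<Longrightarrow> test_function (- {0}) \<Phi> \<Longrightarrow>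
    supp \<Phi> \<subseteq> ball \<xi> (R * freq_scale \<alpha> \<xi>) \<Longrightarrow> 0 \<le> A \<Longrightarrow>
    deriv_bound N A ((2 * L0) / freq_scale \<alpha> \<xi>) \<Phi> \<Longrightarrow>
    (\<Sum>j\<in>J. cmod (multiplier_integral m \<Phi> (v + lattice_point \<alpha> b \<rho> \<xi> j)))
      \<le> C * (A * (freq_scale \<alpha> \<xi>) ^ CARD('n) * norm \<xi> powr (- \<mu>))"
    using multiplier_lattice_sum[OF hm \<alpha> R b, of "2 * L0"] unfolding N_def by blast
  have "(\<Sum>j\<in>J. cmod (LINT \<eta>|lebesgue. m \<eta> * (((1 - \<omega> \<eta>) * (rescale \<alpha> F x \<eta> *
        rescale \<alpha> G y \<eta>)) * cis ((v + lattice_point \<alpha> b \<rho> x j) \<bullet> \<eta>))))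
      \<le> (C * A) * ((freq_scale \<alpha> x) ^ CARD('n) * norm x powr (- \<mu>))"
    if x: "1 \<le> norm x" and y: "1 \<le> norm y" and xy: "norm x \<le> K * norm y" and yx: "norm y \<le> K * norm x"
      and J: "finite J" for x y v J
  proof -
    define s where "s = freq_scale \<alpha> x"
    define t where "t = freq_scale \<alpha> y"
    have pos: "0 < norm x" "0 < norm y" using x y by linarith+
    have s: "0 < s" and t: "0 < t" unfolding s_def t_def using pos by auto
    have "s \<le> K powr \<bar>1 - \<alpha>\<bar> * t" unfolding s_def t_def
      using pos xy yx K by (intro powr_comparable) auto
    also have "\<dots> \<le> (L0 / 2) * t" using L0(1) t by (intro mult_right_mono) auto
    finally have st: "1 / t \<le> (L0 / 2) / s" using s t by (simp add: field_simps)
    define Fx where "Fx = (\<lambda>\<eta>. F ((1 / s) *\<^sub>R (\<eta> - x)))"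
    define Gy where "Gy = (\<lambda>\<eta>. G ((1 / t) *\<^sub>R (\<eta> - y)))"
    define cut where "cut = (\<lambda>\<eta>. 1 - \<omega> \<eta>)"
    define \<Phi> where "\<Phi> = (\<lambda>\<eta>. cut \<eta> * (Fx \<eta> * Gy \<eta>))"
    have Fx: "deriv_bound N AF ((L0 / 2) / s) Fx"
    proof (rule deriv_bound_mono)
      show "deriv_bound N AF (1 / s * 1) Fx" unfolding Fx_def
        by (rule deriv_bound_affine_comp[OF AF(2)]) (use s in auto)
      show "1 / s * 1 \<le> L0 / 2 / s" using L0(3) s by (simp add: field_simps)
    qed (use AF s in auto)
    have Gy: "deriv_bound N AG ((L0 / 2) / s) Gy"
    proof (rule deriv_bound_mono)
      show "deriv_bound N AG (1 / t * 1) Gy" unfolding Gy_def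
        by (rule deriv_bound_affine_comp[OF AG(2)]) (use t in auto)
    qed (use AG t st in auto)
    have FG: "deriv_bound N (AF * AG) (L0 / s) (\<lambda>\<eta>. Fx \<eta> * Gy \<eta>)"
      using deriv_bound_mult[OF Fx Gy] by simp
    have cut: "deriv_bound N (1 + A\<omega>) 1 cut" unfolding cut_def by (rule deriv_bound_one_minus[OF A\<omega>(2)])
    have tFx: "test_function UNIV Fx" "supp Fx \<subseteq> ball x (R * s)"
      unfolding Fx_def using test_function_affine_comp[OF F(1) s F(2)] by auto
    have tGy: "test_function UNIV Gy"
      unfolding Gy_def using test_function_affine_comp[OF G(1) t G(2)] by auto
    have t\<Phi>: "test_function (- {0}) \<Phi>" unfolding \<Phi>_def cut_def
      using tGy by (intro test_function_cutoff_mult test_function_mult tFx \<omega> \<omega>1) (auto simp: test_function_def)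
    have "supp \<Phi> \<subseteq> supp Fx" unfolding \<Phi>_def
      using supp_mult_subset(2)[of cut "\<lambda>\<eta>. Fx \<eta> * Gy \<eta>"] supp_mult_subset(1)[of Fx Gy] by blast
    then have s\<Phi>: "supp \<Phi> \<subseteq> ball x (R * freq_scale \<alpha> x)" using tFx(2) unfolding s_def by blast
    have "deriv_bound N A (2 * L0 / s) \<Phi>"
    \<comment> \<open>For \<open>norm x \<le> K2\<close> the scale \<open>s\<close> is at most
      \<open>L0\<close>, so derivatives of size 1 are also bounded at the rate
      \<open>L0 / s\<close>. For larger \<open>x\<close> the support of the first bump avoids the
      open unit ball, and the cutoff factor is 1 there.\<close>
    proof (cases "norm x \<le> K2")
      case True
      have "freq_scale \<alpha> x \<le> K2 powr \<bar>1 - \<alpha>\<bar> * 1 powr (1 - \<alpha>)"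
      proof (rule powr_comparable)
        show "1 \<le> K2 * norm x" using mult_mono[OF K2 x] K2 by simp
      qed (use True pos K2 in auto)
      moreover have "0 \<le> K2 powr \<bar>1 - \<alpha>\<bar>" by simp
      ultimately have "s \<le> L0" using L0(2) unfolding s_def powr_one_eq_one by linarith
      then have "1 \<le> L0 / s" using s by simp
      then have "deriv_bound N (1 + A\<omega>) (L0 / s) cut"
        using A\<omega> by (intro deriv_bound_mono[OF cut]) auto
      from deriv_bound_mult[OF this FG] show ?thesis by (simp add: \<Phi>_def A_def)
    next
      case False
      have "\<Phi> \<eta> = Fx \<eta> * Gy \<eta>" for \<eta>
      proof (cases "\<eta> \<in> supp Fx")
        case True
        then have "norm (\<eta> - x) \<le> R * freq_scale \<alpha> x"
          using tFx(2) by (force simp: s_def dist_norm norm_minus_commute)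
        then have "norm x \<le> K2 * max 1 (norm \<eta>)" using ball[OF x] by blast
        then have "\<not> norm \<eta> < 1" using \<open>\<not> norm x \<le> K2\<close> by (auto simp: max_def)
        then have "1 \<le> norm \<eta>" by simp
        then show ?thesis by (simp add: \<Phi>_def cut_def \<omega>0)
      qed (simp add: \<Phi>_def not_in_supp)
      then have "\<Phi> = (\<lambda>\<eta>. Fx \<eta> * Gy \<eta>)" by blast
      moreover have "1 * (AF * AG) \<le> A" unfolding A_def using AF AG A\<omega> by (intro mult_right_mono) auto
      ultimately show ?thesis using s L0 AF AG A
        by (auto intro!: deriv_bound_mono[OF FG] divide_right_mono)
    qed
    then have D: "deriv_bound N A (2 * L0 / freq_scale \<alpha> x) \<Phi>" by (simp add: s_def)
    show ?thesis
      using main[OF x J t\<Phi> s\<Phi> A D, of v] unfolding \<Phi>_def Fx_def Gy_def cut_def s_def t_def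
      by (simp only: mult.assoc)
  qed
  then show ?thesis using C A by (intro exI[of _ "C * A"]) auto
qed

text \<open>The Fourier transforms of the packets are rescaled bumps times exponentials. Taking the
  modulus removes the constant phases in \<open>c\<close> and \<open>d\<close>, and the remaining
  exponential sees the lattice points only through their difference. With one index fixed this is a
  shifted lattice in the other.\<close>

lemma norm_gram:
  fixes m \<omega> :: "real^'n \<Rightarrow> complex" and \<phi> :: "real^'n \<Rightarrow> real"
  defines "F \<equiv> fourier (\<lambda>t. complex_of_real (\<phi> t))"
  assumes \<phi>: "integrable lborel \<phi>" and F: "test_function UNIV F" "supp F \<subseteq> ball 0 R"
    and m: "locally_integrable_on m (- {0})" and m0: "\<And>\<eta>. \<eta> \<noteq> 0 \<Longrightarrow> m \<eta> \<noteq> 0 \<Longrightarrow> 1 \<le> norm \<eta>"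
    and \<omega>: "test_function UNIV \<omega>" "\<And>x. norm x \<le> 1/2 \<Longrightarrow> \<omega> x = 1" "\<And>x. 1 \<le> norm x \<Longrightarrow> \<omega> x = 0"
    and \<xi>: "\<xi> k \<noteq> 0" "\<xi> k' \<noteq> 0"
  shows "cmod (gram \<alpha> b \<rho> \<phi> \<xi> m j' k' j k) =
    1 / (2 * pi) ^ CARD('n) * (norm (\<xi> k) powr (- (real CARD('n) / 2 * (1 - \<alpha>))) *
      norm (\<xi> k') powr (- (real CARD('n) / 2 * (1 - \<alpha>)))) *
    cmod (LINT \<eta>|lebesgue. m \<eta> * (((1 - \<omega> \<eta>) *
      (rescale \<alpha> F (\<xi> k) \<eta> *
       cnj (rescale \<alpha> F (\<xi> k') \<eta>))) *
      cis ((lattice_point \<alpha> b \<rho> (\<xi> k') j' - lattice_point \<alpha> b \<rho> (\<xi> k) j) \<bullet> \<eta>)))"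
proof -
  define x where "x = \<xi> k"
  define y where "y = \<xi> k'"
  define p where "p = lattice_point \<alpha> b \<rho> x j"
  define q where "q = lattice_point \<alpha> b \<rho> y j'"
  define s where "s = freq_scale \<alpha> x"
  define t where "t = freq_scale \<alpha> y"
  have s: "0 < s" and t: "0 < t" using \<xi> by (auto simp: s_def t_def x_def y_def)
  define c where "c = complex_of_real (norm x powr (- (real CARD('n) / 2 * (1 - \<alpha>)))) * cis (p \<bullet> x)"
  define d where "d = complex_of_real (norm y powr (- (real CARD('n) / 2 * (1 - \<alpha>)))) * cis (q \<bullet> y)"
  define Fx where "Fx = (\<lambda>\<eta>. F ((1 / s) *\<^sub>R (\<eta> - x)))"
  define Fy where "Fy = (\<lambda>\<eta>. F ((1 / t) *\<^sub>R (\<eta> - y)))"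
  define U where "U = (\<lambda>\<eta>. Fx \<eta> * cnj (Fy \<eta>) * cis ((q - p) \<bullet> \<eta>))"
  have tF: "test_function UNIV Fx" "test_function UNIV (\<lambda>\<eta>. cnj (Fy \<eta>))"
    unfolding Fx_def Fy_def using test_function_affine_comp(1)[OF F(1) _ F(2)] s t test_function_cnj by blast+
  have tU: "test_function UNIV U" unfolding U_def
    using tF(2) by (intro test_function_mult tF(1) smooth_cis_inner) (simp add: test_function_def)
  have fx: "fourier (packet \<alpha> \<phi> p x) \<eta> = c * (Fx \<eta> * cis ((- p) \<bullet> \<eta>))" for \<eta>
  proof -
    have "cis (- (p \<bullet> (\<eta> - x))) = cis (p \<bullet> x) * cis ((- p) \<bullet> \<eta>)"
      unfolding cis_mult by (simp add: inner_diff_right)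
    then show ?thesis using fourier_packet[OF \<phi>, of x \<alpha> p \<eta>] \<xi>
      by (simp add: Fx_def F_def c_def s_def x_def mult_ac)
  qed
  have fy: "fourier (packet \<alpha> \<phi> q y) \<eta> = d * (Fy \<eta> * cis ((- q) \<bullet> \<eta>))" for \<eta>
  proof -
    have "cis (- (q \<bullet> (\<eta> - y))) = cis (q \<bullet> y) * cis ((- q) \<bullet> \<eta>)"
      unfolding cis_mult by (simp add: inner_diff_right)
    then show ?thesis using fourier_packet[OF \<phi>, of y \<alpha> q \<eta>] \<xi>
      by (simp add: Fy_def F_def d_def t_def y_def mult_ac)
  qed
  have "integrable lebesgue (\<lambda>\<eta>. m \<eta> * (Fx \<eta> * cis ((- p) \<bullet> \<eta>)))"
    by (rule integral_mult_test_cutoff(1)[OF m m0 test_function_mult[OF tF(1) smooth_cis_inner] \<omega>])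
  then have "integrable lebesgue (\<lambda>\<eta>. c * (m \<eta> * (Fx \<eta> * cis ((- p) \<bullet> \<eta>))))" by (rule integrable_mult_right)
  then have int: "integrable lebesgue (\<lambda>\<eta>. m \<eta> * fourier (packet \<alpha> \<phi> p x) \<eta>)"
    unfolding fx by (simp only: mult.left_commute)
  have "integrable lborel (packet \<alpha> \<phi> q y)" using integrable_packet[OF \<phi>] \<xi> by (simp add: y_def)
  then have int_q: "integrable lebesgue (packet \<alpha> \<phi> q y)" by (simp add: integrable_completion borel_measurable_integrable)
  have "gram \<alpha> b \<rho> \<phi> \<xi> m j' k' j k = (LINT \<eta>|lebesgue. (m \<eta> * fourier (packet \<alpha> \<phi> p x) \<eta>) *
      cnj (fourier (packet \<alpha> \<phi> q y) \<eta>)) / complex_of_real ((2 * pi) ^ CARD('n))"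
    unfolding gram_def multiplier_op_def
    using l2_inner_inv_fourier[OF int int_q] unfolding p_def q_def x_def y_def .
  also have "(\<lambda>\<eta>. (m \<eta> * fourier (packet \<alpha> \<phi> p x) \<eta>) * cnj (fourier (packet \<alpha> \<phi> q y) \<eta>)) =
      (\<lambda>\<eta>. (c * cnj d) * (m \<eta> * U \<eta>))"
  proof
    fix \<eta>
    have "cis ((- p) \<bullet> \<eta>) * cnj (cis ((- q) \<bullet> \<eta>)) = cis ((q - p) \<bullet> \<eta>)"
      by (simp add: cis_cnj cis_mult inner_diff_left)
    then show "(m \<eta> * fourier (packet \<alpha> \<phi> p x) \<eta>) * cnj (fourier (packet \<alpha> \<phi> q y) \<eta>) = (c * cnj d) * (m \<eta> * U \<eta>)"
      unfolding fx fy U_def complex_cnj_mult by (metis (no_types, lifting) mult.assoc mult.left_commute)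
  qed
  also have "(LINT \<eta>|lebesgue. (c * cnj d) * (m \<eta> * U \<eta>)) = (c * cnj d) * (LINT \<eta>|lebesgue. m \<eta> * U \<eta>)"
    by (rule integral_mult_right_zero)
  also have "(LINT \<eta>|lebesgue. m \<eta> * U \<eta>) = (LINT \<eta>|lebesgue. m \<eta> * ((1 - \<omega> \<eta>) * U \<eta>))"
    by (rule integral_mult_test_cutoff(2)[OF m m0 tU \<omega>])
  finally have "gram \<alpha> b \<rho> \<phi> \<xi> m j' k' j k = (c * cnj d) * (LINT \<eta>|lebesgue. m \<eta> * ((1 - \<omega> \<eta>) * U \<eta>)) /
      complex_of_real ((2 * pi) ^ CARD('n))" .
  then have "cmod (gram \<alpha> b \<rho> \<phi> \<xi> m j' k' j k) = 1 / (2 * pi) ^ CARD('n) * (cmod c * cmod d) *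
      cmod (LINT \<eta>|lebesgue. m \<eta> * ((1 - \<omega> \<eta>) * U \<eta>))"
    by (simp add: norm_mult norm_divide norm_power)
  moreover have "cmod c = norm x powr (- (real CARD('n) / 2 * (1 - \<alpha>)))"
    "cmod d = norm y powr (- (real CARD('n) / 2 * (1 - \<alpha>)))"
    by (simp_all add: c_def d_def norm_mult)
  ultimately show ?thesis
    unfolding U_def Fx_def Fy_def s_def t_def p_def q_def x_def y_def by (simp only: mult.assoc)
qed

text \<open>With \<open>n\<close> the dimension, two normalizing powers \<open>z powr e\<close>
  cancel \<open>(z powr (1 - \<alpha>)) ^ n\<close> exactly; the rest exchanges comparable
  quantities. \<open>z\<close> may be either norm because the row and column estimates are localized
  at different centers. The power of 2 comes from \<open>1 + a \<le> 2 * a\<close>.\<close>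

lemma normalization_bound:
  fixes a b K \<alpha> \<mu> :: real and n :: nat
  assumes ab: "1 \<le> a" "1 \<le> b" "a \<le> K * b" "b \<le> K * a" and K: "1 \<le> K" and z: "z = a \<or> z = b"
  defines "e \<equiv> - (real n / 2 * (1 - \<alpha>))"
  shows "a powr e * b powr e * ((z powr (1 - \<alpha>)) ^ n * z powr (- \<mu>)) \<le>
    K powr \<bar>e\<bar> * (K powr \<bar>\<mu>\<bar> * 2 powr \<bar>\<mu>\<bar>) * (1 + a) powr (- \<mu>)"
proof -
  have pos: "0 < a" "0 < b" using ab by linarith+
  have self: "r \<le> K * r" if "0 < r" for r using mult_right_mono[OF K, of r] that by simp
  have zpos: "0 < z" using z pos by auto
  have le: "a powr e * b powr e \<le> K powr \<bar>e\<bar> * (z powr e * z powr e)"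
    using z
  proof
    assume "z = a"
    then show ?thesis using mult_left_mono[OF powr_comparable[of a b K e], of "a powr e"] pos ab K
      by (simp add: mult_ac)
  next
    assume "z = b"
    then show ?thesis using mult_right_mono[OF powr_comparable[of b a K e], of "b powr e"] pos ab K
      by (simp add: mult_ac)
  qed
  have "(z powr (1 - \<alpha>)) ^ n = z powr ((1 - \<alpha>) * real n)"
    using zpos by (simp add: powr_powr flip: powr_realpow)
  then have "z powr e * z powr e * (z powr (1 - \<alpha>)) ^ n = z powr (e + e + (1 - \<alpha>) * real n)"
    by (simp only: powr_add)
  also have "\<dots> = 1" using zpos by (simp add: e_def)
  finally have one: "z powr e * z powr e * (z powr (1 - \<alpha>)) ^ n = 1" .
  have "a powr e * b powr e * ((z powr (1 - \<alpha>)) ^ n * z powr (- \<mu>)) \<le>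
      K powr \<bar>e\<bar> * (z powr e * z powr e) * ((z powr (1 - \<alpha>)) ^ n * z powr (- \<mu>))"
    by (rule mult_right_mono[OF le]) (simp add: zpos)
  also have "\<dots> = K powr \<bar>e\<bar> * z powr (- \<mu>)" using one by (simp add: mult.assoc[symmetric])
  also have "z powr (- \<mu>) \<le> K powr \<bar>- \<mu>\<bar> * a powr (- \<mu>)"
    using z self[OF pos(1)] pos ab K by (intro powr_comparable) auto
  also have "a powr (- \<mu>) \<le> 2 powr \<bar>- \<mu>\<bar> * (1 + a) powr (- \<mu>)"
    using pos ab by (intro powr_comparable) auto
  finally show ?thesis by (simp add: mult_left_mono mult.assoc)
qed

lemma lattice_point_minus: "lattice_point \<alpha> b \<rho> \<xi> (- j) = - lattice_point \<alpha> b \<rho> \<xi> j"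
  by (simp add: lattice_point_def vec_eq_iff)

text \<open>The sum over \<open>j'\<close> uses the ball and lattice of \<open>\<xi> k'\<close>, the
  sum over \<open>j\<close> those of \<open>\<xi> k\<close>; hence \<open>packet_product_sum\<close>
  is used twice, with the conjugated bump in first or second place. Comparability then states both
  bounds in terms of \<open>\<xi> k\<close>.\<close>

lemma gram_row_column_sums:
  fixes m :: "real^'n \<Rightarrow> complex" and \<omega> :: "real^'n \<Rightarrow> complex" and \<phi> :: "real^'n \<Rightarrow> real" and \<xi> :: "nat \<Rightarrow> real^'n"
  assumes hm: "hoermander_miyachi \<alpha> \<mu> m" and \<alpha>: "0 < \<alpha>" and R: "1 \<le> R"
    and b: "0 < b" "0 < \<rho>" "b * \<rho> * R < pi"
    and \<phi>: "integrable lborel \<phi>"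
    and F: "test_function UNIV (fourier (\<lambda>t. complex_of_real (\<phi> t)))"
      "supp (fourier (\<lambda>t. complex_of_real (\<phi> t))) \<subseteq> ball 0 R"
    and m: "locally_integrable_on m (- {0})" and m0: "\<And>\<eta>. \<eta> \<noteq> 0 \<Longrightarrow> m \<eta> \<noteq> 0 \<Longrightarrow> 1 \<le> norm \<eta>"
    and \<omega>: "test_function UNIV \<omega>" "\<And>x. norm x \<le> 1/2 \<Longrightarrow> \<omega> x = 1" "\<And>x. 1 \<le> norm x \<Longrightarrow> \<omega> x = 0"
    and \<xi>: "\<And>k. 1 \<le> norm (\<xi> k)" and K: "1 \<le> K"
  shows "\<exists>C>0. \<forall>k k' J j j'. norm (\<xi> k) \<le> K * norm (\<xi> k') \<longrightarrow> norm (\<xi> k') \<le> K * norm (\<xi> k) \<longrightarrow> finite J \<longrightarrow>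
    (\<Sum>j'\<in>J. cmod (gram \<alpha> b \<rho> \<phi> \<xi> m j' k' j k)) \<le> C * (1 + norm (\<xi> k)) powr (- \<mu>) \<and>
    (\<Sum>j\<in>J. cmod (gram \<alpha> b \<rho> \<phi> \<xi> m j' k' j k)) \<le> C * (1 + norm (\<xi> k)) powr (- \<mu>)"
proof -
  let ?G = "gram \<alpha> b \<rho> \<phi> \<xi> m"
  define F where "F = fourier (\<lambda>t. complex_of_real (\<phi> t))"
  note F = F[folded F_def]
  have cF: "test_function UNIV (\<lambda>\<eta>. cnj (F \<eta>))" "supp (\<lambda>\<eta>. cnj (F \<eta>)) \<subseteq> ball 0 R"
    using test_function_cnj[OF F(1)] F(2) by auto
  obtain C1 where C1: "0 \<le> C1" and row: "\<And>x y v J. 1 \<le> norm x \<Longrightarrow> 1 \<le> norm y \<Longrightarrow> norm x \<le> K * norm y \<Longrightarrow>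
    norm y \<le> K * norm x \<Longrightarrow> finite J \<Longrightarrow>
    (\<Sum>j\<in>J. cmod (LINT \<eta>|lebesgue. m \<eta> * (((1 - \<omega> \<eta>) * (rescale \<alpha> F x \<eta> *
        cnj (rescale \<alpha> F y \<eta>))) * cis ((v + lattice_point \<alpha> b \<rho> x j) \<bullet> \<eta>))))
      \<le> C1 * ((freq_scale \<alpha> x) ^ CARD('n) * norm x powr (- \<mu>))"
    using packet_product_sum[OF hm \<alpha> R b F cF \<omega> K] by blast
  obtain C2 where C2: "0 \<le> C2" and col: "\<And>x y v J. 1 \<le> norm x \<Longrightarrow> 1 \<le> norm y \<Longrightarrow> norm x \<le> K * norm y \<Longrightarrow>
    norm y \<le> K * norm x \<Longrightarrow> finite J \<Longrightarrow>
    (\<Sum>j\<in>J. cmod (LINT \<eta>|lebesgue. m \<eta> * (((1 - \<omega> \<eta>) * (cnj (rescale \<alpha> F x \<eta>) *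
        rescale \<alpha> F y \<eta>)) * cis ((v + lattice_point \<alpha> b \<rho> x j) \<bullet> \<eta>))))
      \<le> C2 * ((freq_scale \<alpha> x) ^ CARD('n) * norm x powr (- \<mu>))"
    using packet_product_sum[OF hm \<alpha> R b cF F \<omega> K] by blast
  define e where "e = - (real CARD('n) / 2 * (1 - \<alpha>))"
  define P where "P = 1 / (2 * pi) ^ CARD('n)"
  have P: "0 < P" by (simp add: P_def)
  define Q where "Q = K powr \<bar>e\<bar> * (K powr \<bar>\<mu>\<bar> * 2 powr \<bar>\<mu>\<bar>)"
  have Q: "0 \<le> Q" by (simp add: Q_def)
  define C where "C = P * max C1 C2 * Q + 1"
  have C: "0 < C" unfolding C_def using P C1 Q by (intro add_nonneg_pos mult_nonneg_nonneg) auto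
  have nz: "\<xi> k \<noteq> 0" for k using \<xi>[of k] by auto
  have ng: "cmod (?G j' k' j k) = P * (norm (\<xi> k) powr e * norm (\<xi> k') powr e) *
    cmod (LINT \<eta>|lebesgue. m \<eta> * (((1 - \<omega> \<eta>) *
      (rescale \<alpha> F (\<xi> k) \<eta> *
       cnj (rescale \<alpha> F (\<xi> k') \<eta>))) *
      cis ((lattice_point \<alpha> b \<rho> (\<xi> k') j' - lattice_point \<alpha> b \<rho> (\<xi> k) j) \<bullet> \<eta>)))" for j j' k k'
    unfolding P_def e_def F_def by (rule norm_gram[OF \<phi> F[unfolded F_def] m m0 \<omega> nz nz])
  have combine: "P * (norm (\<xi> k) powr e * norm (\<xi> k') powr e) * S \<le> C * (1 + norm (\<xi> k)) powr (- \<mu>)"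
    if S: "S \<le> C' * ((freq_scale \<alpha> (\<xi> l)) ^ CARD('n) * norm (\<xi> l) powr (- \<mu>))" and C': "0 \<le> C'" "C' \<le> max C1 C2"
      and l: "l = k \<or> l = k'" and kk': "norm (\<xi> k) \<le> K * norm (\<xi> k')" "norm (\<xi> k') \<le> K * norm (\<xi> k)" for k k' l S C'
  proof -
    have "P * (norm (\<xi> k) powr e * norm (\<xi> k') powr e) * S \<le>
        P * (norm (\<xi> k) powr e * norm (\<xi> k') powr e) * (C' * ((freq_scale \<alpha> (\<xi> l)) ^ CARD('n) * norm (\<xi> l) powr (- \<mu>)))"
      using P by (intro mult_left_mono S) auto
    also have "\<dots> = P * C' * (norm (\<xi> k) powr e * norm (\<xi> k') powr e * ((freq_scale \<alpha> (\<xi> l)) ^ CARD('n) * norm (\<xi> l) powr (- \<mu>)))"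
      by (simp only: mult_ac)
    also have "\<dots> \<le> P * C' * (Q * (1 + norm (\<xi> k)) powr (- \<mu>))"
      unfolding Q_def e_def using P C' l
      by (intro mult_left_mono normalization_bound \<xi> kk' K) auto
    also have "\<dots> \<le> P * max C1 C2 * (Q * (1 + norm (\<xi> k)) powr (- \<mu>))"
      using P C' Q by (intro mult_right_mono mult_left_mono) auto
    also have "\<dots> \<le> C * (1 + norm (\<xi> k)) powr (- \<mu>)" unfolding C_def by (simp add: distrib_right)
    finally show ?thesis .
  qed
  have "(\<Sum>j'\<in>J. cmod (?G j' k' j k)) \<le> C * (1 + norm (\<xi> k)) powr (- \<mu>) \<and>
    (\<Sum>j\<in>J. cmod (?G j' k' j k)) \<le> C * (1 + norm (\<xi> k)) powr (- \<mu>)"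
    if kk': "norm (\<xi> k) \<le> K * norm (\<xi> k')" "norm (\<xi> k') \<le> K * norm (\<xi> k)" and J: "finite J" for k k' J j j'
  proof
    show "(\<Sum>j'\<in>J. cmod (?G j' k' j k)) \<le> C * (1 + norm (\<xi> k)) powr (- \<mu>)"
      unfolding ng sum_distrib_left[symmetric]
    proof (rule combine[OF _ C2 _ _ kk', of _ k'])
      show "(\<Sum>j'\<in>J. cmod (LINT \<eta>|lebesgue. m \<eta> * ((1 - \<omega> \<eta>) * (rescale \<alpha> F (\<xi> k) \<eta> *
          cnj (rescale \<alpha> F (\<xi> k') \<eta>)) *
          cis ((lattice_point \<alpha> b \<rho> (\<xi> k') j' - lattice_point \<alpha> b \<rho> (\<xi> k) j) \<bullet> \<eta>))))
        \<le> C2 * ((freq_scale \<alpha> (\<xi> k')) ^ CARD('n) * norm (\<xi> k') powr (- \<mu>))"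
        using col[OF \<xi> \<xi> kk'(2,1) J, of "- lattice_point \<alpha> b \<rho> (\<xi> k) j"]
        by (simp only: mult.commute[of "cnj _"] uminus_add_conv_diff)
    qed auto
    show "(\<Sum>j\<in>J. cmod (?G j' k' j k)) \<le> C * (1 + norm (\<xi> k)) powr (- \<mu>)"
      unfolding ng sum_distrib_left[symmetric]
    proof (rule combine[OF _ C1 _ _ kk', of _ k])
      \<comment> \<open>The lattice point of \<open>j\<close> enters with a minus sign, so the
        estimate is applied to the reflected set \<open>uminus\<close> followed by reindexing to
        \<open>J\<close>.\<close>
      define f where "f = (\<lambda>p. cmod (LINT \<eta>|lebesgue. m \<eta> * ((1 - \<omega> \<eta>) * (rescale \<alpha> F (\<xi> k) \<eta> *
          cnj (rescale \<alpha> F (\<xi> k') \<eta>)) *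
          cis (p \<bullet> \<eta>))))"
      have "(\<Sum>j\<in>uminus ` J. f (lattice_point \<alpha> b \<rho> (\<xi> k') j' + lattice_point \<alpha> b \<rho> (\<xi> k) j))
        \<le> C1 * ((freq_scale \<alpha> (\<xi> k)) ^ CARD('n) * norm (\<xi> k) powr (- \<mu>))"
        unfolding f_def using row[OF \<xi> \<xi> kk', of "uminus ` J" "lattice_point \<alpha> b \<rho> (\<xi> k') j'"] J by blast
      then have "(\<Sum>j\<in>J. f (lattice_point \<alpha> b \<rho> (\<xi> k') j' - lattice_point \<alpha> b \<rho> (\<xi> k) j))
        \<le> C1 * ((freq_scale \<alpha> (\<xi> k)) ^ CARD('n) * norm (\<xi> k) powr (- \<mu>))"
        by (subst (asm) sum.reindex) (simp_all add: lattice_point_minus)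
      then show "(\<Sum>j\<in>J. cmod (LINT \<eta>|lebesgue. m \<eta> * ((1 - \<omega> \<eta>) * (rescale \<alpha> F (\<xi> k) \<eta> *
          cnj (rescale \<alpha> F (\<xi> k') \<eta>)) *
          cis ((lattice_point \<alpha> b \<rho> (\<xi> k') j' - lattice_point \<alpha> b \<rho> (\<xi> k) j) \<bullet> \<eta>))))
        \<le> C1 * ((freq_scale \<alpha> (\<xi> k)) ^ CARD('n) * norm (\<xi> k) powr (- \<mu>))" unfolding f_def .
    qed auto
  qed
  then show ?thesis using C by blast
qed

lemma family_fourier_supp_subset:
  assumes "supp (fourier (\<lambda>t. complex_of_real (\<phi> t))) \<subseteq> ball 0 R" "\<xi> \<noteq> 0"
    and "\<eta> \<in> family_fourier_supp \<alpha> \<phi> \<xi>"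
  shows "norm (\<eta> - \<xi>) \<le> R * freq_scale \<alpha> \<xi>"
proof -
  have "norm (\<eta> - \<xi>) < R * freq_scale \<alpha> \<xi>"
    using assms by (intro rescaled_in_ball) (auto simp: family_fourier_supp_def subset_eq)
  then show ?thesis by simp
qed

theorem lemma5p3:
  fixes \<alpha> \<mu> \<rho>0 a b Acov \<rho> :: real
    and \<phi> :: "real^'n \<Rightarrow> real"
    and \<xi> :: "nat \<Rightarrow> real^'n"
    and m :: "real^'n \<Rightarrow> complex"
  assumes "0 < \<alpha>"
    and "0 < \<rho>0" "0 < a" "0 < b" "1 < Acov"
    and "covering_constant TYPE('n) \<alpha> \<rho>0 a Acov"
    and "subdyadic_frame_pair \<alpha> \<rho>0 a b Acov \<phi> \<rho> \<xi>"
    and "\<forall>\<eta>. \<eta> \<noteq> 0 \<and> m \<eta> \<noteq> 0 \<longrightarrow> norm \<eta> powr \<alpha> \<ge> 1"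
    and "hoermander_miyachi \<alpha> \<mu> m"
  shows "(\<forall>k k'. family_fourier_supp \<alpha> \<phi> (\<xi> k) \<inter> family_fourier_supp \<alpha> \<phi> (\<xi> k') = {} \<longrightarrow>
            (\<forall>j j'. gram \<alpha> b \<rho> \<phi> \<xi> m j' k' j k = 0))
      \<and> (\<exists>M::nat. \<forall>k.
            (let S = {k'. family_fourier_supp \<alpha> \<phi> (\<xi> k) \<inter> family_fourier_supp \<alpha> \<phi> (\<xi> k') \<noteq> {}};
                 I = {k'. \<exists>j j'. gram \<alpha> b \<rho> \<phi> \<xi> m j' k' j k \<noteq> 0 \<or> gram \<alpha> b \<rho> \<phi> \<xi> m j k j' k' \<noteq> 0}
             in finite S \<and> card S \<le> M \<and> finite I \<and> card I \<le> M))
      \<and> (\<exists>C::real. \<forall>k k'.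
            family_fourier_supp \<alpha> \<phi> (\<xi> k) \<inter> family_fourier_supp \<alpha> \<phi> (\<xi> k') \<noteq> {} \<longrightarrow>
            (SUP j. \<Sum>\<^sub>\<infinity>j'. ennreal (cmod (gram \<alpha> b \<rho> \<phi> \<xi> m j' k' j k))) +
            (SUP j'. \<Sum>\<^sub>\<infinity>j. ennreal (cmod (gram \<alpha> b \<rho> \<phi> \<xi> m j' k' j k)))
              \<le> ennreal (C * (1 + norm (\<xi> k)) powr (- \<mu>)))
      \<and> (\<forall>p q \<beta>. 1 \<le> p \<and> 1 \<le> q \<longrightarrow>
            bounded_matrix_operator (gram \<alpha> b \<rho> \<phi> \<xi> m)
              (mixed_norm q p (\<beta> - \<mu>) \<xi>) (mixed_norm q p \<beta> \<xi>))"
proof -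
  let ?G = "gram \<alpha> b \<rho> \<phi> \<xi> m"
  define F where "F = fourier (\<lambda>t. complex_of_real (\<phi> t))"
  note \<alpha> = assms(1) and hm = assms(9)
  have \<rho>: "0 < \<rho>" and centers: "subdyadic_centers \<alpha> a \<rho> \<xi>" and tF: "test_function UNIV F"
    and sw: "schwartz \<phi>"
    using assms(7) unfolding subdyadic_frame_pair_def F_def by (simp_all add: Let_def)
  have "\<exists>R0 R1 m0. 3 * 2 powr max (\<alpha> - 1) 0 < R0 \<and> R0 < R1 \<and> 0 < m0 \<and>
           supp F \<subseteq> ball 0 R1 \<and> (\<forall>\<zeta>. norm \<zeta> \<le> R0 \<longrightarrow> m0 \<le> cmod (F \<zeta>)) \<and>
           Acov * \<rho> < R0 \<and> b * \<rho> * R1 < pi"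
    using assms(7) unfolding subdyadic_frame_pair_def F_def by (simp add: Let_def)
  then obtain R0 R m0 where R0: "3 * 2 powr max (\<alpha> - 1) 0 < R0" and R0R: "R0 < R" and m0: "0 < m0"
    and sF: "supp F \<subseteq> ball 0 R" and low: "\<forall>\<zeta>. norm \<zeta> \<le> R0 \<longrightarrow> m0 \<le> cmod (F \<zeta>)" and bR: "b * \<rho> * R < pi"
    by (elim exE conjE) (rule that)
  have "(1::real) \<le> 2 powr max (\<alpha> - 1) 0" by (intro ge_one_powr_ge_zero) auto
  then have "1 < R0" using R0 by linarith
  then have R: "1 \<le> R" "0 < R" using R0R by linarith+
  \<comment> \<open>This single value supports both the integrability of \<open>\<phi>\<close> and
    the construction of the cutoff.\<close>
  have F0: "F 0 \<noteq> 0" using low[rule_format, of 0] m0 \<open>1 < R0\<close> by auto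
  \<comment> \<open>A non-integrable function would have vanishing Fourier transform.\<close>
  have \<phi>: "integrable lborel \<phi>"
  proof -
    have "(LINT t|lebesgue. complex_of_real (\<phi> t)) \<noteq> 0" using F0 by (simp add: F_def fourier_def)
    then have "integrable lebesgue (\<lambda>t. complex_of_real (\<phi> t))" by (metis not_integrable_integral_eq)
    then have "integrable lebesgue (\<lambda>t. Re (complex_of_real (\<phi> t)))" by (rule integrable_Re)
    then have "integrable lebesgue \<phi>" by simp
    moreover have "\<phi> \<in> borel_measurable borel"
      using sw by (intro borel_measurable_continuous_onI smooth_imp_continuous) (simp add: schwartz_def)
    ultimately show ?thesis by (simp add: integrable_completion)
  qed
  obtain \<omega> :: "real^'n \<Rightarrow> complex" where \<omega>: "test_function UNIV \<omega>"
    "\<And>x. norm x \<le> 1/2 \<Longrightarrow> \<omega> x = 1" "\<And>x. 1 \<le> norm x \<Longrightarrow> \<omega> x = 0"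
    using smooth_cutoff[OF tF F0] by blast
  have m_supp: "1 \<le> norm \<eta>" if "\<eta> \<noteq> 0" "m \<eta> \<noteq> 0" for \<eta>
  proof (rule ccontr)
    assume "\<not> 1 \<le> norm \<eta>"
    then have "norm \<eta> powr \<alpha> < 1 powr \<alpha>" using \<alpha> by (intro powr_less_mono2) auto
    then show False using assms(8) that by fastforce
  qed
  \<comment> \<open>Order 0 is used only to read off local integrability of \<open>m\<close>, which
    is part of the definition of a weak derivative.\<close>
  obtain g where "weak_deriv (- {0}) (unit_multi (undefined::'n) 0) m g"
    using hoermander_miyachi_pure[OF hm \<alpha> R(1), of 0] by blast
  then have m: "locally_integrable_on m (- {0})" by (simp add: weak_deriv_def)
  note \<xi> = subdyadic_centers_norm_ge_1[OF centers]
  have nz: "\<xi> k \<noteq> 0" for k using \<xi>[of k] by auto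
  define fam where "fam = (\<lambda>k. family_fourier_supp \<alpha> \<phi> (\<xi> k))"
  define S where "S = (\<lambda>k. {k'. fam k \<inter> fam k' \<noteq> {}})"
  have near: "interacting \<alpha> R (\<xi> k) (\<xi> k')" if k': "k' \<in> S k" for k k'
  proof -
    obtain \<eta> where "\<eta> \<in> fam k" "\<eta> \<in> fam k'" using k' unfolding S_def by blast
    then show ?thesis
      using family_fourier_supp_subset[OF sF[unfolded F_def] nz] unfolding fam_def by blast
  qed
  have zero: "?G j' k' j k = 0" if k': "k' \<notin> S k" for j j' k k'
  proof -
    have "rescale \<alpha> F (\<xi> k) \<eta> * cnj (rescale \<alpha> F (\<xi> k') \<eta>) = 0" for \<eta>
    proof -
      have "\<eta> \<notin> fam k \<or> \<eta> \<notin> fam k'" using k' by (auto simp: S_def)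
      then show ?thesis
        using not_in_supp[of _ F] unfolding fam_def family_fourier_supp_def F_def[symmetric] by auto
    qed
    note product_zero = this
    have "cmod (?G j' k' j k) =
      1 / (2 * pi) ^ CARD('n) * (norm (\<xi> k) powr (- (real CARD('n) / 2 * (1 - \<alpha>))) *
        norm (\<xi> k') powr (- (real CARD('n) / 2 * (1 - \<alpha>)))) *
      cmod (LINT \<eta>|lebesgue. m \<eta> * (((1 - \<omega> \<eta>) *
        (rescale \<alpha> F (\<xi> k) \<eta> *
         cnj (rescale \<alpha> F (\<xi> k') \<eta>))) *
        cis ((lattice_point \<alpha> b \<rho> (\<xi> k') j' - lattice_point \<alpha> b \<rho> (\<xi> k) j) \<bullet> \<eta>)))"
      unfolding F_def by (rule norm_gram[OF \<phi> tF[unfolded F_def] sF[unfolded F_def] m m_supp \<omega> nz nz])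
    then show ?thesis unfolding product_zero by simp
  qed
  obtain M where M: "\<And>k. finite {k'. interacting \<alpha> R (\<xi> k) (\<xi> k')}"
    "\<And>k. card {k'. interacting \<alpha> R (\<xi> k) (\<xi> k')} \<le> M"
    using finitely_many_neighbours[OF \<alpha> R(2) assms(3) \<rho> centers] by blast
  have S_sub: "S k \<subseteq> {k'. interacting \<alpha> R (\<xi> k) (\<xi> k')}" for k
    using near by blast
  have S_fin: "finite (S k)" for k by (rule finite_subset[OF S_sub M(1)])
  have S_card: "card (S k) \<le> M" for k by (rule order_trans[OF card_mono[OF M(1) S_sub] M(2)])
  have S_sym: "k \<in> S k' \<longleftrightarrow> k' \<in> S k" for k k' unfolding S_def by blast
  obtain K where K: "1 \<le> K" and cmp: "\<And>x y z :: real^'n. 1 \<le> norm x \<Longrightarrow> 1 \<le> norm y \<Longrightarrow>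
    norm (z - x) \<le> R * freq_scale \<alpha> x \<Longrightarrow> norm (z - y) \<le> R * freq_scale \<alpha> y \<Longrightarrow>
    norm y \<le> K * norm x"
    using interacting_norm_le[OF \<alpha> R(2), where 'a="real^'n"] by blast
  have comparable: "norm (\<xi> k') \<le> K * norm (\<xi> k)" if "k' \<in> S k" for k k'
    using near[OF that] cmp[OF \<xi> \<xi>] by blast
  obtain C where C: "0 < C" and sums: "\<And>k k' J j j'. norm (\<xi> k) \<le> K * norm (\<xi> k') \<Longrightarrow> norm (\<xi> k') \<le> K * norm (\<xi> k) \<Longrightarrow> finite J \<Longrightarrow>
    (\<Sum>j'\<in>J. cmod (?G j' k' j k)) \<le> C * (1 + norm (\<xi> k)) powr (- \<mu>) \<and>
    (\<Sum>j\<in>J. cmod (?G j' k' j k)) \<le> C * (1 + norm (\<xi> k)) powr (- \<mu>)"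
    using gram_row_column_sums[where \<xi> = \<xi>, OF hm \<alpha> R(1) assms(4) \<rho> bR \<phi> tF[unfolded F_def] sF[unfolded F_def] m m_supp \<omega> \<xi> K]
    by blast
  define \<omega>' where "\<omega>' = (\<lambda>k. C * (1 + norm (\<xi> k)) powr (- \<mu>))"
  have \<omega>': "0 < \<omega>' k" for k
  proof -
    have "0 < 1 + norm (\<xi> k)" by (intro add_pos_nonneg) auto
    then show ?thesis unfolding \<omega>'_def using C by simp
  qed
  have col: "(\<Sum>j'\<in>J. cmod (?G j' k' j k)) \<le> \<omega>' k"
    and row: "(\<Sum>j\<in>J. cmod (?G j' k' j k)) \<le> \<omega>' k"
    if "k' \<in> S k" "finite J" for k k' J j j'
    using sums[OF comparable comparable] that S_sym unfolding \<omega>'_def by blast+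
  have part3: "(SUP j. \<Sum>\<^sub>\<infinity>j'. ennreal (cmod (?G j' k' j k))) +
      (SUP j'. \<Sum>\<^sub>\<infinity>j. ennreal (cmod (?G j' k' j k)))
      \<le> ennreal (2 * C * (1 + norm (\<xi> k)) powr (- \<mu>))" if "k' \<in> S k" for k k'
  proof -
    have "(SUP j. \<Sum>\<^sub>\<infinity>j'. ennreal (cmod (?G j' k' j k))) \<le> ennreal (\<omega>' k)"
      by (intro SUP_least ennreal_infsum_le) (simp add: col[OF that] ennreal_leI)
    moreover have "(SUP j'. \<Sum>\<^sub>\<infinity>j. ennreal (cmod (?G j' k' j k))) \<le> ennreal (\<omega>' k)"
      by (intro SUP_least ennreal_infsum_le) (simp add: row[OF that] ennreal_leI)
    ultimately have "(SUP j. \<Sum>\<^sub>\<infinity>j'. ennreal (cmod (?G j' k' j k))) +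
      (SUP j'. \<Sum>\<^sub>\<infinity>j. ennreal (cmod (?G j' k' j k))) \<le> ennreal (\<omega>' k) + ennreal (\<omega>' k)"
      by (rule add_mono)
    also have "\<dots> = ennreal (2 * C * (1 + norm (\<xi> k)) powr (- \<mu>))"
      using \<omega>'[of k] by (simp add: ennreal_plus[symmetric] \<omega>'_def del: ennreal_plus)
    finally show ?thesis .
  qed
  have part4: "bounded_matrix_operator (?G) (mixed_norm q p (\<beta> - \<mu>) \<xi>) (mixed_norm q p \<beta> \<xi>)"
    if p: "1 \<le> p" and q: "1 \<le> q" for p q \<beta>
  proof -
    have pos: "0 < 1 + norm (\<xi> k)" for k by (intro add_pos_nonneg) auto
    have pw: "0 < (1 + norm (\<xi> k)) powr z" for k z using pos[of k] by simp
    have "\<omega>' k * (1 + norm (\<xi> k')) powr \<beta> \<le> (C * K powr \<bar>\<beta>\<bar>) * (1 + norm (\<xi> k)) powr (\<beta> - \<mu>)"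
      if kk': "k \<in> S k'" for k k'
    proof -
      \<comment> \<open>Comparability moves the weight with exponent \<beta> from \<open>k'\<close>
        to \<open>k\<close> for either sign of \<beta>; the factor \<open>\<omega>' k\<close>
        supplies the exponent - \<mu>.\<close>
      have "1 + norm (\<xi> k') \<le> K * (1 + norm (\<xi> k))" "1 + norm (\<xi> k) \<le> K * (1 + norm (\<xi> k'))"
        using comparable[of k' k] comparable[OF kk'] kk' S_sym K by (simp_all add: distrib_left add_mono)
      then have "(1 + norm (\<xi> k')) powr \<beta> \<le> K powr \<bar>\<beta>\<bar> * (1 + norm (\<xi> k)) powr \<beta>"
        using K pos by (intro powr_comparable) auto
      then have "\<omega>' k * (1 + norm (\<xi> k')) powr \<beta> \<le> \<omega>' k * (K powr \<bar>\<beta>\<bar> * (1 + norm (\<xi> k)) powr \<beta>)"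
        using \<omega>'[of k] by (intro mult_left_mono) auto
      also have "\<dots> = (C * K powr \<bar>\<beta>\<bar>) * (1 + norm (\<xi> k)) powr (\<beta> - \<mu>)"
        unfolding \<omega>'_def diff_conv_add_uminus[of \<beta> \<mu>] powr_add by (simp only: mult_ac)
      finally show ?thesis .
    qed
    note weights = this
    show ?thesis
      unfolding mixed_norm_def[abs_def]
      by (rule banded_matrix_bounded[where S = S, OF S_fin S_card S_sym _ \<omega>' _ _ _ _ weights p q])
         (use zero S_sym row col pw in auto)
  qed
  have I_sub: "{k'. \<exists>j j'. ?G j' k' j k \<noteq> 0 \<or> ?G j k j' k' \<noteq> 0} \<subseteq> S k" for k
    using zero S_sym by blast
  have fam: "family_fourier_supp \<alpha> \<phi> (\<xi> k) = fam k" for k by (simp add: fam_def)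
  show ?thesis
    unfolding Let_def fam
  proof (intro conjI exI[of _ M] exI[of _ "2 * C"] allI impI)
    show "?G j' k' j k = 0" if "fam k \<inter> fam k' = {}" for k k' j j'
      using zero[of k' k] that by (simp add: S_def)
    show "finite {k'. fam k \<inter> fam k' \<noteq> {}}" "card {k'. fam k \<inter> fam k' \<noteq> {}} \<le> M" for k
      using S_fin S_card unfolding S_def by auto
    show "finite {k'. \<exists>j j'. ?G j' k' j k \<noteq> 0 \<or> ?G j k j' k' \<noteq> 0}" for k
      by (rule finite_subset[OF I_sub S_fin])
    show "card {k'. \<exists>j j'. ?G j' k' j k \<noteq> 0 \<or> ?G j k j' k' \<noteq> 0} \<le> M" for k
      by (rule order_trans[OF card_mono[OF S_fin I_sub] S_card])
    show "(SUP j. \<Sum>\<^sub>\<infinity>j'. ennreal (cmod (?G j' k' j k))) +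
        (SUP j'. \<Sum>\<^sub>\<infinity>j. ennreal (cmod (?G j' k' j k)))
        \<le> ennreal (2 * C * (1 + norm (\<xi> k)) powr (- \<mu>))" if "fam k \<inter> fam k' \<noteq> {}" for k k'
      using part3[of k' k] that by (simp add: S_def)
    show "bounded_matrix_operator (?G) (mixed_norm q p (\<beta> - \<mu>) \<xi>) (mixed_norm q p \<beta> \<xi>)"
      if "1 \<le> p \<and> 1 \<le> q" for p q \<beta>
      using part4 that by blast
  qed
qed

end
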